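(* Let $\mathfrak g$ be a simple Lie algebra and $\sigma_1$ a Hermitian involution of $\mathfrak g$, associated with the short grading $\mathfrak g=\mathfrak g(-1)\oplus\mathfrak g(0)\oplus\mathfrak g(1)$, and let $e$ be an element of the dense $G(0)$-orbit in $\mathfrak g(1)$. Suppose that $\mathfrak g(0)^e$ is reductive. Then $\sigma_1$ can be included in a triad, i.e. there exist involutions $\sigma_2,\sigma_3$ of $\mathfrak g$ such that $\{\sigma_1,\sigma_2,\sigma_3\}$ is a triad.
   Context: The ground field is algebraically closed of characteristic $0$; $G$ is a connected algebraic group with simple Lie algebra $\mathfrak g$. An involution $\sigma$ of $\mathfrak g$ is Hermitian if its fixed-point subalgebra $\mathfrak g^\sigma$ is not semisimple. Each Hermitian involution comes from a $\mathbb Z$-grading with exactly three nonzero terms (short grading) $\mathfrak g=\mathfrak g(-1)\oplus\mathfrak g(0)\oplus\mathfrak g(1)$, with $\mathfrak g^\sigma=\mathfrak g(0)$ and $(-1)$-eigenspace $\mathfrak g(-1)\oplus\mathfrak g(1)$. $G(0)$ is the connected subgroup of $G$ with Lie algebra $\mathfrak g(0)$; it has finitely many orbits in $\mathfrak g(1)$, hence a dense one. $\mathfrak g(0)^e=\{x\in\mathfrak g(0)\mid[x,e]=0\}$; it is the Lie algebra of the stabiliser of $e$ in $G(0)$, and "reductive" is meant in the sense of algebraic Lie algebras (the stabiliser is a reductive group). Two involutions are conjugate if they are conjugate by an inner automorphism of $\mathfrak g$. A triad is a set of three involutions $\{\sigma_1,\sigma_2,\sigma_3\}$ of $\mathfrak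 g$ which are all conjugate to each other and satisfy $\sigma_1\sigma_2=\sigma_3$ (so they commute pairwise). *)

theory Defs
  imports "HOL-Analysis.Analysis" "HOL-Computational_Algebra.Polynomial"
begin

section \<open>Polynomial functions and the Zariski topology of a vector space\<close>

inductive polynomial_fun :: "('k::field \<Rightarrow> 'v::ab_group_add \<Rightarrow> 'v) \<Rightarrow> ('v \<Rightarrow> 'k) \<Rightarrow> bool"
  for s :: "'k \<Rightarrow> 'v \<Rightarrow> 'v" where
  const: "polynomial_fun s (\<lambda>_. c)"
| functional: "Vector_Spaces.linear s (*) f \<Longrightarrow> polynomial_fun s f"
| add: "polynomial_fun s p \<Longrightarrow> polynomial_fun s q \<Longrightarrow> polynomial_fun s (\<lambda>x. p x + q x)"
| mult: "polynomial_fun s p \<Longrightarrow> polynomial_fun s q \<Longrightarrow> polynomial_fun s (\<lambda>x. p x * q x)"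

definition zariski_topology :: "('k::field \<Rightarrow> 'v::ab_group_add \<Rightarrow> 'v) \<Rightarrow> 'v topology" where
  "zariski_topology s =
     topology (\<lambda>U. \<exists>P. P \<subseteq> {p. polynomial_fun s p} \<and> U = {x. \<exists>p\<in>P. p x \<noteq> 0})"

lemma istopology_zariski:
  "istopology (\<lambda>U. \<exists>P. P \<subseteq> {p. polynomial_fun s p} \<and> U = {x. \<exists>p\<in>P. p x \<noteq> 0})"
proof -
  let ?O = "\<lambda>U. \<exists>P. P \<subseteq> {p. polynomial_fun s p} \<and> U = {x. \<exists>p\<in>P. p x \<noteq> 0}"
  have "?O (U \<inter> V)" if U: "?O U" and V: "?O V" for U V
  proof -
    obtain P where P: "P \<subseteq> {p. polynomial_fun s p}" "U = {x. \<exists>p\<in>P. p x \<noteq> 0}"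
      using U by blast
    obtain Q where Q: "Q \<subseteq> {p. polynomial_fun s p}" "V = {x. \<exists>p\<in>Q. p x \<noteq> 0}"
      using V by blast
    let ?R = "{\<lambda>x. p x * q x | p q. p \<in> P \<and> q \<in> Q}"
    have "?R \<subseteq> {p. polynomial_fun s p}"
      using P(1) Q(1) by (auto intro: polynomial_fun.mult)
    moreover have "U \<inter> V = {x. \<exists>r\<in>?R. r x \<noteq> 0}"
      unfolding P(2) Q(2) by (auto; metis mult_eq_0_iff)
    ultimately show ?thesis by blast
  qed
  moreover have "?O (\<Union>\<K>)" if K: "\<forall>U\<in>\<K>. ?O U" for \<K>
  proof -
    let ?R = "{p. polynomial_fun s p \<and> {x. p x \<noteq> 0} \<subseteq> \<Union>\<K>}"
    have "\<exists>p\<in>?R. p x \<noteq> 0" if "x \<in> U" "U \<in> \<K>" for x U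
    proof -
      obtain P where P: "P \<subseteq> {p. polynomial_fun s p}" "U = {x. \<exists>p\<in>P. p x \<noteq> 0}"
        using K \<open>U \<in> \<K>\<close> by blast
      with that show ?thesis by blast
    qed
    then have "\<Union>\<K> = {x. \<exists>p\<in>?R. p x \<noteq> 0}" by blast
    moreover have "?R \<subseteq> {p. polynomial_fun s p}" by blast
    ultimately show ?thesis by blast
  qed
  ultimately show ?thesis unfolding istopology_def by blast
qed

lemma openin_zariski_topology:
  "openin (zariski_topology s) U \<longleftrightarrow>
     (\<exists>P. P \<subseteq> {p. polynomial_fun s p} \<and> U = {x. \<exists>p\<in>P. p x \<noteq> 0})"
  unfolding zariski_topology_def by (simp add: istopology_zariski topology_inverse')

lemma polynomial_fun_on_line:
  assumes "polynomial_fun s p"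
  shows "\<exists>q. \<forall>t. p (x + s t v) = poly q t"
  using assms
proof induction
  case (const c)
  have "\<forall>t. c = poly [:c:] t" by simp
  then show ?case by blast
next
  case (functional f)
  then interpret Vector_Spaces.linear s "(*)" f .
  have "\<forall>t. f (x + s t v) = poly [:f x, f v:] t" by (simp add: add scale)
  then show ?case by blast
next
  case (add p q)
  then obtain p' q' where "\<forall>t. p (x + s t v) = poly p' t" "\<forall>t. q (x + s t v) = poly q' t"
    by blast
  then have "\<forall>t. p (x + s t v) + q (x + s t v) = poly (p' + q') t" by simp
  then show ?case by blast
next
  case (mult p q)
  then obtain p' q' where "\<forall>t. p (x + s t v) = poly p' t" "\<forall>t. q (x + s t v) = poly q' t"
    by blast
  then have "\<forall>t. p (x + s t v) * q (x + s t v) = poly (p' * q') t" by simp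
  then show ?case by blast
qed

definition nilpotent_map :: "('v::zero \<Rightarrow> 'v) \<Rightarrow> bool" where
  "nilpotent_map f \<longleftrightarrow> (\<exists>m. \<forall>x. (f ^^ m) x = 0)"

section \<open>Linear algebraic groups\<close>

definition mscale :: "'k::field \<Rightarrow> 'k^'n^'n \<Rightarrow> 'k^'n^'n" where
  "mscale c A = (\<chi> i j. c * A $ i $ j)"

lemma vector_space_mscale: "vector_space mscale"
  by unfold_locales (auto simp: mscale_def vec_eq_iff algebra_simps)

text \<open>Closed subgroups of the general linear group; the closed subsets of the latter are traces
  of Zariski closed sets of matrices.\<close>

definition linear_algebraic_group :: "('k::field^'n^'n) set \<Rightarrow> bool" where
  "linear_algebraic_group G \<longleftrightarrow>
     closedin (subtopology (zariski_topology mscale) {A. invertible A}) G \<and>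
     mat 1 \<in> G \<and> (\<forall>A\<in>G. \<forall>B\<in>G. A ** B \<in> G) \<and> (\<forall>A\<in>G. matrix_inv A \<in> G)"

definition connected_linear_algebraic_group :: "('k::field^'n^'n) set \<Rightarrow> bool" where
  "connected_linear_algebraic_group G \<longleftrightarrow>
     linear_algebraic_group G \<and> connectedin (zariski_topology mscale) G"

text \<open>The tangent space at the identity: \<open>X\<close> is tangent iff every polynomial function \<open>p\<close>
  vanishing on \<open>G\<close> has derivative \<open>0\<close> at the identity in the direction \<open>X\<close>. This derivative is
  formal: \<open>t \<mapsto> p (1 + t X)\<close> is given by a polynomial \<open>q\<close> (see
  \<open>polynomial_fun_on_line\<close>), unique over an infinite field.\<close>

definition lie_algebra_of :: "('k::field^'n^'n) set \<Rightarrow> ('k^'n^'n) set" where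
  "lie_algebra_of G =
     {X. \<forall>p. polynomial_fun mscale p \<and> (\<forall>A\<in>G. p A = 0) \<longrightarrow>
           (\<exists>q. (\<forall>t. p (mat 1 + mscale t X) = poly q t) \<and> poly (pderiv q) 0 = 0)}"

definition unipotent_matrix :: "'k::field^'n^'n \<Rightarrow> bool" where
  "unipotent_matrix A \<longleftrightarrow> nilpotent_map (\<lambda>v. A *v v - v)"

text \<open>Reductive, not necessarily connected: the unipotent radical is trivial.\<close>

definition reductive_group :: "('k::field^'n^'n) set \<Rightarrow> bool" where
  "reductive_group H \<longleftrightarrow> linear_algebraic_group H \<and>
     (\<forall>U. connected_linear_algebraic_group U \<and> U \<subseteq> H \<and>
          (\<forall>A\<in>H. \<forall>B\<in>U. A ** B ** matrix_inv A \<in> U) \<and> (\<forall>B\<in>U. unipotent_matrix B)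
          \<longrightarrow> U = {mat 1})"

section \<open>Lie algebras and their involutions\<close>

locale lie_algebra = finite_dimensional_vector_space scale Basis
  for scale :: "'k::{alg_closed_field,field_char_0} \<Rightarrow> 'g::ab_group_add \<Rightarrow> 'g"
    and Basis :: "'g set" +
  fixes bracket :: "'g \<Rightarrow> 'g \<Rightarrow> 'g"
  assumes linear_left: "Vector_Spaces.linear scale scale (\<lambda>x. bracket x y)"
    and linear_right: "Vector_Spaces.linear scale scale (\<lambda>y. bracket x y)"
    and alternating: "bracket x x = 0"
    and jacobi: "bracket x (bracket y z) + bracket y (bracket z x) + bracket z (bracket x y) = 0"
begin

definition lie_ideal :: "'g set \<Rightarrow> 'g set \<Rightarrow> bool" where
  "lie_ideal I L \<longleftrightarrow> subspace I \<and> I \<subseteq> L \<and> (\<forall>x\<in>L. \<forall>y\<in>I. bracket x y \<in> I)"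

definition simple :: bool where
  "simple \<longleftrightarrow> (\<exists>x y. bracket x y \<noteq> 0) \<and> (\<forall>I. lie_ideal I UNIV \<longrightarrow> I = {0} \<or> I = UNIV)"

definition derived_algebra :: "'g set \<Rightarrow> 'g set" where
  "derived_algebra L = span {bracket x y | x y. x \<in> L \<and> y \<in> L}"

definition solvable :: "'g set \<Rightarrow> bool" where
  "solvable L \<longleftrightarrow> (\<exists>n. (derived_algebra ^^ n) L = {0})"

definition semisimple :: "'g set \<Rightarrow> bool" where
  "semisimple L \<longleftrightarrow> (\<forall>I. lie_ideal I L \<and> solvable I \<longrightarrow> I = {0})"

definition automorphism :: "('g \<Rightarrow> 'g) \<Rightarrow> bool" where
  "automorphism \<sigma> \<longleftrightarrow> Vector_Spaces.linear scale scale \<sigma> \<and> bij \<sigma> \<and>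
     (\<forall>x y. \<sigma> (bracket x y) = bracket (\<sigma> x) (\<sigma> y))"

definition involution :: "('g \<Rightarrow> 'g) \<Rightarrow> bool" where
  "involution \<sigma> \<longleftrightarrow> automorphism \<sigma> \<and> \<sigma> \<circ> \<sigma> = id \<and> \<sigma> \<noteq> id"

definition hermitian_involution :: "('g \<Rightarrow> 'g) \<Rightarrow> bool" where
  "hermitian_involution \<sigma> \<longleftrightarrow> involution \<sigma> \<and> \<not> semisimple {x. \<sigma> x = x}"

text \<open>The exponential series, summed over its nonzero terms; these are finite in number when
  \<open>f\<close> is nilpotent, the only case in which it is used.\<close>

definition exp_nilpotent :: "('g \<Rightarrow> 'g) \<Rightarrow> 'g \<Rightarrow> 'g" where
  "exp_nilpotent f v = (\<Sum>i | (f ^^ i) v \<noteq> 0. scale (1 / fact i) ((f ^^ i) v))"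

text \<open>The group generated by the \<open>exp (ad x)\<close> with \<open>ad x\<close> nilpotent. Closure under inverses is
  automatic, the inverse of \<open>exp (ad x)\<close> being \<open>exp (ad (- x))\<close>.\<close>

inductive_set inner_automorphisms :: "('g \<Rightarrow> 'g) set" where
  id: "id \<in> inner_automorphisms"
| exp_ad: "nilpotent_map (bracket x) \<Longrightarrow> \<tau> \<in> inner_automorphisms \<Longrightarrow>
     exp_nilpotent (bracket x) \<circ> \<tau> \<in> inner_automorphisms"

definition conjugate_inv :: "('g \<Rightarrow> 'g) \<Rightarrow> ('g \<Rightarrow> 'g) \<Rightarrow> bool" where
  "conjugate_inv \<sigma> \<sigma>' \<longleftrightarrow> (\<exists>\<tau>\<in>inner_automorphisms. \<sigma>' = \<tau> \<circ> \<sigma> \<circ> inv \<tau>)"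

definition triad :: "('g \<Rightarrow> 'g) set \<Rightarrow> bool" where
  "triad T \<longleftrightarrow> card T = 3 \<and> (\<forall>\<sigma>\<in>T. involution \<sigma>) \<and>
     (\<forall>\<sigma>\<in>T. \<forall>\<sigma>'\<in>T. conjugate_inv \<sigma> \<sigma>') \<and>
     (\<exists>\<sigma>\<^sub>1 \<sigma>\<^sub>2 \<sigma>\<^sub>3. T = {\<sigma>\<^sub>1, \<sigma>\<^sub>2, \<sigma>\<^sub>3} \<and> \<sigma>\<^sub>1 \<circ> \<sigma>\<^sub>2 = \<sigma>\<^sub>3)"

definition z_grading :: "(int \<Rightarrow> 'g set) \<Rightarrow> bool" where
  "z_grading gr \<longleftrightarrow> (\<forall>i. subspace (gr i)) \<and>
     (\<forall>x. \<exists>!c :: int \<Rightarrow> 'g. finite {i. c i \<noteq> 0} \<and> (\<forall>i. c i \<in> gr i) \<and> x = (\<Sum>i | c i \<noteq> 0. c i)) \<and>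
     (\<forall>i j. \<forall>x\<in>gr i. \<forall>y\<in>gr j. bracket x y \<in> gr (i + j))"

definition short_grading :: "(int \<Rightarrow> 'g set) \<Rightarrow> bool" where
  "short_grading gr \<longleftrightarrow> z_grading gr \<and> (\<forall>i. gr i \<noteq> {0} \<longleftrightarrow> i \<in> {-1, 0, 1})"

definition associated_grading :: "('g \<Rightarrow> 'g) \<Rightarrow> (int \<Rightarrow> 'g set) \<Rightarrow> bool" where
  "associated_grading \<sigma> gr \<longleftrightarrow> {x. \<sigma> x = x} = gr 0 \<and>
     {x. \<sigma> x = - x} = {y + z | y z. y \<in> gr (-1) \<and> z \<in> gr 1}"

text \<open>\<open>\<phi>\<close> identifies the Lie algebra at hand with the Lie algebra of the group \<open>G\<close>. Every
  algebraic group with simple Lie algebra is affine, hence isomorphic to a group of matrices.\<close>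

definition lie_algebra_iso :: "('g \<Rightarrow> 'k^'n^'n) \<Rightarrow> ('k^'n^'n) set \<Rightarrow> bool" where
  "lie_algebra_iso \<phi> G \<longleftrightarrow> Vector_Spaces.linear scale mscale \<phi> \<and> inj \<phi> \<and>
     range \<phi> = lie_algebra_of G \<and>
     (\<forall>x y. \<phi> (bracket x y) = \<phi> x ** \<phi> y - \<phi> y ** \<phi> x)"

text \<open>The adjoint action of the group, transported to the Lie algebra along \<open>\<phi>\<close>.\<close>

definition Ad :: "('g \<Rightarrow> 'k^'n^'n) \<Rightarrow> 'k^'n^'n \<Rightarrow> 'g \<Rightarrow> 'g" where
  "Ad \<phi> A x = inv \<phi> (A ** \<phi> x ** matrix_inv A)"

text \<open>Reductivity in the sense of algebraic Lie algebras: \<open>L\<close> is the Lie algebra of a reductive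
  algebraic group. This is stronger than reductivity of \<open>L\<close> as an abstract Lie algebra, which a
  one-dimensional algebra of nilpotent matrices satisfies. In characteristic \<open>0\<close> a connected
  algebraic group is determined by its Lie algebra, and a group is reductive iff its identity
  component is; so \<open>L\<close> is reductive iff one, equivalently every, closed group with Lie algebra
  \<open>L\<close> is reductive.\<close>

definition reductive_algebraic :: "('g \<Rightarrow> 'k^'n^'n) \<Rightarrow> 'g set \<Rightarrow> bool" where
  "reductive_algebraic \<phi> L \<longleftrightarrow> (\<exists>H. reductive_group H \<and> lie_algebra_of H = \<phi> ` L)"

end

end

theory Submission
  imports Defs
begin

text \<open>The idea is to find an \<open>sl(2)\<close>-triple \<open>(e, h, f)\<close> with \<open>f \<in> gr (-1)\<close> such that \<open>ad h\<close> is
  twice the degree operator \<open>D\<close> of the grading. Then \<open>ad h\<close> has eigenvalues \<open>-2, 0, 2\<close>, so the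
  algebra is a sum of three- and one-dimensional modules of the triple, \<open>PGL(2)\<close> acts on it by inner
  automorphisms, and \<open>\<sigma>\<^sub>1\<close> is the action of \<open>diag(1, -1)\<close>. The three involutions
  \<open>diag(1, -1)\<close>, \<open>(0 1; 1 0)\<close> and \<open>(0 1; -1 0)\<close> of \<open>PGL(2)\<close> are conjugate and the product of the
  first two is the third; they give the triad (\<open>triad_from_triple\<close>).

  To find the triple, one first needs that the Killing form is nondegenerate
  (\<open>killing_nondegenerate\<close>). This is Cartan's criterion: if the form vanished, every \<open>ad x\<close> would be
  nilpotent, which Engel's theorem forbids. Next, \<open>[gr 0, v] = gr 1\<close> for a suitable \<open>v \<in> gr 1\<close>
  (\<open>exists_regular\<close>): take \<open>v\<close> with \<open>ad v\<close> of maximal rank on \<open>gr (-1)\<close>. An element of its kernel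
  is a sandwich element, that is, the square of its adjoint operator is zero, and nondegeneracy excludes
  nonzero ones. This condition on \<open>v\<close> is Zariski open, so the dense orbit satisfies it and
  \<open>[gr 0, e] = gr 1\<close> (\<open>dense_orbit_regular\<close>). The
  Jacobson--Morozov argument then gives a triple with \<open>h \<in> gr 0\<close> and \<open>f \<in> gr (-1)\<close>
  (\<open>jacobson_morozov_graded\<close>).

  Reductivity of the centraliser \<open>L\<close> of \<open>e\<close> in \<open>gr 0\<close> enters as follows. Since \<open>f\<close> lowers the
  degree, \<open>ad h\<close> has only the eigenvalues \<open>0\<close> and \<open>1\<close> on \<open>L\<close> (\<open>centralizer_weights\<close>). Let \<open>H\<close> be a
  reductive group with Lie algebra \<open>L\<close>, and let \<open>R\<close> be the radical of the trace form on the associative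
  algebra that \<open>L\<close> generates. The elements \<open>A\<close> of \<open>H\<close> with \<open>A - 1 \<in> R\<close> form a connected normal
  unipotent subgroup, so it is trivial, and \<open>L\<close> meets \<open>R\<close> only in \<open>0\<close>
  (\<open>reductive_trace_radical\<close>). An eigenvector of weight \<open>1\<close> lies in \<open>R\<close> because products with it have
  positive weights, hence trace \<open>0\<close>. So \<open>ad h\<close> vanishes on \<open>L\<close>. From this, the relations of the
  triple and the self-duality of \<open>gr 0\<close> under the Killing form force \<open>ad h = 2 D\<close>
  (\<open>characteristic_of_triple\<close>).\<close>

section \<open>Functionals and traces\<close>

lemma (in vector_space) exists_functional:
  assumes "subspace S" "x \<notin> S"
  shows "\<exists>f. Vector_Spaces.linear scale (*) f \<and> (\<forall>y\<in>S. f y = 0) \<and> f x = (1::'a)"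
proof -
  interpret vk: vector_space "(*) :: 'a \<Rightarrow> 'a \<Rightarrow> 'a"
    by unfold_locales (auto simp: algebra_simps)
  interpret vp: vector_space_pair scale "(*) :: 'a \<Rightarrow> 'a \<Rightarrow> 'a" by unfold_locales
  obtain B where B: "B \<subseteq> S" "independent B" "S \<subseteq> span B"
    using basis_exists[of S] by metis
  have sB: "span B = S" using B assms(1) by (simp add: span_subspace)
  have xB: "x \<notin> span B" using sB assms by simp
  then have ind: "independent (insert x B)" using B by (simp add: independent_insertI)
  have xnB: "x \<notin> B" using xB span_base by blast
  obtain f where f: "Vector_Spaces.linear scale (*) f"
     "\<forall>b\<in>insert x B. f b = (if b = x then 1 else 0)"
    using vp.linear_independent_extend[OF ind, of "\<lambda>b. if b = x then 1 else 0"] by blast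
  have "f y = 0" if "y \<in> S" for y
  proof -
    interpret f: Vector_Spaces.linear scale "(*)" f by fact
    show ?thesis using that sB f(2) xnB by (metis f.eq_0_on_span insertCI)
  qed
  then show ?thesis using f by auto
qed

locale alg_closed_space = finite_dimensional_vector_space scale Basis
  for scale :: "'k::{alg_closed_field,field_char_0} \<Rightarrow> 'g::ab_group_add \<Rightarrow> 'g"
    and Basis :: "'g set"
begin

abbreviation lin :: "('g \<Rightarrow> 'g) \<Rightarrow> bool" where
  "lin f \<equiv> Vector_Spaces.linear scale scale f"

lemma linI:
  assumes "\<And>x y. f (x + y) = f x + f y" "\<And>c x. f (scale c x) = scale c (f x)"
  shows "lin f"
  using assms by (simp add: Vector_Spaces.linear_iff vector_space_axioms)

lemma lin_add: "lin f \<Longrightarrow> f (x + y) = f x + f y"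
  and lin_scale: "lin f \<Longrightarrow> f (scale c x) = scale c (f x)"
  by (simp_all add: Vector_Spaces.linear_iff)

lemma lin_0: "lin f \<Longrightarrow> f 0 = 0"
  by (metis add_cancel_left_left lin_add)

lemma lin_diff: "lin f \<Longrightarrow> f (x - y) = f x - f y"
  by (metis add_diff_cancel diff_add_cancel lin_add)

lemma lin_neg: "lin f \<Longrightarrow> f (- x) = - f x"
  by (metis add.right_inverse add_eq_0_iff lin_0 lin_add)

lemma lin_sum: assumes "lin f" shows "f (\<Sum>i\<in>I. u i) = (\<Sum>i\<in>I. f (u i))"
  by (induction I rule: infinite_finite_induct) (simp_all add: lin_0[OF assms] lin_add[OF assms])

lemma lin_id: "lin (\<lambda>x. x)" by (rule linI) auto
lemma lin_comp: assumes "lin f" "lin g" shows "lin (\<lambda>x. f (g x))"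
  by (rule linI)
    (simp_all add: lin_add[OF assms(1)] lin_scale[OF assms(1)] lin_add[OF assms(2)] lin_scale[OF assms(2)])
lemma lin_plus: assumes "lin f" "lin g" shows "lin (\<lambda>x. f x + g x)"
  by (rule linI) (simp_all add: lin_add[OF assms(1)] lin_scale[OF assms(1)] lin_add[OF assms(2)]
      lin_scale[OF assms(2)] scale_right_distrib)
lemma lin_minus: assumes "lin f" "lin g" shows "lin (\<lambda>x. f x - g x)"
  by (rule linI) (simp_all add: lin_add[OF assms(1)] lin_scale[OF assms(1)] lin_add[OF assms(2)]
      lin_scale[OF assms(2)] scale_right_diff_distrib)
lemma lin_scaled: assumes "lin f" shows "lin (\<lambda>x. scale c (f x))"
  by (rule linI)
    (simp_all add: lin_add[OF assms(1)] lin_scale[OF assms(1)] scale_right_distrib mult.commute)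
lemma lin_zero: "lin (\<lambda>x. 0)" by (rule linI) auto
lemma lin_summed: "(\<And>i. i \<in> I \<Longrightarrow> lin (f i)) \<Longrightarrow> lin (\<lambda>x. \<Sum>i\<in>I. f i x)"
  by (induction I rule: infinite_finite_induct) (simp_all add: lin_zero lin_plus)
lemma lin_pow: "lin f \<Longrightarrow> lin (f ^^ n)"
proof (induction n)
  case 0 then show ?case using lin_id by (simp add: id_def)
next
  case (Suc n) then show ?case using lin_comp[of f "f ^^ n"] by (simp add: o_def)
qed

lemma scale_2: "scale 2 z = z + z" and scale_3: "scale 3 z = z + z + z"
  using scale_left_distrib[of 1 1 z] scale_left_distrib[of 2 1 z] by simp_all

definition tr :: "('g \<Rightarrow> 'g) \<Rightarrow> 'k" where
  "tr f = (\<Sum>b\<in>Basis. representation Basis (f b) b)"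

lemma expand_in_basis:
  assumes "finite B" "independent B" "span B = UNIV"
  shows "(\<Sum>b\<in>B. scale (representation B v b) b) = v"
  using sum_representation_eq[of B v B] assms by auto

text \<open>Both sums are \<open>\<Sum>b\<in>B. \<Sum>c\<in>C. f\<^sub>b\<^sub>c * g\<^sub>c\<^sub>b\<close> for the matrices of \<open>f\<close> and \<open>g\<close> with respect to
  the two bases. The two bases may differ, so \<open>g = id\<close> gives independence of the basis.\<close>

lemma trace_comp_commute:
  assumes B: "finite B" "independent B" "span B = UNIV"
    and C: "finite C" "independent C" "span C = UNIV"
    and f: "lin f" and g: "lin g"
  shows "(\<Sum>b\<in>B. representation B (f (g b)) b) = (\<Sum>c\<in>C. representation C (g (f c)) c)"
proof -
  have exp: "representation B' (u w) b
      = (\<Sum>c\<in>C'. representation C' w c * representation B' (u c) b)"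
    if "finite B'" "independent B'" "span B' = UNIV" "finite C'" "independent C'" "span C' = UNIV" "lin u"
    for B' C' u w b
  proof -
    have "u w = u (\<Sum>c\<in>C'. scale (representation C' w c) c)"
      using that expand_in_basis by simp
    also have "\<dots> = (\<Sum>c\<in>C'. scale (representation C' w c) (u c))"
      by (simp add: lin_sum[OF that(7)] lin_scale[OF that(7)])
    finally show ?thesis
      using that by (simp add: representation_sum representation_scale)
  qed
  have "(\<Sum>b\<in>B. representation B (f (g b)) b)
     = (\<Sum>b\<in>B. \<Sum>c\<in>C. representation C (g b) c * representation B (f c) b)"
    by (intro sum.cong refl exp) (use assms in auto)
  also have "\<dots> = (\<Sum>c\<in>C. \<Sum>b\<in>B. representation B (f c) b * representation C (g b) c)"
    by (subst sum.swap) (simp add: mult.commute)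
  also have "\<dots> = (\<Sum>c\<in>C. representation C (g (f c)) c)"
    by (intro sum.cong refl exp[symmetric]) (use assms in auto)
  finally show ?thesis .
qed

lemma tr_commute: "lin f \<Longrightarrow> lin g \<Longrightarrow> tr (\<lambda>x. f (g x)) = tr (\<lambda>x. g (f x))"
  unfolding tr_def
  by (rule trace_comp_commute) (auto simp: finite_Basis independent_Basis span_Basis)

lemma tr_any_basis:
  assumes "finite B" "independent B" "span B = UNIV" "lin f"
  shows "tr f = (\<Sum>b\<in>B. representation B (f b) b)"
  unfolding tr_def
  using trace_comp_commute[OF finite_Basis independent_Basis span_Basis assms(1-4) lin_id] by simp

lemma tr_plus: "lin f \<Longrightarrow> lin g \<Longrightarrow> tr (\<lambda>x. f x + g x) = tr f + tr g"
  unfolding tr_def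
  by (simp add: representation_add independent_Basis span_Basis sum.distrib)

lemma tr_minus: "lin f \<Longrightarrow> lin g \<Longrightarrow> tr (\<lambda>x. f x - g x) = tr f - tr g"
  unfolding tr_def
  by (simp add: representation_diff independent_Basis span_Basis sum_subtractf)

lemma tr_scaled: "lin f \<Longrightarrow> tr (\<lambda>x. scale c (f x)) = c * tr f"
  unfolding tr_def
  by (simp add: representation_scale independent_Basis span_Basis sum_distrib_left)

lemma tr_zero: "tr (\<lambda>x. 0) = 0"
  unfolding tr_def by (simp add: representation_zero)

lemma tr_summed: "(\<And>i. i \<in> I \<Longrightarrow> lin (f i)) \<Longrightarrow> tr (\<lambda>x. \<Sum>i\<in>I. f i x) = (\<Sum>i\<in>I. tr (f i))"
  by (induction I rule: infinite_finite_induct) (auto simp: tr_zero tr_plus lin_summed)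

lemma subspace_lin_image: "lin f \<Longrightarrow> subspace S \<Longrightarrow> subspace (f ` S)"
  by (rule module_hom.subspace_image[OF Vector_Spaces.linear.axioms(3)])

lemma exists_projection:
  assumes S: "subspace S"
  shows "\<exists>P. lin P \<and> (\<forall>x. P x \<in> S) \<and> (\<forall>x\<in>S. P x = x)"
proof -
  interpret p: vector_space_pair scale scale by unfold_locales
  obtain B where B: "B \<subseteq> S" "independent B" "S \<subseteq> span B"
    using basis_exists[of S] by metis
  obtain P where P: "lin P" "\<forall>x\<in>B. P x = x" "range P = span B"
    using p.linear_independent_extend_subspace[OF B(2), of "\<lambda>x. x"] by auto
  have sB: "span B = S" using B assms(1) by (simp add: span_subspace)
  have "P x = x" if "x \<in> S" for x
    using p.linear_eq_on[of P "\<lambda>x. x" x B] P that sB lin_id by auto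
  then show ?thesis using P sB by auto
qed

text \<open>If \<open>P\<close> projects onto the range of \<open>T\<close>, then \<open>T = P T\<close> has the same trace as \<open>T P\<close>, and the
  powers of \<open>T P\<close> vanish one step earlier than those of \<open>T\<close>.\<close>

lemma tr_nilpotent:
  assumes "lin T" "\<And>x. (T ^^ m) x = 0"
  shows "tr T = 0"
  using assms
proof (induction m arbitrary: T)
  case 0
  then have "T = (\<lambda>x. 0)" by auto
  then show ?case by (simp add: tr_zero)
next
  case (Suc m)
  have S: "subspace (range T)"
    by (rule subspace_lin_image[OF Suc.prems(1) subspace_UNIV])
  obtain P where P: "lin P" "\<And>x. P x \<in> range T" "\<And>x. x \<in> range T \<Longrightarrow> P x = x"
    using exists_projection[OF S] by blast
  have PT: "(\<lambda>x. P (T x)) = T" using P(3) by auto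
  have TP: "lin (\<lambda>x. T (P x))" using P Suc.prems lin_comp by blast
  have *: "((\<lambda>x. T (P x)) ^^ k) x = (T ^^ k) (P x)" if "k > 0" for k x
    using that
  proof (induction k)
    case 0 then show ?case by simp
  next
    case (Suc k)
    show ?case
    proof (cases "k = 0")
      case True then show ?thesis by simp
    next
      case False
      then obtain j where "k = Suc j" using not0_implies_Suc by blast
      then have "(T ^^ k) (P x) \<in> range T" by simp
      then have "P ((T ^^ k) (P x)) = (T ^^ k) (P x)" by (rule P(3))
      then show ?thesis using Suc.IH False by simp
    qed
  qed
  show ?case
  proof (cases "m = 0")
    case True
    then have "T = (\<lambda>x. 0)" using Suc.prems(2) by auto
    then show ?thesis by (simp add: tr_zero)
  next
    case False
    have "((\<lambda>x. T (P x)) ^^ m) x = 0" for x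
    proof -
      obtain y where "P x = T y" using P(2) by blast
      then have "(T ^^ m) (P x) = (T ^^ Suc m) y" by (simp add: funpow_swap1)
      then show ?thesis using * False Suc.prems(2) by simp
    qed
    then have "tr (\<lambda>x. T (P x)) = 0" using Suc.IH TP by blast
    then show ?thesis using tr_commute[OF P(1) Suc.prems(1)] PT by simp
  qed
qed

end

section \<open>Polynomials in an operator\<close>

lemma poly_bezout_no_common_root:
  fixes p q :: "'k::alg_closed_field poly"
  assumes "p \<noteq> 0" "\<And>x. poly p x = 0 \<Longrightarrow> poly q x \<noteq> 0"
  shows "\<exists>a b. a * p + b * q = 1"
proof -
  define I where "I = {a * p + b * q | a b. True}"
  have I_diff: "u - v * w \<in> I" if "u \<in> I" "w \<in> I" for u v w
  proof -
    obtain a b a' b' where "u = a * p + b * q" "w = a' * p + b' * q" using \<open>u \<in> I\<close> \<open>w \<in> I\<close>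
      unfolding I_def by blast
    then have "u - v * w = (a - v * a') * p + (b - v * b') * q" by (simp add: algebra_simps)
    then show ?thesis unfolding I_def by blast
  qed
  have "p = 1 * p + 0 * q" "q = 0 * p + 1 * q" by auto
  then have pq: "p \<in> I" "q \<in> I" unfolding I_def by blast+
  obtain d where d: "d \<in> I" "d \<noteq> 0" "\<And>u. u \<in> I \<Longrightarrow> u \<noteq> 0 \<Longrightarrow> degree d \<le> degree u"
    using ex_has_least_nat[of "\<lambda>u. u \<in> I \<and> u \<noteq> 0" p degree] pq assms(1) by blast
  have dvd: "d dvd u" if "u \<in> I" for u
  proof (rule ccontr)
    assume "\<not> d dvd u"
    then have nz: "u mod d \<noteq> 0" by (simp add: mod_eq_0_iff_dvd)
    have "u mod d = u - u div d * d" by (simp add: minus_div_mult_eq_mod)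
    then have "u mod d \<in> I" using I_diff that d(1) by simp
    then show False using d(3)[of "u mod d"] nz degree_mod_less[OF d(2), of u] by force
  qed
  have "degree d = 0"
  proof (rule ccontr)
    assume "degree d \<noteq> 0"
    then obtain x where "poly d x = 0" using alg_closed_imp_poly_has_root[of d] by auto
    then have "poly p x = 0" "poly q x = 0" using dvd pq by (meson poly_eq_0_iff_dvd dvd_trans)+
    then show False using assms(2) by blast
  qed
  then obtain c where c: "d = [:c:]" by (meson degree_eq_zeroE)
  obtain a b where ab: "d = a * p + b * q" using d(1) unfolding I_def by blast
  have c0: "c \<noteq> 0" using c d(2) by auto
  have "smult (inverse c) a * p + smult (inverse c) b * q = smult (inverse c) d"
    using ab by (simp add: smult_add_right)
  also have "\<dots> = 1" using c c0 by (simp add: one_pCons)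
  finally show ?thesis by blast
qed

context alg_closed_space
begin

text \<open>The operator \<open>p(T)\<close>, evaluated at a vector by the Horner scheme.\<close>

definition poly_op :: "'k poly \<Rightarrow> ('g \<Rightarrow> 'g) \<Rightarrow> 'g \<Rightarrow> 'g" where
  "poly_op p T v = fold_coeffs (\<lambda>a w. scale a v + T w) p 0"

lemma poly_op_0: "poly_op 0 T v = 0" by (simp add: poly_op_def)

lemma poly_op_pCons:
  assumes "lin T"
  shows "poly_op (pCons a p) T v = scale a v + T (poly_op p T v)"
  by (cases "p = 0 \<and> a = 0") (auto simp: poly_op_def lin_0[OF assms])

lemma poly_op_lin:
  assumes "lin T" shows "lin (poly_op p T)"
proof (induction p)
  case 0 then show ?case using lin_zero by (simp add: poly_op_0[abs_def])
next
  case (pCons a p)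
  have "poly_op (pCons a p) T = (\<lambda>v. scale a v + T (poly_op p T v))" using assms by (auto simp: poly_op_pCons)
  then show ?case using pCons by (simp add: lin_plus lin_scaled lin_id lin_comp assms)
qed

lemma poly_op_add: assumes "lin T" shows "poly_op (p + q) T v = poly_op p T v + poly_op q T v"
proof (induction p q rule: poly_induct2)
  case (pCons a p b q)
  then show ?case using assms
    by (simp add: poly_op_pCons lin_add[OF assms] scale_left_distrib algebra_simps)
qed (simp add: poly_op_0)

lemma poly_op_smult: assumes "lin T" shows "poly_op (smult c p) T v = scale c (poly_op p T v)"
  by (induction p)
    (simp_all add: poly_op_0 poly_op_pCons[OF assms] lin_scale[OF assms] scale_right_distrib)

lemma poly_op_mult: assumes "lin T" shows "poly_op (p * q) T v = poly_op p T (poly_op q T v)"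
  by (induction p) (simp_all add: poly_op_0 poly_op_pCons[OF assms] poly_op_add[OF assms] poly_op_smult[OF assms])

lemma poly_op_diff: assumes "lin T" shows "poly_op (p - q) T v = poly_op p T v - poly_op q T v"
  using poly_op_add[OF assms, of "p - q" q v] by simp

lemma poly_op_1: assumes "lin T" shows "poly_op 1 T v = v"
  by (simp add: one_pCons poly_op_pCons[OF assms] poly_op_0 lin_0[OF assms])

lemma poly_op_X: assumes "lin T" shows "poly_op [:- l, 1:] T v = T v - scale l v"
  by (simp add: poly_op_pCons[OF assms] poly_op_0 lin_0[OF assms] )

lemma poly_op_power: assumes "lin T" shows "poly_op (p ^ n) T v = ((poly_op p T) ^^ n) v"
  by (induction n) (simp_all add: poly_op_1[OF assms] poly_op_mult[OF assms])

lemma poly_op_sum: assumes "lin T" shows "poly_op (\<Sum>i\<in>I. p i) T v = (\<Sum>i\<in>I. poly_op (p i) T v)"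
  by (induction I rule: infinite_finite_induct) (simp_all add: poly_op_0 poly_op_add[OF assms])

lemma poly_op_monom: assumes "lin T" shows "poly_op (monom c n) T v = scale c ((T ^^ n) v)"
proof (induction n)
  case 0 then show ?case by (simp add: monom_0 poly_op_pCons[OF assms] poly_op_0 lin_0[OF assms])
next
  case (Suc n) then show ?case
    by (simp add: monom_Suc poly_op_pCons[OF assms] lin_scale[OF assms])
qed

lemma poly_op_commute:
  assumes "lin T" "lin S" "\<And>x. S (T x) = T (S x)"
  shows "S (poly_op p T v) = poly_op p T (S v)"
  by (induction p) (simp_all add: poly_op_0 poly_op_pCons[OF assms(1)] assms lin_0[OF assms(2)]
     lin_add[OF assms(2)] lin_scale[OF assms(2)])

lemma poly_op_poly_op_commute: assumes "lin T" shows "poly_op p T (poly_op q T v) = poly_op q T (poly_op p T v)"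
  using poly_op_mult[OF assms, of p q v] poly_op_mult[OF assms, of q p v] by (simp add: mult.commute)

lemma exists_annihilator_vec:
  assumes "lin T"
  shows "\<exists>p. p \<noteq> 0 \<and> poly_op p T v = 0"
proof (cases "inj_on (\<lambda>i. (T ^^ i) v) {..dimension}")
  case False
  then obtain i j where ij: "i \<noteq> j" "(T ^^ i) v = (T ^^ j) v" unfolding inj_on_def by blast
  have "coeff (monom (1::'k) i - monom 1 j) i \<noteq> 0" using ij(1) by simp
  then have "monom (1::'k) i - monom 1 j \<noteq> 0" by fastforce
  moreover have "poly_op (monom 1 i - monom 1 j) T v = 0"
    using ij by (simp add: poly_op_diff[OF assms] poly_op_monom[OF assms])
  ultimately show ?thesis by blast
next
  case True
  define S where "S = (\<lambda>i. (T ^^ i) v) ` {..dimension}"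
  have cS: "card S = dimension + 1" unfolding S_def by (simp add: card_image True)
  have "dependent S"
    using independent_card_le_dim[of S UNIV] cS by (metis dim_UNIV dimension_def
        Suc_eq_plus1 not_less_eq_eq subset_UNIV le_refl)
  then obtain u where u: "\<exists>w\<in>S. u w \<noteq> 0" "(\<Sum>w\<in>S. scale (u w) w) = 0"
    using dependent_finite[of S] unfolding S_def by auto
  define p where "p = (\<Sum>i\<le>dimension. monom (u ((T ^^ i) v)) i)"
  obtain j where j: "j \<le> dimension" "u ((T ^^ j) v) \<noteq> 0" using u(1) unfolding S_def by auto
  have "coeff p j = u ((T ^^ j) v)" using j unfolding p_def by (simp add: coeff_sum)
  then have "p \<noteq> 0" using j by auto
  moreover have "poly_op p T v = (\<Sum>w\<in>S. scale (u w) w)"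
    unfolding p_def S_def by (simp add: poly_op_sum[OF assms] poly_op_monom[OF assms] sum.reindex[OF True])
  ultimately show ?thesis using u(2) by auto
qed

lemma exists_annihilator:
  assumes "lin T"
  shows "\<exists>p. p \<noteq> 0 \<and> (\<forall>v. poly_op p T v = 0)"
proof -
  obtain P where P: "\<And>v. P v \<noteq> 0 \<and> poly_op (P v) T v = 0"
    using exists_annihilator_vec[OF assms] by metis
  define p where "p = (\<Prod>b\<in>Basis. P b)"
  have "p \<noteq> 0" using P finite_Basis by (simp add: p_def)
  have b: "poly_op p T b = 0" if "b \<in> Basis" for b
  proof -
    have "p = (\<Prod>b\<in>Basis - {b}. P b) * P b"
      using that finite_Basis by (simp add: p_def prod.remove mult.commute)
    then show ?thesis using P[of b] by (simp add: poly_op_mult[OF assms] lin_0[OF poly_op_lin[OF assms]])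
  qed
  have "poly_op p T v = 0" for v
  proof -
    have "v \<in> span Basis" by (simp add: span_Basis)
    then show ?thesis
    proof (induction rule: span_induct_alt)
      case base then show ?case by (simp add: lin_0[OF poly_op_lin[OF assms]])
    next
      case (step c x y) then show ?case
        by (simp add: lin_add[OF poly_op_lin[OF assms]] lin_scale[OF poly_op_lin[OF assms]] b)
    qed
  qed
  then show ?thesis using \<open>p \<noteq> 0\<close> by blast
qed

text \<open>Only finitely many \<open>t\<close> are excluded, the negative reciprocals of the eigenvalues of \<open>T\<close>. Below,
  this shows that the rank of a linear family of operators can only drop at special parameters.\<close>

lemma exists_injective_perturbation:
  assumes "lin T"
  shows "\<exists>t. t \<noteq> 0 \<and> inj (\<lambda>x. x + scale t (T x))"
proof -
  obtain p where p: "p \<noteq> 0" "\<And>v. poly_op p T v = 0" using exists_annihilator[OF assms] by blast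
  have "finite ({x. poly p x = 0} \<union> {0})" using p poly_roots_finite by auto
  then obtain s where s: "poly p s \<noteq> 0" "s \<noteq> 0"
    using ex_new_if_finite[OF infinite_UNIV_char_0] by blast
  define t where "t = - inverse s"
  have L: "lin (\<lambda>x. x + scale t (T x))" by (simp add: lin_plus lin_id lin_scaled assms)
  have "x = 0" if "x + scale t (T x) = 0" for x
  proof -
    have "x = scale (inverse s) (T x)" using that by (simp add: t_def eq_neg_iff_add_eq_0)
    then have T: "T x = scale s x" using s(2) by (metis scale_scale right_inverse scale_one)
    have "poly_op q T x = scale (poly q s) x" for q
      by (induction q) (simp_all add: poly_op_0 poly_op_pCons[OF assms] lin_scale[OF assms] T
         scale_left_distrib mult.commute)
    then show "x = 0" using p(2)[of x] s(1) by simp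
  qed
  then have "inj (\<lambda>x. x + scale t (T x))"
    using L by (metis (no_types, lifting) Vector_Spaces.linear.axioms(3) module_hom.inj_iff_eq_0)
  then show ?thesis using s(2) by (intro exI[of _ t]) (simp add: t_def)
qed

text \<open>In a basis that extends one of the range, the diagonal entries are \<open>1\<close> on the range and \<open>0\<close>
  elsewhere.\<close>

lemma tr_idempotent:
  assumes P: "lin P" "\<And>x. P (P x) = P x"
  shows "tr P = of_nat (dim (range P))"
proof -
  obtain B where B: "B \<subseteq> range P" "independent B" "range P \<subseteq> span B" "card B = dim (range P)"
    using basis_exists[of "range P"] by metis
  obtain C where C: "B \<subseteq> C" "independent C" "UNIV \<subseteq> span C"
    using maximal_independent_subset_extend[of B UNIV] B by auto
  have fC: "finite C" by (rule finiteI_independent[OF C(2)])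
  have "tr P = (\<Sum>c\<in>C. representation C (P c) c)"
    using tr_any_basis[OF fC C(2) _ P(1)] C(3) by auto
  also have "\<dots> = (\<Sum>c\<in>C. if c \<in> B then 1 else 0)"
  proof (intro sum.cong refl)
    fix c assume c: "c \<in> C"
    show "representation C (P c) c = (if c \<in> B then 1 else 0)"
    proof (cases "c \<in> B")
      case True
      then have "P c = c" using B(1) P(2) by auto
      then show ?thesis using representation_basis[OF C(2) c] True by simp
    next
      case False
      have "P c \<in> span B" using B(3) by blast
      then have "representation C (P c) = representation B (P c)"
        by (rule representation_extend[OF C(2) _ C(1)])
      then show ?thesis using False representation_ne_zero[of B "P c" c] by auto
    qed
  qed
  also have "\<dots> = of_nat (card B)"
    using fC C(1) by (subst sum.inter_restrict[symmetric]) (auto simp: Int_absorb1)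
  finally show ?thesis using B(4) by simp
qed

lemma tr_idempotent_eq_0D:
  assumes "lin P" "\<And>x. P (P x) = P x" "tr P = 0"
  shows "P x = 0"
proof -
  have "dim (range P) = 0" using tr_idempotent[OF assms(1,2)] assms(3) by simp
  then have "range P \<subseteq> {0}" by (simp only: dim_eq_0)
  then show ?thesis by auto
qed

lemma poly_op_eq_0_coprime:
  assumes T: "lin T" and "p \<noteq> 0" "\<And>x. poly p x = 0 \<Longrightarrow> poly q x \<noteq> 0"
    and "poly_op p T v = 0" "poly_op q T v = 0"
  shows "v = 0"
proof -
  obtain a b where ab: "a * p + b * q = 1" using poly_bezout_no_common_root assms(2,3) by blast
  have "v = poly_op (a * p + b * q) T v" using ab by (simp add: poly_op_1[OF T])
  also have "\<dots> = 0" using assms by (simp add: poly_op_add[OF T] poly_op_mult[OF T] lin_0[OF poly_op_lin[OF T]])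
  finally show ?thesis .
qed

text \<open>The projections onto the generalised eigenspaces, as polynomials in \<open>T\<close>, so that they commute
  with everything that commutes with \<open>T\<close>. If the product \<open>q\<close> of the powers
  \<open>L l = (X - l)\<^sup>m\<close> annihilates \<open>T\<close>, Bezout's identity for \<open>L l\<close> and the product \<open>r l\<close> of the other
  powers gives \<open>e l = b l * r l\<close>.\<close>

lemma eigenprojections:
  assumes T: "lin T"
  obtains S :: "'k set" and e :: "'k \<Rightarrow> 'k poly" and m :: nat where
    "finite S"
    "\<And>v. (\<Sum>l\<in>S. poly_op (e l) T v) = v"
    "\<And>l m v. l \<in> S \<Longrightarrow> m \<in> S \<Longrightarrow> l \<noteq> m \<Longrightarrow> poly_op (e l) T (poly_op (e m) T v) = 0"
    "\<And>l v. l \<in> S \<Longrightarrow> ((\<lambda>w. T w - scale l w) ^^ m) (poly_op (e l) T v) = 0"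
proof -
  obtain p where p: "p \<noteq> 0" "\<And>v. poly_op p T v = 0" using exists_annihilator[OF T] by blast
  obtain A where A: "p = smult (lead_coeff p) (\<Prod>x\<in>#A. [:-x, 1:])"
    using alg_closed_imp_factorization[OF p(1)] by blast
  define S where "S = set_mset A"
  define m where "m = size A"
  define L where "L = (\<lambda>l::'k. [:- l, 1:] ^ m)"
  define q where "q = (\<Prod>l\<in>S. L l)"
  have fS: "finite S" by (simp add: S_def)
  have d: "(\<Prod>x\<in>#A'. [:-x, 1:]) dvd (\<Prod>l\<in>S. [:- l, 1:]) ^ size A'" if "set_mset A' \<subseteq> S" for A' :: "'k multiset"
    using that
  proof (induction A')
    case (add x A')
    then have "[:-x, 1:] dvd (\<Prod>l\<in>S. [:- l, 1:])" using fS by (intro dvd_prodI) auto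
    then show ?case using add by (simp add: mult_dvd_mono del: mult_pCons_left)
  qed simp
  have "(\<Prod>x\<in>#A. [:-x, 1:]) dvd q"
    using d[of A] unfolding q_def L_def S_def m_def by (simp add: prod_power_distrib)
  then have "p dvd q" by (subst A) (simp add: smult_dvd p(1))
  then have q0: "poly_op (q * r) T v = 0" for r v
    using p(2) by (auto simp: poly_op_mult[OF T] mult.assoc dvd_def)
  have L0: "L l \<noteq> 0" for l by (simp add: L_def)
  have Lroot: "poly (L l) x = 0 \<longleftrightarrow> x = l \<and> m \<noteq> 0" for l x by (auto simp: L_def)
  define r where "r = (\<lambda>l. \<Prod>j\<in>S - {l}. L j)"
  have rL: "r l * L l = q" if "l \<in> S" for l
    using that fS by (simp add: r_def q_def prod.remove[of S l] mult.commute)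
  have "\<exists>a b. a * L l + b * r l = 1" for l
    by (rule poly_bezout_no_common_root) (use L0 fS in \<open>auto simp: Lroot r_def poly_prod\<close>)
  then obtain a b where ab: "\<And>l. a l * L l + b l * r l = 1" by metis
  define e where "e = (\<lambda>l. b l * r l)"
  have Ldvd: "L j dvd r l" if "j \<in> S" "j \<noteq> l" for j l
    using that fS unfolding r_def by (intro dvd_prodI) auto
  have ee: "poly_op (e l) T (poly_op (e j) T v) = 0" if lj: "l \<in> S" "j \<in> S" "l \<noteq> j" for l j v
  proof -
    obtain w where "r j = L l * w" using Ldvd[of l j] lj by (auto simp: dvd_def)
    then have "e l * e j = (r l * L l) * (b l * b j * w)" by (simp add: e_def mult_ac)
    then have "e l * e j = q * (b l * b j * w)" using rL lj(1) by simp
    then show ?thesis using q0 poly_op_mult[OF T] by metis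
  qed
  have Le: "poly_op (L l) T (poly_op (e l) T v) = 0" if "l \<in> S" for l v
  proof -
    have "L l * e l = (r l * L l) * b l" by (simp add: e_def mult_ac)
    then have "L l * e l = q * b l" using rL that by simp
    then show ?thesis using q0 poly_op_mult[OF T] by metis
  qed
  have idem: "poly_op (e l) T (poly_op (e l) T v) = poly_op (e l) T v" if "l \<in> S" for l v
  proof -
    have "poly_op (e l) T (poly_op (e l) T v) + poly_op (a l * L l) T (poly_op (e l) T v) = poly_op (e l) T v"
      using ab[of l] poly_op_add[OF T, of "e l" "a l * L l"] poly_op_1[OF T] by (simp add: e_def add.commute)
    then show ?thesis using Le[OF that] by (simp add: poly_op_mult[OF T] lin_0[OF poly_op_lin[OF T]])
  qed
  \<comment> \<open>The difference \<open>w\<close> is killed by every \<open>e l\<close>, so each \<open>a l * L l\<close> fixes it; their product is a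
    multiple of \<open>q\<close>.\<close>
  have total: "(\<Sum>l\<in>S. poly_op (e l) T v) = v" for v
  proof -
    define w where "w = v - (\<Sum>l\<in>S. poly_op (e l) T v)"
    have ew: "poly_op (e l) T w = 0" if l: "l \<in> S" for l
    proof -
      have "poly_op (e l) T (\<Sum>j\<in>S. poly_op (e j) T v) = (\<Sum>j\<in>S. poly_op (e l) T (poly_op (e j) T v))"
        by (rule lin_sum[OF poly_op_lin[OF T]])
      also have "\<dots> = (\<Sum>j\<in>S. if j = l then poly_op (e l) T v else 0)"
        by (intro sum.cong refl) (use ee l idem in auto)
      also have "\<dots> = poly_op (e l) T v" using l fS by simp
      finally show ?thesis by (simp add: w_def lin_diff[OF poly_op_lin[OF T]])
    qed
    have wL: "w = poly_op (a l * L l) T w" if "l \<in> S" for l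
    proof -
      have "poly_op (e l) T w + poly_op (a l * L l) T w = w"
        using ab[of l] poly_op_add[OF T, of "e l" "a l * L l"] poly_op_1[OF T] by (simp add: e_def add.commute)
      then show ?thesis using ew[OF that] by simp
    qed
    have "w = poly_op (\<Prod>l\<in>S'. a l * L l) T w" if "S' \<subseteq> S" for S'
      using finite_subset[OF that fS] that
    proof (induction S' rule: finite_induct)
      case empty then show ?case by (simp add: poly_op_1[OF T])
    next
      case (insert l S')
      then have "w = poly_op (a l * L l) T (poly_op (\<Prod>l\<in>S'. a l * L l) T w)" using wL by auto
      then show ?case using insert by (simp add: poly_op_mult[OF T])
    qed
    then have "w = poly_op (q * (\<Prod>l\<in>S. a l)) T w" by (simp add: q_def prod.distrib mult.commute)
    then have "w = 0" using q0 by metis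
    then show ?thesis by (simp add: w_def)
  qed
  have pX: "poly_op [:- l, 1:] T = (\<lambda>w. T w - scale l w)" for l
    by (rule ext) (rule poly_op_X[OF T])
  show thesis
  proof
    show "((\<lambda>w. T w - scale l w) ^^ m) (poly_op (e l) T v) = 0" if "l \<in> S" for l v
      using Le[OF that] by (simp add: L_def poly_op_power[OF T] pX)
  qed (use fS total ee in auto)
qed

lemma eigenprojection_idem:
  assumes "finite S" and tot: "\<And>v. (\<Sum>l\<in>S. P l v) = v" and "\<And>l. lin (P l)"
    and "\<And>l m v. l \<in> S \<Longrightarrow> m \<in> S \<Longrightarrow> l \<noteq> m \<Longrightarrow> P l (P m v) = (0::'g)" and l: "l \<in> S"
  shows "P l (P l v) = P l v"
proof -
  have "P l v = P l (\<Sum>j\<in>S. P j v)" using tot by simp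
  also have "\<dots> = (\<Sum>j\<in>S. P l (P j v))" by (rule lin_sum[OF assms(3)])
  also have "\<dots> = (\<Sum>j\<in>S. if j = l then P l (P l v) else 0)"
    by (intro sum.cong refl) (use assms in auto)
  also have "\<dots> = P l (P l v)" using l assms(1) by simp
  finally show ?thesis by simp
qed

lemma tr_eigenprojection:
  assumes T: "lin T" and P: "lin P" "\<And>x. P (P x) = P x" "\<And>x. P (T x) = T (P x)"
    and nil: "\<And>v. ((\<lambda>w. T w - scale l w) ^^ m) (P v) = 0"
  shows "tr (\<lambda>x. T (P x)) = l * tr P"
proof -
  define N where "N = (\<lambda>w. T w - scale l w)"
  have N: "lin N" unfolding N_def by (simp add: lin_minus T lin_scaled lin_id)
  have NP: "lin (\<lambda>x. N (P x))" using N P lin_comp by blast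
  have c: "P (N x) = N (P x)" for x by (simp add: N_def lin_diff[OF P(1)] lin_scale[OF P(1)] P(3))
  have cN: "P ((N ^^ k) y) = (N ^^ k) (P y)" for k y by (induction k) (simp_all add: c)
  have pw: "((\<lambda>x. N (P x)) ^^ Suc k) x = (N ^^ Suc k) (P x)" for k x
  proof (induction k)
    case (Suc k)
    have "((\<lambda>x. N (P x)) ^^ Suc (Suc k)) x = N (P (((\<lambda>x. N (P x)) ^^ Suc k) x))"
      unfolding funpow.simps(2)[of "Suc k"] by simp
    also have "\<dots> = N (P ((N ^^ Suc k) (P x)))" unfolding Suc by simp
    also have "\<dots> = (N ^^ Suc (Suc k)) (P x)" unfolding cN P(2) by simp
    finally show ?case .
  qed simp
  have "((\<lambda>x. N (P x)) ^^ Suc m) x = 0" for x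
    unfolding pw using nil[of x] by (simp add: N_def[symmetric] lin_0[OF N])
  then have "tr (\<lambda>x. N (P x)) = 0" using tr_nilpotent[OF NP] by blast
  then have "tr (\<lambda>x. T (P x) - scale l (P x)) = 0" by (simp add: N_def)
  then show ?thesis by (simp add: tr_minus lin_comp T P lin_scaled tr_scaled)
qed

lemma nilpotent_if_eigenprojections_0:
  assumes T: "lin T" and S: "finite S"
    and tot: "\<And>v. (\<Sum>l\<in>S. poly_op (e l) T v) = v"
    and nil: "\<And>l v. l \<in> S \<Longrightarrow> ((\<lambda>w. T w - scale l w) ^^ m) (poly_op (e l) T v) = 0"
    and P0: "\<And>l v. l \<in> S \<Longrightarrow> l \<noteq> 0 \<Longrightarrow> poly_op (e l) T v = 0"
  shows "(T ^^ m) v = 0"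
proof (cases "0 \<in> S")
  case True
  have "(\<Sum>l\<in>S. poly_op (e l) T v) = (\<Sum>l\<in>S. if l = 0 then poly_op (e 0) T v else 0)"
    by (rule sum.cong[OF refl]) (simp add: P0)
  then have "poly_op (e 0) T v = v" using True S by (simp add: tot)
  then show ?thesis using nil[OF True, of v] by simp
next
  case False
  have "(\<Sum>l\<in>S. poly_op (e l) T v) = 0"
    by (rule sum.neutral) (metis P0 False)
  then have "v = 0" by (simp add: tot)
  then show ?thesis by (simp add: lin_0[OF lin_pow[OF T]])
qed

text \<open>For an eigenvalue \<open>l \<noteq> 0\<close> with projection \<open>P\<close>, the operator \<open>T P\<close> is a polynomial in \<open>T\<close> without
  constant term, so its trace \<open>l * tr P\<close> vanishes. In characteristic \<open>0\<close> this forces \<open>P = 0\<close>.\<close>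

lemma nilpotent_if_tr_powers_0:
  assumes T: "lin T" and tr0: "\<And>k. k > 0 \<Longrightarrow> tr (T ^^ k) = 0"
  shows "\<exists>m. \<forall>x. (T ^^ m) x = 0"
proof -
  obtain S e m where S: "finite S"
    and tot: "\<And>v. (\<Sum>l\<in>S. poly_op (e l) T v) = v"
    and ort: "\<And>l m v. l \<in> S \<Longrightarrow> m \<in> S \<Longrightarrow> l \<noteq> m \<Longrightarrow> poly_op (e l) T (poly_op (e m) T v) = 0"
    and nil: "\<And>l v. l \<in> S \<Longrightarrow> ((\<lambda>w. T w - scale l w) ^^ m) (poly_op (e l) T v) = 0"
    using eigenprojections[OF T] by blast
  have idem: "poly_op (e l) T (poly_op (e l) T v) = poly_op (e l) T v" if "l \<in> S" for l v
    using eigenprojection_idem[OF S tot poly_op_lin[OF T] ort that] .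
  have trT: "tr (\<lambda>x. T (poly_op p T x)) = 0" for p
  proof -
    have "tr (poly_op (monom 1 1 * p) T) = tr (\<lambda>x. \<Sum>i\<le>degree p. poly_op (monom (coeff p i) (Suc i)) T x)"
    proof -
      have "monom 1 1 * p = (\<Sum>i\<le>degree p. monom (coeff p i) (Suc i))"
        by (subst (1) poly_as_sum_of_monoms[symmetric, of p])
          (simp add: sum_distrib_left mult_monom)
      then show ?thesis by (auto simp: poly_op_sum[OF T] intro!: arg_cong[where f=tr])
    qed
    also have "\<dots> = (\<Sum>i\<le>degree p. coeff p i * tr (T ^^ Suc i))"
    proof (subst tr_summed)
      show "(\<Sum>i\<le>degree p. tr (poly_op (monom (coeff p i) (Suc i)) T))
          = (\<Sum>i\<le>degree p. coeff p i * tr (T ^^ Suc i))"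
        by (simp add: poly_op_monom[OF T, abs_def] tr_scaled[OF lin_pow[OF T]] del: funpow.simps)
    qed (rule poly_op_lin[OF T])
    also have "\<dots> = 0" by (rule sum.neutral) (simp add: tr0 del: funpow.simps)
    finally show ?thesis by (simp add: poly_op_mult[OF T, abs_def] poly_op_monom[OF T])
  qed
  have P0: "poly_op (e l) T v = 0" if l: "l \<in> S" "l \<noteq> 0" for l v
  proof -
    have "l * tr (poly_op (e l) T) = 0"
      using tr_eigenprojection[OF T poly_op_lin[OF T] idem[OF l(1)] poly_op_commute[OF T T refl, symmetric]
          nil[OF l(1)]] unfolding trT by (rule sym)
    then show ?thesis using tr_idempotent_eq_0D[OF poly_op_lin[OF T] idem[OF l(1)]] l(2) by simp
  qed
  have "(T ^^ m) v = 0" for v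
    by (rule nilpotent_if_eigenprojections_0[OF T S tot nil P0])
  then show ?thesis by blast
qed

end

section \<open>The Killing form and Cartan's criterion\<close>

lemma exists_rational_functional:
  fixes a :: "'k::field_char_0"
  assumes "a \<noteq> 0"
  shows "\<exists>f :: 'k \<Rightarrow> rat. (\<forall>x y. f (x + y) = f x + f y) \<and> (\<forall>q x. f (of_rat q * x) = q * f x) \<and> f a = 1"
proof -
  interpret Q: vector_space "\<lambda>(q::rat) (x::'k). of_rat q * x"
    by unfold_locales (auto simp: algebra_simps of_rat_add of_rat_mult)
  have "Q.subspace {0}" by (rule Q.subspace_single_0)
  then obtain f :: "'k \<Rightarrow> rat" where f: "Vector_Spaces.linear (\<lambda>q x. of_rat q * x) (*) f" "f a = 1"
    using Q.exists_functional[of "{0}" a] assms by auto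
  interpret f: Vector_Spaces.linear "\<lambda>q x. of_rat q * x" "(*)" f by fact
  show ?thesis using f.add f.scale f(2) by (intro exI[of _ f]) auto
qed

sublocale lie_algebra \<subseteq> alg_closed_space scale Basis by unfold_locales

context lie_algebra
begin

lemma bracket_add_right: "bracket x (y + z) = bracket x y + bracket x z"
  by (rule lin_add[OF linear_right])
lemma bracket_add_left: "bracket (x + y) z = bracket x z + bracket y z"
  by (rule lin_add[OF linear_left])
lemma bracket_diff_right: "bracket x (y - z) = bracket x y - bracket x z"
  by (rule lin_diff[OF linear_right])
lemma bracket_diff_left: "bracket (x - y) z = bracket x z - bracket y z"
  by (rule lin_diff[OF linear_left])
lemma bracket_scale_right: "bracket x (scale c y) = scale c (bracket x y)"
  by (rule lin_scale[OF linear_right])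
lemma bracket_scale_left: "bracket (scale c x) y = scale c (bracket x y)"
  by (rule lin_scale[OF linear_left])
lemma bracket_0_right: "bracket x 0 = 0" by (rule lin_0[OF linear_right])
lemma bracket_0_left: "bracket 0 x = 0" by (rule lin_0[OF linear_left])
lemma bracket_neg_right: "bracket x (- y) = - bracket x y" by (rule lin_neg[OF linear_right])
lemma bracket_neg_left: "bracket (- x) y = - bracket x y" by (rule lin_neg[OF linear_left])

lemmas bracket_simps = bracket_add_right bracket_add_left bracket_diff_right bracket_diff_left
  bracket_scale_right bracket_scale_left bracket_0_right bracket_0_left bracket_neg_right bracket_neg_left

lemma anticommute: "bracket x y = - bracket y x"
proof -
  have "bracket x y + bracket y x = 0"
    using alternating[of "x + y"] unfolding bracket_add_left bracket_add_right
    by (simp add: alternating add.commute)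
  then show ?thesis by (rule eq_neg_iff_add_eq_0[THEN iffD2])
qed

lemma bracket_bracket_left: "bracket (bracket x y) z = bracket x (bracket y z) - bracket y (bracket x z)"
proof -
  have "bracket x (bracket y z) + bracket y (bracket z x) + bracket z (bracket x y) = 0" by (rule jacobi)
  then show ?thesis
    using anticommute[of z x] anticommute[of z "bracket x y"] by (simp add: bracket_neg_right algebra_simps)
qed

lemma bracket_leibniz: "bracket x (bracket y z) = bracket (bracket x y) z + bracket y (bracket x z)"
  by (simp add: bracket_bracket_left)

lemma lin_ad: "lin (bracket x)" by (rule linear_right)

definition killing :: "'g \<Rightarrow> 'g \<Rightarrow> 'k" where
  "killing x y = tr (\<lambda>z. bracket x (bracket y z))"

lemma lin_ad_ad: "lin (\<lambda>z. bracket x (bracket y z))" by (rule lin_comp[OF lin_ad lin_ad])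

lemma killing_sym: "killing x y = killing y x"
  unfolding killing_def by (rule tr_commute[OF lin_ad lin_ad])

lemma killing_add_left: "killing (x + y) z = killing x z + killing y z"
  unfolding killing_def by (simp add: bracket_add_left tr_plus lin_ad_ad)
lemma killing_scale_left: "killing (scale c x) z = c * killing x z"
  unfolding killing_def by (simp add: bracket_scale_left tr_scaled lin_ad_ad)
lemma killing_add_right: "killing z (x + y) = killing z x + killing z y"
  by (simp add: killing_sym[of z] killing_add_left)
lemma killing_scale_right: "killing z (scale c x) = c * killing z x"
  by (simp add: killing_sym[of z] killing_scale_left)
lemma killing_0_left: "killing 0 x = 0" using killing_scale_left[of 0 0 x] by simp
lemma killing_0_right: "killing x 0 = 0" by (simp add: killing_sym[of x 0] killing_0_left)
lemma killing_neg_left: "killing (- x) y = - killing x y"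
  using killing_scale_left[of "-1" x y] by simp
lemma killing_neg_right: "killing x (- y) = - killing x y"
  by (simp add: killing_sym[of x] killing_neg_left)
lemma killing_diff_right: "killing z (x - y) = killing z x - killing z y"
  using killing_add_right[of z x "- y"] by (simp add: killing_neg_right)

text \<open>The trace of \<open>[ad a, ad b] F\<close> is that of \<open>ad a [ad b, F]\<close>, and \<open>[ad b, F] = - ad (F b)\<close> for a
  derivation \<open>F\<close>.\<close>

lemma tr_derivation_ad:
  assumes F: "lin F" "\<And>v w. F (bracket v w) = bracket (F v) w + bracket v (F w)"
  shows "tr (\<lambda>z. bracket (bracket a b) (F z)) = - killing a (F b)"
proof -
  have 1: "bracket b (F z) = F (bracket b z) - bracket (F b) z" for z by (simp add: F(2))
  note l1 = lin_comp[OF lin_ad F(1)] and l2 = lin_comp[OF F(1) lin_ad]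
  note l3 = lin_comp[OF lin_ad l1] and l4 = lin_comp[OF lin_ad l2]
  have "tr (\<lambda>z. bracket (bracket a b) (F z))
      = tr (\<lambda>z. bracket a (bracket b (F z)) - bracket b (bracket a (F z)))"
    by (simp add: bracket_bracket_left)
  also have "\<dots> = tr (\<lambda>z. bracket a (bracket b (F z))) - tr (\<lambda>z. bracket b (bracket a (F z)))"
    by (rule tr_minus[OF l3 l3])
  also have "tr (\<lambda>z. bracket b (bracket a (F z))) = tr (\<lambda>z. bracket a (F (bracket b z)))"
    by (rule tr_commute[OF lin_ad l1])
  also have "tr (\<lambda>z. bracket a (bracket b (F z))) - tr (\<lambda>z. bracket a (F (bracket b z)))
      = tr (\<lambda>z. bracket a (bracket b (F z)) - bracket a (F (bracket b z)))"
    by (rule tr_minus[OF l3 l4, symmetric])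
  also have "\<dots> = tr (\<lambda>z. scale (- 1) (bracket a (bracket (F b) z)))"
    by (simp add: bracket_diff_right[symmetric] bracket_neg_right[symmetric] 1)
  also have "\<dots> = - killing a (F b)"
    by (subst tr_scaled) (auto simp: lin_ad_ad killing_def)
  finally show ?thesis .
qed

lemma killing_invariant: "killing (bracket x y) z = killing x (bracket y z)"
proof -
  have "killing (bracket x y) z = tr (\<lambda>u. bracket (bracket x y) (bracket z u))" by (simp add: killing_def)
  also have "\<dots> = - killing x (bracket z y)"
    by (rule tr_derivation_ad[OF lin_ad bracket_leibniz])
  also have "\<dots> = killing x (bracket y z)" by (simp add: anticommute[of z y] killing_neg_right)
  finally show ?thesis .
qed

lemma killing_ad_skew: "killing (bracket x y) z = - killing y (bracket x z)"
  using killing_invariant[of y x z] by (simp add: anticommute[of x y] killing_neg_left)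

lemma simple_perfect:
  assumes simple
  shows "span {bracket x y | x y. True} = UNIV"
proof -
  let ?D = "span {bracket x y | x y. True}"
  have "lie_ideal ?D UNIV" unfolding lie_ideal_def
    by (auto intro!: span_base)
  moreover obtain x y where "bracket x y \<noteq> 0" using assms unfolding simple_def by blast
  then have "?D \<noteq> {0}" using span_base[of "bracket x y" "{bracket x y | x y. True}"] by auto
  ultimately show ?thesis using assms unfolding simple_def by blast
qed

lemma bracket_generalized_eigenvectors:
  assumes "((\<lambda>z. bracket x z - scale l z) ^^ i) v = 0"
    and "((\<lambda>z. bracket x z - scale m z) ^^ j) w = 0"
  shows "((\<lambda>z. bracket x z - scale (l + m) z) ^^ (i + j)) (bracket v w) = 0"
  using assms
proof (induction "i + j" arbitrary: i j v w)
  case 0 then show ?case by (simp add: bracket_0_left)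
next
  case (Suc n)
  let ?N = "\<lambda>l z. bracket x z - scale l z"
  have L: "lin (?N l)" for l by (intro lin_minus lin_ad lin_scaled lin_id)
  show ?case
  proof (cases "i = 0 \<or> j = 0")
    case True
    then have "bracket v w = 0" using Suc.prems by (auto simp: bracket_simps)
    then show ?thesis by (simp add: lin_0[OF lin_pow[OF L]])
  next
    case False
    then obtain i' j' where ij: "i = Suc i'" "j = Suc j'" using not0_implies_Suc by blast
    have e: "?N (l + m) (bracket v w) = bracket (?N l v) w + bracket v (?N m w)"
      by (simp add: bracket_simps bracket_leibniz[of x v w] scale_left_distrib)
    have v: "(?N l ^^ i') (?N l v) = 0" and w: "(?N m ^^ j') (?N m w) = 0"
      using Suc.prems unfolding ij funpow_Suc_right by (simp_all only: o_apply)
    have n: "n = i' + j" "n = i + j'" using Suc.hyps(2) ij by auto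
    have "(?N (l + m) ^^ n) (bracket (?N l v) w) = 0"
      using Suc.hyps(1)[OF n(1) v Suc.prems(2)] unfolding n(1) .
    moreover have "(?N (l + m) ^^ n) (bracket v (?N m w)) = 0"
      using Suc.hyps(1)[OF n(2) Suc.prems(1) w] unfolding n(2) .
    moreover have "(?N (l + m) ^^ (i + j)) (bracket v w) = (?N (l + m) ^^ n) (?N (l + m) (bracket v w))"
      unfolding Suc.hyps(2)[symmetric] funpow_Suc_right by (simp only: o_apply)
    ultimately show ?thesis unfolding e lin_add[OF lin_pow[OF L]] by (simp only: add_0_left)
  qed
qed

text \<open>Let \<open>P j\<close> be the projections onto the generalised eigenspaces of \<open>ad x\<close>. For an additive
  function \<open>f\<close> from the field to the rationals, \<open>F = \<Sum>j. f j P j\<close> is a derivation, because brackets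
  add generalised eigenvalues. As the algebra is perfect and the Killing form is zero, \<open>ad x F\<close> has trace
  \<open>0\<close>, that is, \<open>\<Sum>j. f j * d j * j = 0\<close> with \<open>d j\<close> the rank of \<open>P j\<close>. Applying \<open>f\<close>
  gives \<open>\<Sum>j. (f j)\<^sup>2 * d j = 0\<close> in the rationals, so \<open>d l = 0\<close> as soon as \<open>f l = 1\<close>.\<close>

lemma ad_nilpotent_if_killing_0:
  assumes simple and k0: "\<And>x y. killing x y = 0"
  shows "\<exists>m. \<forall>z. (bracket x ^^ m) z = 0"
proof -
  let ?T = "bracket x"
  note T = lin_ad[of x]
  obtain S e m where S: "finite S"
    and tot: "\<And>v. (\<Sum>l\<in>S. poly_op (e l) ?T v) = v"
    and ort: "\<And>l m v. l \<in> S \<Longrightarrow> m \<in> S \<Longrightarrow> l \<noteq> m \<Longrightarrow> poly_op (e l) ?T (poly_op (e m) ?T v) = 0"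
    and nil: "\<And>l v. l \<in> S \<Longrightarrow> ((\<lambda>w. ?T w - scale l w) ^^ m) (poly_op (e l) ?T v) = 0"
    using eigenprojections[OF T] by blast
  define P where "P l = poly_op (e l) ?T" for l
  have linP: "lin (P l)" for l unfolding P_def by (rule poly_op_lin[OF T])
  note tot = tot[folded P_def] and nil = nil[folded P_def] and ort = ort[folded P_def]
  have idem: "P l (P l v) = P l v" if "l \<in> S" for l v
    by (rule eigenprojection_idem[OF S tot linP ort that])
  have P0: "P l v = 0" if l: "l \<in> S" "l \<noteq> 0" for l v
  proof -
    obtain f :: "'k \<Rightarrow> rat" where f: "\<And>x y. f (x + y) = f x + f y" "\<And>q x. f (of_rat q * x) = q * f x" "f l = 1"
      using exists_rational_functional[OF l(2)] by blast
    define F where "F = (\<lambda>v. \<Sum>j\<in>S. scale (of_rat (f j)) (P j v))"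
    have F: "lin F" unfolding F_def by (intro lin_summed lin_scaled linP)
    have gen: "F u = scale (of_rat (f s)) u" if u: "((\<lambda>z. ?T z - scale s z) ^^ n) u = 0" for s u n
    proof -
      have "P j u = 0" if j: "j \<in> S" "j \<noteq> s" for j
      proof (rule poly_op_eq_0_coprime[OF T])
        show "[:- s, 1:] ^ n \<noteq> 0" by simp
        show "poly ([:- s, 1:] ^ n) y = 0 \<Longrightarrow> poly ([:- j, 1:] ^ m) y \<noteq> 0" for y using j by (auto simp: algebra_simps)
        have "poly_op ([:- s, 1:] ^ n) ?T u = 0" using u by (simp add: poly_op_power[OF T] poly_op_X[OF T, abs_def])
        then show "poly_op ([:- s, 1:] ^ n) ?T (P j u) = 0"
          unfolding P_def by (subst poly_op_poly_op_commute[OF T]) (simp add: lin_0[OF poly_op_lin[OF T]])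
        show "poly_op ([:- j, 1:] ^ m) ?T (P j u) = 0" using nil[OF j(1)] by (simp add: poly_op_power[OF T] poly_op_X[OF T, abs_def])
      qed
      then have "F u = (\<Sum>j\<in>S. scale (of_rat (f s)) (P j u))"
        unfolding F_def by (intro sum.cong refl) (metis scale_zero_right)
      also have "\<dots> = scale (of_rat (f s)) u" by (simp add: scale_sum_right[symmetric] tot)
      finally show ?thesis .
    qed
    have FP: "F (P j v) = scale (of_rat (f j)) (P j v)" if "j \<in> S" for j v
      using gen nil[OF that] by blast
    have FPP: "F (bracket (P i v) (P j w)) = bracket (F (P i v)) (P j w) + bracket (P i v) (F (P j w))"
      if ij: "i \<in> S" "j \<in> S" for i j v w
      using gen[OF bracket_generalized_eigenvectors[OF nil[OF ij(1), of v] nil[OF ij(2), of w]]]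
      by (simp add: FP ij bracket_simps f(1) of_rat_add scale_left_distrib)
    have sumL: "bracket (\<Sum>i\<in>I. u i) w = (\<Sum>i\<in>I. bracket (u i) w)"
      and sumR: "bracket w (\<Sum>i\<in>I. u i) = (\<Sum>i\<in>I. bracket w (u i))" for I :: "'k set" and u w
      using lin_sum[OF linear_left] lin_sum[OF linear_right] by auto
    have der: "F (bracket v w) = bracket (F v) w + bracket v (F w)" for v w
    proof -
      have "F (bracket (\<Sum>i\<in>S. P i v) (\<Sum>j\<in>S. P j w)) = (\<Sum>i\<in>S. \<Sum>j\<in>S. F (bracket (P i v) (P j w)))"
        by (simp add: sumL sumR lin_sum[OF F]) (rule sum.swap)
      also have "\<dots> = (\<Sum>i\<in>S. \<Sum>j\<in>S. bracket (F (P i v)) (P j w) + bracket (P i v) (F (P j w)))"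
        by (intro sum.cong refl FPP)
      also have "\<dots> = bracket (F (\<Sum>i\<in>S. P i v)) (\<Sum>j\<in>S. P j w) + bracket (\<Sum>i\<in>S. P i v) (F (\<Sum>j\<in>S. P j w))"
        by (simp add: sumL sumR lin_sum[OF F] sum.distrib) (intro arg_cong2[of _ _ _ _ "(+)"] sum.swap)
      finally show ?thesis by (simp add: tot)
    qed
    have tr0: "tr (\<lambda>z. bracket y (F z)) = 0" for y
    proof -
      have "y \<in> span {bracket x y | x y. True}" using simple_perfect[OF assms(1)] by simp
      then show ?thesis
      proof (induction rule: span_induct_alt)
        case base then show ?case by (simp add: bracket_0_left tr_zero)
      next
        case (step c a b)
        then obtain u v where a: "a = bracket u v" by blast
        have 1: "tr (\<lambda>z. bracket a (F z)) = 0" unfolding a using tr_derivation_ad[OF F der] k0 by simp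
        have "tr (\<lambda>z. bracket (scale c a + b) (F z)) = tr (\<lambda>z. scale c (bracket a (F z)) + bracket b (F z))"
          by (simp add: bracket_simps)
        also have "\<dots> = c * tr (\<lambda>z. bracket a (F z)) + tr (\<lambda>z. bracket b (F z))"
          by (subst tr_plus) (auto intro!: lin_scaled lin_comp[OF lin_ad F] simp: tr_scaled[OF lin_comp[OF lin_ad F]])
        finally show ?case using 1 step by simp
      qed
    qed
    define d where "d = (\<lambda>j. dim (range (P j)))"
    have trP: "tr (P j) = of_nat (d j)" if "j \<in> S" for j
      unfolding d_def by (rule tr_idempotent[OF linP idem[OF that]])
    have PT: "P j (bracket x v) = bracket x (P j v)" for j v
      unfolding P_def by (rule poly_op_commute[OF T T refl, symmetric])
    have "0 = tr (\<lambda>z. \<Sum>j\<in>S. scale (of_rat (f j)) (bracket x (P j z)))"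
      using tr0[of x] by (simp add: F_def sumR bracket_simps)
    also have "\<dots> = (\<Sum>j\<in>S. of_rat (f j) * (j * of_nat (d j)))"
    proof (subst tr_summed)
      show "(\<Sum>j\<in>S. tr (\<lambda>z. scale (of_rat (f j)) (bracket x (P j z)))) = (\<Sum>j\<in>S. of_rat (f j) * (j * of_nat (d j)))"
      proof (intro sum.cong refl)
        fix j assume j: "j \<in> S"
        have "tr (\<lambda>z. bracket x (P j z)) = j * of_nat (d j)"
          using tr_eigenprojection[OF T linP idem[OF j] PT nil[OF j]] trP[OF j] by simp
        then show "tr (\<lambda>z. scale (of_rat (f j)) (bracket x (P j z))) = of_rat (f j) * (j * of_nat (d j))"
          by (simp add: tr_scaled lin_comp[OF T linP])
      qed
    qed (intro lin_scaled lin_comp[OF T linP])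
    finally have s0: "(\<Sum>j\<in>S. of_rat (f j * of_nat (d j)) * j) = 0"
      by (simp add: of_rat_mult mult_ac)
    have f0: "f 0 = 0" using f(2)[of 0 0] by simp
    have fsum: "f (\<Sum>j\<in>I. u j) = (\<Sum>j\<in>I. f (u j))" for I :: "'k set" and u
      by (induction I rule: infinite_finite_induct) (auto simp: f f0)
    have "f (\<Sum>j\<in>S. of_rat (f j * of_nat (d j)) * j) = 0" unfolding s0 by (rule f0)
    then have "(\<Sum>j\<in>S. f j * of_nat (d j) * f j) = 0" unfolding fsum f(2) .
    then have "(\<Sum>j\<in>S. (f j)^2 * of_nat (d j)) = 0" by (simp add: power2_eq_square mult_ac)
    then have "(f l)^2 * of_nat (d l) = 0"
      using sum_nonneg_eq_0_iff[OF S, of "\<lambda>j. (f j)^2 * of_nat (d j)"] l(1) by simp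
    then have "tr (P l) = 0" using trP[OF l(1)] f(3) by simp
    then show ?thesis using tr_idempotent_eq_0D[OF linP idem[OF l(1)]] by blast
  qed
  have "(bracket x ^^ m) z = 0" for z
    by (rule nilpotent_if_eigenprojections_0[OF T S tot[unfolded P_def] nil[unfolded P_def] P0[unfolded P_def]])
  then show ?thesis by blast
qed

section \<open>Engel's theorem\<close>

definition bracket_span :: "'g set \<Rightarrow> 'g set \<Rightarrow> 'g set" where
  "bracket_span K W = span {bracket x y | x y. x \<in> K \<and> y \<in> W}"

lemma bracket_span_base: "x \<in> K \<Longrightarrow> y \<in> W \<Longrightarrow> bracket x y \<in> bracket_span K W"
  unfolding bracket_span_def by (rule span_base) blast

lemma subspace_bracket_span: "subspace (bracket_span K W)" unfolding bracket_span_def by simp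

lemma subspace_bracket_span_pow: "subspace ((bracket_span K ^^ i) UNIV)"
  by (cases i) (auto simp: subspace_bracket_span)

lemma bracket_span_subset:
  assumes "subspace V" "\<And>x y. x \<in> K \<Longrightarrow> y \<in> W \<Longrightarrow> bracket x y \<in> V"
  shows "bracket_span K W \<subseteq> V"
  unfolding bracket_span_def by (rule span_minimal) (use assms in auto)

lemma bracket_span_mono: "W \<subseteq> W' \<Longrightarrow> bracket_span K W \<subseteq> bracket_span K W'"
  unfolding bracket_span_def by (rule span_mono) blast

lemma bracket_span_pow_mono: "W \<subseteq> W' \<Longrightarrow> (bracket_span K ^^ i) W \<subseteq> (bracket_span K ^^ i) W'"
  by (induction i) (simp_all add: bracket_span_mono)

text \<open>Among the subalgebras \<open>K\<close> for which all sufficiently long products of operators \<open>ad k\<close> vanish, one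
  of maximal dimension must be everything: otherwise some \<open>x \<notin> K\<close> satisfies \<open>[K, x] \<subseteq> K\<close>, and \<open>K\<close>
  together with \<open>x\<close> spans a larger subalgebra of the same kind. But a nonzero perfect algebra is not nilpotent.\<close>

lemma not_all_ad_nilpotent:
  assumes simple
  shows "\<exists>x. \<forall>m. \<exists>z. (bracket x ^^ m) z \<noteq> 0"
proof (rule ccontr)
  assume "\<not> ?thesis"
  then have nil: "\<exists>m. \<forall>z. (bracket x ^^ m) z = 0" for x by blast
  define nil_subalgebra where "nil_subalgebra = (\<lambda>K. subspace K \<and> (\<forall>x\<in>K. \<forall>y\<in>K. bracket x y \<in> K) \<and> (\<exists>m. (bracket_span K ^^ m) UNIV = {0}))"
  have "{bracket x y | x y. x \<in> {0} \<and> y \<in> UNIV} \<subseteq> {0}" by (auto simp: bracket_0_left)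
  then have "bracket_span {0} UNIV \<subseteq> {0}" unfolding bracket_span_def by (rule span_minimal) (rule subspace_single_0)
  then have "bracket_span {0} UNIV = {0}" using subspace_0[OF subspace_bracket_span] by blast
  then have "(bracket_span {0} ^^ 1) UNIV = {0}" by simp
  then have nil0: "nil_subalgebra {0}" unfolding nil_subalgebra_def using subspace_single_0 bracket_0_left by blast
  have "\<forall>K. nil_subalgebra K \<longrightarrow> dim K < Suc dimension" using dim_subset_UNIV le_imp_less_Suc by blast
  then obtain K where K: "nil_subalgebra K" "\<And>K'. nil_subalgebra K' \<Longrightarrow> dim K' \<le> dim K"
    using ex_has_greatest_nat[of nil_subalgebra "{0}" dim, OF nil0] by blast
  have sK: "subspace K" and cK: "\<And>x y. x \<in> K \<Longrightarrow> y \<in> K \<Longrightarrow> bracket x y \<in> K"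
    using K(1) unfolding nil_subalgebra_def by auto
  obtain M where M: "(bracket_span K ^^ M) UNIV = {0}" using K(1) unfolding nil_subalgebra_def by auto
  have "K = UNIV"
  proof (rule ccontr)
    assume KU: "K \<noteq> UNIV"
    \<comment> \<open>Apply \<open>K\<close> repeatedly to the whole algebra; the stage before the first one inside \<open>K\<close> supplies \<open>x\<close>.\<close>
    define i where "i = (LEAST i. (bracket_span K ^^ i) UNIV \<subseteq> K)"
    have "(bracket_span K ^^ M) UNIV \<subseteq> K" using M subspace_0[OF sK] by simp
    then have i: "(bracket_span K ^^ i) UNIV \<subseteq> K" unfolding i_def by (rule LeastI)
    have "i \<noteq> 0" using i KU by auto
    then obtain i' where i': "i = Suc i'" using not0_implies_Suc by blast
    have "\<not> (bracket_span K ^^ i') UNIV \<subseteq> K" using not_less_Least[of i' "\<lambda>i. (bracket_span K ^^ i) UNIV \<subseteq> K"] i'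
      unfolding i_def by simp
    then obtain x where x: "x \<in> (bracket_span K ^^ i') UNIV" "x \<notin> K" by blast
    have kx: "bracket k x \<in> K" if "k \<in> K" for k
      using bracket_span_base[OF that x(1)] i i' by auto
    define K' where "K' = {k + scale c x | k c. k \<in> K}"
    have K'I: "k + scale c x \<in> K'" if "k \<in> K" for k c using that unfolding K'_def by blast
    have sK': "subspace K'"
    proof (rule subspaceI)
      show "0 \<in> K'" using K'I[of 0 0] subspace_0[OF sK] by simp
    next
      fix u v assume "u \<in> K'" "v \<in> K'"
      then obtain k c k' c' where "u = k + scale c x" "v = k' + scale c' x" "k \<in> K" "k' \<in> K"
        unfolding K'_def by blast
      then show "u + v \<in> K'" using K'I[of "k + k'" "c + c'"] subspace_add[OF sK]
        by (simp add: scale_left_distrib algebra_simps)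
    next
      fix a u assume "u \<in> K'"
      then obtain k c where "u = k + scale c x" "k \<in> K" unfolding K'_def by blast
      then show "scale a u \<in> K'" using K'I[of "scale a k" "a * c"] subspace_scale[OF sK]
        by (simp add: scale_right_distrib)
    qed
    have KK': "K \<subseteq> K'" using K'I[of _ 0] by auto
    have xK': "x \<in> K'" using K'I[of 0 1] subspace_0[OF sK] by simp
    have cK': "bracket u v \<in> K'" if uv: "u \<in> K'" "v \<in> K'" for u v
    proof -
      obtain k c k' c' where e: "u = k + scale c x" "v = k' + scale c' x" "k \<in> K" "k' \<in> K"
        using uv unfolding K'_def by blast
      have "bracket u v = bracket k k' + scale c' (bracket k x) - scale c (bracket k' x)"
        unfolding e using anticommute[of x k'] by (simp add: bracket_simps alternating)
      also have "\<dots> \<in> K" using e kx cK by (intro subspace_diff subspace_add subspace_scale sK) auto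
      finally show ?thesis using KK' by blast
    qed
    define V where "V = (\<lambda>i. (bracket_span K ^^ i) UNIV)"
    have sV: "subspace (V i)" for i unfolding V_def by (rule subspace_bracket_span_pow)
    have V_Suc: "V (Suc i) = bracket_span K (V i)" for i by (simp add: V_def)
    have xV: "bracket x w \<in> V i" if "w \<in> V i" for i w
      using that
    proof (induction i arbitrary: w)
      case 0 then show ?case by (simp add: V_def)
    next
      case (Suc i)
      have "w \<in> span {bracket a b | a b. a \<in> K \<and> b \<in> V i}" using Suc.prems by (simp add: V_Suc bracket_span_def)
      then show ?case
      proof (induction rule: span_induct_alt)
        case base then show ?case by (simp add: bracket_simps subspace_0[OF sV])
      next
        case (step c u v)
        then obtain a b where ab: "u = bracket a b" "a \<in> K" "b \<in> V i" by blast
        have "bracket x a \<in> K" using kx[OF ab(2)] anticommute[of x a] subspace_neg[OF sK] by simp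
        then have "bracket x u \<in> V (Suc i)"
          unfolding ab(1) bracket_leibniz[of x a b] V_Suc using ab Suc.IH
          by (intro subspace_add subspace_bracket_span bracket_span_base) auto
        then show ?case using step by (simp add: bracket_simps subspace_add subspace_scale sV)
      qed
    qed
    have VS: "V (Suc i) \<subseteq> V i" for i
    proof (induction i)
      case 0 then show ?case by (simp add: V_def)
    next
      case (Suc i) then show ?case using bracket_span_mono by (simp add: V_Suc)
    qed
    obtain p where p: "\<And>z. (bracket x ^^ p) z = 0" using nil by blast
    \<comment> \<open>Modulo \<open>V (Suc i)\<close>, a product of \<open>j\<close> elements of \<open>K'\<close> acts on \<open>V i\<close> as a multiple of the power
      \<open>(ad x)\<^sup>j\<close>.\<close>
    have step: "(bracket_span K' ^^ j) (V i) \<subseteq> {a + (bracket x ^^ j) b | a b. a \<in> V (Suc i) \<and> b \<in> V i}" for i j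
    proof (induction j)
      case 0 then show ?case using subspace_0[OF sV[of "Suc i"]] by force
    next
      case (Suc j)
      let ?X = "\<lambda>j. {a + (bracket x ^^ j) b | a b. a \<in> V (Suc i) \<and> b \<in> V i}"
      have sX: "subspace (?X j)" for j
        using subspace_sums[OF sV[of "Suc i"] subspace_lin_image[OF lin_pow[OF lin_ad[of x]] sV[of i]], of j]
        by (rule back_subst[where P=subspace]) blast
      have xVj: "(bracket x ^^ j) b \<in> V i" if "b \<in> V i" for b j
        using that by (induction j) (auto simp: xV)
      have "bracket_span K' (?X j) \<subseteq> ?X (Suc j)"
      proof (rule bracket_span_subset[OF sX])
        fix u v assume "u \<in> K'" "v \<in> ?X j"
        then obtain k c a b where e: "u = k + scale c x" "k \<in> K" "v = a + (bracket x ^^ j) b" "a \<in> V (Suc i)" "b \<in> V i"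
          unfolding K'_def by blast
        have "a \<in> V i" using e VS by blast
        then have 1: "bracket k (a + (bracket x ^^ j) b) + scale c (bracket x a) \<in> V (Suc i)"
          using e xVj[OF e(5)] xV[OF e(4)]
          by (intro subspace_add[OF sV] subspace_scale[OF sV])
            (auto simp: V_Suc bracket_add_right intro!: subspace_add[OF subspace_bracket_span] bracket_span_base)
        have "bracket u v = (bracket k (a + (bracket x ^^ j) b) + scale c (bracket x a)) + (bracket x ^^ Suc j) (scale c b)"
          unfolding e by (simp add: bracket_simps lin_scale[OF lin_pow[OF lin_ad]] scale_right_distrib)
        then show "bracket u v \<in> ?X (Suc j)" using 1 subspace_scale[OF sV e(5)] by blast
      qed
      then show ?case using bracket_span_mono[OF Suc.IH, of K'] by auto
    qed
    have down: "(bracket_span K' ^^ p) (V i) \<subseteq> V (Suc i)" for i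
      using step[of p i] p by auto
    have "(bracket_span K' ^^ (n * p)) UNIV \<subseteq> V n" for n
    proof (induction n)
      case 0 then show ?case by (simp add: V_def)
    next
      case (Suc n)
      have "(bracket_span K' ^^ (Suc n * p)) UNIV = (bracket_span K' ^^ p) ((bracket_span K' ^^ (n * p)) UNIV)"
        by (simp add: funpow_add)
      also have "\<dots> \<subseteq> (bracket_span K' ^^ p) (V n)" by (rule bracket_span_pow_mono[OF Suc.IH])
      finally show ?case using down by blast
    qed
    then have "(bracket_span K' ^^ (M * p)) UNIV \<subseteq> {0}" using M unfolding V_def by metis
    then have "(bracket_span K' ^^ (M * p)) UNIV = {0}" using subspace_0[OF subspace_bracket_span_pow] by blast
    then have "\<exists>m. (bracket_span K' ^^ m) UNIV = {0}" by (rule exI)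
    then have "nil_subalgebra K'" by (simp add: nil_subalgebra_def sK' cK')
    then have "dim K' \<le> dim K" by (rule K(2))
    then have "K = K'" using subspace_dim_equal[OF sK sK' KK'] by simp
    then show False using xK' x(2) by simp
  qed
  then have lu: "(bracket_span UNIV ^^ M) UNIV = {0}" using M by simp
  have l1: "bracket_span UNIV UNIV = UNIV" using simple_perfect[OF assms] unfolding bracket_span_def by simp
  have "(bracket_span UNIV ^^ i) UNIV = (UNIV :: 'g set)" for i by (induction i) (simp_all add: l1)
  then have "UNIV = {0::'g}" using lu by simp
  then have "x = 0" for x :: 'g by (metis UNIV_I singletonD)
  moreover obtain a b where "bracket a b \<noteq> 0" using assms unfolding simple_def by blast
  ultimately show False by blast
qed

lemma killing_nondegenerate:
  assumes s: simple and "\<And>y. killing x y = 0"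
  shows "x = 0"
proof -
  define R where "R = {x. \<forall>y. killing x y = 0}"
  have "lie_ideal R UNIV" unfolding lie_ideal_def R_def
    by (auto simp: subspace_def killing_0_left killing_add_left killing_scale_left killing_ad_skew)
  then have "R = {0} \<or> R = UNIV" using s unfolding simple_def by blast
  moreover have "R \<noteq> UNIV"
  proof
    assume "R = UNIV"
    then have "killing x y = 0" for x y unfolding R_def by blast
    then show False using ad_nilpotent_if_killing_0[OF s] not_all_ad_nilpotent[OF s] by blast
  qed
  ultimately show ?thesis using assms(2) unfolding R_def by blast
qed

end

section \<open>Short gradings\<close>

locale short_graded_algebra = lie_algebra scale Basis bracket
  for scale :: "'k::{alg_closed_field,field_char_0} \<Rightarrow> 'g::ab_group_add \<Rightarrow> 'g"
    and Basis :: "'g set"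
    and bracket :: "'g \<Rightarrow> 'g \<Rightarrow> 'g" +
  fixes gr :: "int \<Rightarrow> 'g set"
  assumes simple: simple and short: "short_grading gr"
begin

lemma subspace_gr: "subspace (gr i)"
  using short unfolding short_grading_def z_grading_def by blast

lemma gr_bracket: "x \<in> gr i \<Longrightarrow> y \<in> gr j \<Longrightarrow> k = i + j \<Longrightarrow> bracket x y \<in> gr k"
  using short unfolding short_grading_def z_grading_def by blast

lemma gr_eq_0_iff: "gr i \<noteq> {0} \<longleftrightarrow> i \<in> {-1, 0, 1}"
  using short unfolding short_grading_def by (elim conjE allE)

lemma gr_trivial: "x \<in> gr i \<Longrightarrow> i \<notin> {-1, 0, 1} \<Longrightarrow> x = 0"
  using gr_eq_0_iff[of i] by simp

lemma gr_nontrivial: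
  assumes "i \<in> {-1, 0, 1}" shows "\<exists>x\<in>gr i. x \<noteq> 0"
proof -
  have "gr i \<noteq> {0}" using gr_eq_0_iff assms by (rule iffD2)
  then show ?thesis using subspace_0[OF subspace_gr[of i]] by blast
qed

lemma bracket_gr_0: "x \<in> gr i \<Longrightarrow> y \<in> gr j \<Longrightarrow> i + j \<notin> {-1, 0, 1} \<Longrightarrow> bracket x y = 0"
  by (rule gr_trivial[OF gr_bracket[OF _ _ refl]])

lemma gr_0_mem: "0 \<in> gr i" by (rule subspace_0[OF subspace_gr])

definition component :: "int \<Rightarrow> 'g \<Rightarrow> 'g" where
  "component i x = (THE c. finite {i. c i \<noteq> 0} \<and> (\<forall>i. c i \<in> gr i) \<and> x = (\<Sum>i | c i \<noteq> 0. c i)) i"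

lemma grading_unique:
  "\<exists>!c :: int \<Rightarrow> 'g. finite {i. c i \<noteq> 0} \<and> (\<forall>i. c i \<in> gr i) \<and> x = (\<Sum>i | c i \<noteq> 0. c i)"
  by (rule short[unfolded short_grading_def z_grading_def, THEN conjunct1, THEN conjunct2,
        THEN conjunct1, THEN spec])

lemmas component_characterization = theI'[OF grading_unique, folded component_def]

lemma component_props: "component i x \<in> gr i" "x = (\<Sum>i | component i x \<noteq> 0. component i x)"
  by (rule component_characterization[THEN conjunct2, THEN conjunct1, THEN spec])
    (rule component_characterization[THEN conjunct2, THEN conjunct2])

lemma support_sum:
  assumes "\<And>i. c i \<in> gr i"
  shows "finite {i. c i \<noteq> 0}" "(\<Sum>i | c i \<noteq> 0. c i) = c (-1) + c 0 + c 1"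
proof -
  have sub: "{i. c i \<noteq> 0} \<subseteq> {-1, 0, 1}"
  proof
    fix i assume "i \<in> {i. c i \<noteq> 0}"
    then show "i \<in> {-1, 0, 1}" using gr_trivial[OF assms, of i] by blast
  qed
  then show "finite {i. c i \<noteq> 0}" by (rule finite_subset) simp
  have "(\<Sum>i | c i \<noteq> 0. c i) = (\<Sum>i\<in>{-1, 0, 1}. c i)"
    by (rule sum.mono_neutral_left) (use sub in auto)
  then show "(\<Sum>i | c i \<noteq> 0. c i) = c (-1) + c 0 + c 1" by simp
qed

lemma component_decomp: "x = component (-1) x + component 0 x + component 1 x"
  by (rule trans[OF component_props(2) support_sum(2)[OF component_props(1)]])

lemma component_unique:
  assumes "a \<in> gr (-1)" "b \<in> gr 0" "c \<in> gr 1" and x: "x = a + b + c"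
  shows "component (-1) x = a" "component 0 x = b" "component 1 x = c"
proof -
  define d where "d = (\<lambda>i::int. if i = -1 then a else if i = 0 then b else if i = 1 then c else 0)"
  have d: "d i \<in> gr i" for i unfolding d_def using assms gr_0_mem by auto
  have "(\<Sum>i | d i \<noteq> 0. d i) = a + b + c" using support_sum(2)[OF d] by (simp add: d_def)
  then have "finite {i. d i \<noteq> 0} \<and> (\<forall>i. d i \<in> gr i) \<and> x = (\<Sum>i | d i \<noteq> 0. d i)"
    using support_sum(1)[OF d] d x by simp
  then have "(THE c. finite {i. c i \<noteq> 0} \<and> (\<forall>i. c i \<in> gr i) \<and> x = (\<Sum>i | c i \<noteq> 0. c i)) = d"
    by (rule the1_equality[OF grading_unique])
  then have "component i x = d i" for i unfolding component_def by simp
  then show "component (-1) x = a" "component 0 x = b" "component 1 x = c" by (simp_all add: d_def)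
qed

lemma graded_induct [case_names neg zero pos add]:
  assumes "\<And>x. x \<in> gr (-1) \<Longrightarrow> P x" "\<And>x. x \<in> gr 0 \<Longrightarrow> P x" "\<And>x. x \<in> gr 1 \<Longrightarrow> P x"
    "\<And>x y. P x \<Longrightarrow> P y \<Longrightarrow> P (x + y)"
  shows "P x"
  by (subst component_decomp) (intro assms component_props(1))

lemma lin_pr: "i \<in> {-1, 0, 1} \<Longrightarrow> lin (component i)"
proof -
  have 1: "x + y = (component (-1) x + component (-1) y) + (component 0 x + component 0 y) + (component 1 x + component 1 y)" for x y
    by (subst component_decomp[of x], subst component_decomp[of y]) (simp add: algebra_simps)
  have 2: "scale c x = scale c (component (-1) x) + scale c (component 0 x) + scale c (component 1 x)" for c x
    by (subst component_decomp[of x]) (simp add: scale_right_distrib)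
  show "i \<in> {-1, 0, 1} \<Longrightarrow> lin (component i)"
    using component_unique[OF _ _ _ 1] component_unique[OF _ _ _ 2]
    by (intro linI) (auto simp: component_props(1) subspace_add[OF subspace_gr] subspace_scale[OF subspace_gr])
qed

lemma component_gr:
  assumes "x \<in> gr j" "i \<in> {-1, 0, 1}" "j \<in> {-1, 0, 1}" shows "component i x = (if i = j then x else 0)"
  using assms component_unique[of x 0 0 x] component_unique[of 0 x 0 x] component_unique[of 0 0 x x] gr_0_mem by auto

text \<open>The derivation that multiplies \<open>gr i\<close> by \<open>i\<close>.\<close>

definition degree_derivation :: "'g \<Rightarrow> 'g" where
  "degree_derivation x = component 1 x - component (-1) x"

abbreviation "D \<equiv> degree_derivation"

lemma lin_D: "lin D"
  unfolding degree_derivation_def[abs_def] by (intro lin_minus lin_pr) auto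

lemma D_gr: "x \<in> gr i \<Longrightarrow> i \<in> {-1, 0, 1} \<Longrightarrow> D x = scale (of_int i) x"
  unfolding degree_derivation_def by (auto simp: component_gr[of x i])

lemma D_gr': assumes "x \<in> gr i" shows "D x = scale (of_int i) x"
proof (cases "i \<in> {-1, 0, 1}")
  case False
  then have "x = 0" by (rule gr_trivial[OF assms])
  then show ?thesis by (simp add: lin_0[OF lin_D])
qed (rule D_gr[OF assms])

lemma D_derivation: "D (bracket x y) = bracket (D x) y + bracket x (D y)"
proof -
  have h: "D (bracket x y) = bracket (D x) y + bracket x (D y)" if "x \<in> gr i" "y \<in> gr j" for x y i j
    using D_gr'[OF that(1)] D_gr'[OF that(2)] D_gr'[OF gr_bracket[OF that refl]]
    by (simp add: bracket_simps scale_left_distrib)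
  have h2: "D (bracket x y) = bracket (D x) y + bracket x (D y)" if "x \<in> gr i" for x y i
    by (induction y rule: graded_induct)
      (use h[OF that] in \<open>auto simp: bracket_add_right lin_add[OF lin_D] algebra_simps\<close>)
  show ?thesis
    by (induction x rule: graded_induct)
      (use h2 in \<open>auto simp: bracket_add_left lin_add[OF lin_D] algebra_simps\<close>)
qed

lemma tr_ad_D: "tr (\<lambda>z. bracket (bracket x y) (D z)) = - killing x (D y)"
  by (rule tr_derivation_ad[OF lin_D D_derivation])

lemma killing_D: "killing (D x) y = - killing x (D y)"
proof -
  have "tr (\<lambda>z. bracket (bracket x y) (D z)) = tr (\<lambda>z. scale (-1) (bracket (bracket y x) (D z)))"
    by (simp add: anticommute[of x y] bracket_neg_left)
  then show ?thesis
    using tr_ad_D[of x y] tr_ad_D[of y x] tr_scaled[OF lin_comp[OF lin_ad lin_D], of "-1" "bracket y x"]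
    by (simp add: killing_sym[of y])
qed

lemma killing_gr:
  assumes "x \<in> gr i" "y \<in> gr j" "i + j \<noteq> 0" shows "killing x y = 0"
proof -
  have "of_int i * killing x y = - (of_int j * killing x y)"
    using killing_D[of x y] D_gr'[OF assms(1)] D_gr'[OF assms(2)]
    by (simp add: killing_scale_left killing_scale_right)
  then have "of_int (i + j) * killing x y = 0" by (simp add: algebra_simps)
  then show ?thesis using assms(3) by (simp only: mult_eq_0_iff of_int_eq_0_iff) simp
qed

lemma killing_dual:
  assumes x: "x \<in> gr i" and "\<And>u. u \<in> gr (- i) \<Longrightarrow> killing x u = 0"
  shows "x = 0"
proof (rule killing_nondegenerate[OF simple])
  have *: "killing x y = 0" if "y \<in> gr j" for y j
    using that assms(2)[of y] killing_gr[OF x that] by (cases "j = - i") auto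
  show "killing x y = 0" for y
    by (induction y rule: graded_induct) (use * in \<open>auto simp: killing_add_right\<close>)
qed

text \<open>The map that sends \<open>y\<close> to \<open>\<Sum>b. \<kappa>(y, b) b\<close>, summed over the basis, is injective by nondegeneracy, hence
  surjective.\<close>

lemma killing_represents_functionals:
  assumes f: "Vector_Spaces.linear scale (*) f"
  shows "\<exists>y. \<forall>x. f x = killing y x"
proof -
  interpret f: Vector_Spaces.linear scale "(*)" f by fact
  define \<Phi> where "\<Phi> = (\<lambda>y. \<Sum>b\<in>Basis. scale (killing y b) b)"
  have L: "lin \<Phi>" unfolding \<Phi>_def
    by (rule linI) (auto simp: killing_add_left killing_scale_left scale_left_distrib sum.distrib scale_sum_right)
  have ext: "u = w" if "\<And>b. b \<in> Basis \<Longrightarrow> u b = w b"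
    "\<And>x y. u (x + y) = u x + u y" "\<And>c x. u (scale c x) = c * u x"
    "\<And>x y. w (x + y) = w x + w y" "\<And>c x. w (scale c x) = c * w x" for u w :: "'g \<Rightarrow> 'k"
  proof
    fix x
    have u0: "u 0 = 0" "w 0 = 0" using that(3)[of 0 0] that(5)[of 0 0] by auto
    have "x \<in> span Basis" by (simp add: span_Basis)
    then show "u x = w x"
      by (induction rule: span_induct_alt) (simp_all add: u0 that)
  qed
  have coeff: "(\<Sum>b\<in>Basis. scale (u b) b) = (\<Sum>b\<in>Basis. scale (w b) b) \<Longrightarrow> b \<in> Basis \<Longrightarrow> u b = w b" for u w b
  proof -
    assume "(\<Sum>b\<in>Basis. scale (u b) b) = (\<Sum>b\<in>Basis. scale (w b) b)" and b: "b \<in> Basis"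
    then have "(\<Sum>b\<in>Basis. scale (u b - w b) b) = 0" by (simp add: scale_left_diff_distrib sum_subtractf)
    then have "u b - w b = 0" by (rule independentD[OF independent_Basis finite_Basis subset_refl _ b])
    then show "u b = w b" by simp
  qed
  have "y = 0" if "\<Phi> y = 0" for y
  proof (rule killing_nondegenerate[OF simple])
    have "killing y b = 0" if "b \<in> Basis" for b
      using coeff[of "killing y" "\<lambda>_. 0" b] \<open>\<Phi> y = 0\<close> that by (simp add: \<Phi>_def)
    then have "killing y = (\<lambda>_. 0)" by (intro ext) (auto simp: killing_add_right killing_scale_right)
    then show "killing y x = 0" for x by simp
  qed
  then have "inj \<Phi>" using L by (metis Vector_Spaces.linear.axioms(3) module_hom.inj_iff_eq_0)
  then have "surj \<Phi>" using linear_inj_imp_surj[OF L] by blast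
  then obtain y where y: "\<Phi> y = (\<Sum>b\<in>Basis. scale (f b) b)" by (metis surjD)
  have "f = killing y"
    by (rule ext) (use coeff[of "killing y" f] y in \<open>auto simp: \<Phi>_def f.add f.scale killing_add_right killing_scale_right\<close>)
  then show ?thesis by auto
qed

lemma separate_by_killing:
  assumes W: "subspace W" "W \<subseteq> gr 1" and u: "u \<in> gr 1" "u \<notin> W"
  obtains w where "w \<in> gr (-1)" "\<And>x. x \<in> W \<Longrightarrow> killing w x = 0" "killing w u = 1"
proof -
  obtain f where f: "Vector_Spaces.linear scale (*) f" "\<And>x. x \<in> W \<Longrightarrow> f x = 0" "f u = 1"
    using exists_functional[OF W(1) u(2)] by blast
  obtain y where y: "\<And>x. f x = killing y x" using killing_represents_functionals[OF f(1)] by blast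
  have "killing y x = killing (component (-1) y) x" if "x \<in> gr 1" for x
    using killing_gr[OF component_props(1)[of 0 y] that] killing_gr[OF component_props(1)[of 1 y] that]
    by (subst component_decomp[of y]) (simp add: killing_add_left)
  then have k: "killing (component (-1) y) x = f x" if "x \<in> gr 1" for x using that y by simp
  show thesis
  proof (rule that[OF component_props(1)])
    show "killing (component (-1) y) x = 0" if "x \<in> W" for x using k[of x] f(2)[OF that] W(2) that by auto
    show "killing (component (-1) y) u = 1" using k[OF u(1)] f(3) by simp
  qed
qed

text \<open>By invariance, \<open>ad v\<close> on \<open>gr (-1)\<close> and \<open>ad v\<close> on \<open>gr 0\<close> are adjoint up to sign with
  respect to the pairings of \<open>gr (-1)\<close> with \<open>gr 1\<close> and of \<open>gr 0\<close> with itself. So one is injective iff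
  the other is surjective onto \<open>gr 1\<close>.\<close>

lemma ad_surjective_if_injective:
  assumes v: "v \<in> gr 1" and inj: "\<And>y. y \<in> gr (-1) \<Longrightarrow> bracket v y = 0 \<Longrightarrow> y = 0"
  shows "(\<lambda>x. bracket x v) ` gr 0 = gr 1"
proof (rule ccontr)
  let ?W = "(\<lambda>x. bracket x v) ` gr 0"
  have W: "subspace ?W"
    by (rule subspace_lin_image[OF linear_left subspace_gr])
  have sub: "?W \<subseteq> gr 1" using v by (auto intro: gr_bracket)
  assume "?W \<noteq> gr 1"
  then obtain u where u: "u \<in> gr 1" "u \<notin> ?W" using sub by blast
  obtain z where z: "z \<in> gr (-1)" "\<And>x. x \<in> ?W \<Longrightarrow> killing z x = 0" "killing z u = 1"
    using separate_by_killing[OF W sub u] by blast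
  have "bracket v z = 0"
  proof (rule killing_dual[of _ 0])
    show "bracket v z \<in> gr 0" using gr_bracket[OF v z(1)] by simp
    fix x assume "x \<in> gr (- 0)"
    then have x: "x \<in> gr 0" by simp
    have "killing z (bracket x v) = 0" using z(2) x by blast
    then show "killing (bracket v z) x = 0"
      using killing_ad_skew[of v z x] by (simp add: anticommute[of v x] killing_neg_right)
  qed
  then have "z = 0" by (rule inj[OF z(1)])
  then show False using z(3) by (simp add: killing_0_left)
qed

lemma ad_injective_if_surjective:
  assumes v: "v \<in> gr 1" and sur: "(\<lambda>x. bracket x v) ` gr 0 = gr 1"
    and y: "y \<in> gr (-1)" "bracket v y = 0"
  shows "y = 0"
proof (rule killing_dual[OF y(1)])
  fix u assume "u \<in> gr (- (- 1))"
  then obtain x where x: "x \<in> gr 0" "u = bracket x v" using sur by auto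
  have "killing y (bracket x v) = killing (bracket v y) x"
    using killing_ad_skew[of v y x] by (simp add: anticommute[of v x] killing_neg_right)
  then show "killing y u = 0" using x y by (simp add: killing_0_left)
qed

section \<open>Regular elements of degree one\<close>

text \<open>Expanding \<open>ad [y, [y, x]] = 0\<close> gives \<open>ad y ad x ad y = 0\<close>, so \<open>ad y ad x\<close> has square \<open>0\<close> and
  trace \<open>0\<close> for every \<open>x\<close>.\<close>

lemma sandwich_0:
  assumes "\<And>z. bracket y (bracket y z) = 0"
  shows "y = 0"
proof (rule killing_nondegenerate[OF simple])
  fix x
  have "bracket y (bracket x (bracket y z)) = 0" for z
  proof -
    have "bracket (bracket y (bracket y x)) z = 0" using assms by (simp add: bracket_0_left)
    then have "bracket y (bracket y (bracket x z)) - bracket y (bracket x (bracket y z))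
        - (bracket y (bracket x (bracket y z)) - bracket x (bracket y (bracket y z))) = 0"
      by (simp add: bracket_bracket_left bracket_diff_right)
    then have "bracket y (bracket x (bracket y z)) + bracket y (bracket x (bracket y z)) = 0"
      using assms by (simp add: bracket_0_right) (simp add: algebra_simps eq_neg_iff_add_eq_0 neg_eq_iff_add_eq_0)
    then have "scale 2 (bracket y (bracket x (bracket y z))) = 0"
      using scale_left_distrib[of 1 1] by simp
    then show ?thesis by simp
  qed
  then have "((\<lambda>z. bracket y (bracket x z)) ^^ 2) z = 0" for z by (simp add: numeral_2_eq_2 bracket_0_right)
  then show "killing y x = 0" unfolding killing_def by (rule tr_nilpotent[OF lin_ad_ad])
qed

text \<open>Choose \<open>v\<close> such that \<open>ad v\<close> has maximal rank on \<open>gr (-1)\<close>, and let \<open>y \<in> gr (-1)\<close> commute with \<open>v\<close>.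
  First, \<open>[u, y] \<in> [v, gr (-1)]\<close> for all \<open>u \<in> gr 1\<close>: otherwise \<open>[v + t u, t\<^sup>-\<^sup>1 y] = [u, y]\<close> would raise
  the rank of \<open>ad (v + t u)\<close> for a suitable \<open>t\<close>. Write \<open>[u, y] = [v, y']\<close>. Since \<open>v\<close> commutes with
  \<open>[u', y]\<close> for \<open>u' \<in> gr 1\<close>, the Killing form of \<open>[u, y]\<close> and \<open>[u', y]\<close> is \<open>0\<close>. Hence
  \<open>[y, [y, u']]\<close> is orthogonal to \<open>gr 1\<close> and vanishes, which makes \<open>y\<close> a sandwich element.\<close>

lemma exists_regular:
  "\<exists>v\<in>gr 1. \<forall>y\<in>gr (-1). bracket v y = 0 \<longrightarrow> y = 0"
proof -
  define r where "r = (\<lambda>v. dim (bracket v ` gr (-1)))"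
  have "\<forall>v. v \<in> gr 1 \<longrightarrow> r v < Suc dimension" unfolding r_def using dim_subset_UNIV le_imp_less_Suc by blast
  then obtain v where v: "v \<in> gr 1" "\<And>v'. v' \<in> gr 1 \<Longrightarrow> r v' \<le> r v"
    using ex_has_greatest_nat[of "\<lambda>v. v \<in> gr 1" 0 r, OF gr_0_mem] by blast
  have sub: "subspace (bracket w ` gr (-1))" for w
    by (rule subspace_lin_image[OF lin_ad subspace_gr])
  have key: "bracket u y \<in> bracket v ` gr (-1)" if u: "u \<in> gr 1" and y: "y \<in> gr (-1)" "bracket v y = 0" for u y
  proof (rule ccontr)
    let ?W = "bracket v ` gr (-1)" and ?z = "bracket u y"
    assume z: "?z \<notin> ?W"
    interpret p: vector_space_pair scale scale by unfold_locales
    obtain B where B: "B \<subseteq> ?W" "independent B" "?W \<subseteq> span B" "card B = dim ?W"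
      using basis_exists[of ?W] by metis
    have spB: "span B = ?W" using B sub by (simp add: span_subspace)
    have ind: "independent (insert ?z B)" using B z spB by (simp add: independent_insertI)
    have zB: "?z \<notin> B" using z B(1) by blast
    obtain g where g: "\<And>b. b \<in> B \<Longrightarrow> g b \<in> gr (-1) \<and> b = bracket v (g b)"
      using B(1) by (metis image_iff subsetD)
    obtain T where T: "lin T" "\<And>b. b \<in> insert ?z B \<Longrightarrow> T b = (if b = ?z then 0 else bracket u (g b))"
      using p.linear_independent_extend[OF ind, of "\<lambda>b. if b = ?z then 0 else bracket u (g b)"] by blast
    obtain t where t: "t \<noteq> 0" "inj (\<lambda>x. x + scale t (T x))"
      using exists_injective_perturbation[OF T(1)] by blast
    define L where "L = (\<lambda>x. x + scale t (T x))"
    have L: "lin L" unfolding L_def by (intro lin_plus lin_id lin_scaled T)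
    have injL: "inj_on L A" for A using t(2) unfolding L_def by (rule inj_on_subset) simp
    define w where "w = v + scale t u"
    have w: "w \<in> gr 1" unfolding w_def using v u by (intro subspace_add subspace_scale subspace_gr)
    have "L b \<in> bracket w ` gr (-1)" if b: "b \<in> insert ?z B" for b
    proof (cases "b = ?z")
      case True
      have "L b = bracket w (scale (inverse t) y)"
        using T(2)[OF b] True t(1) y(2) by (simp add: L_def w_def bracket_simps)
      then show ?thesis using y subspace_scale[OF subspace_gr] by blast
    next
      case False
      then have bB: "b \<in> B" using b by simp
      have "L b = bracket w (g b)" using T(2)[OF b] False g[OF bB] by (simp add: L_def w_def bracket_simps)
      then show ?thesis using g[OF bB] by blast
    qed
    then have "L ` insert ?z B \<subseteq> bracket w ` gr (-1)" by blast
    moreover have "independent (L ` insert ?z B)"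
      using module_hom.independent_injective_image[OF Vector_Spaces.linear.axioms(3)[OF L] ind injL] .
    ultimately have "card (L ` insert ?z B) \<le> r w" unfolding r_def by (rule independent_card_le_dim)
    then have "card (insert ?z B) \<le> r w" unfolding card_image[OF injL] .
    then have "Suc (card B) \<le> r w" using zB finiteI_independent[OF B(2)] by simp
    then show False using v(2)[OF w] B(4) unfolding r_def by simp
  qed
  have "y = 0" if y: "y \<in> gr (-1)" "bracket v y = 0" for y
  proof (rule sandwich_0)
    have yy: "bracket y (bracket u' y) = 0" if u': "u' \<in> gr 1" for u'
    proof (rule killing_dual[of _ "-1"])
      show "bracket y (bracket u' y) \<in> gr (- 1)" by (rule gr_bracket[OF y(1) gr_bracket[OF u' y(1) refl]]) simp
      fix u assume "u \<in> gr (- (- 1))"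
      then have u: "u \<in> gr 1" by simp
      obtain y' where y': "y' \<in> gr (-1)" "bracket u y = bracket v y'" using key[OF u y] by blast
      have "bracket v (bracket u' y) = bracket (bracket v u') y + bracket u' (bracket v y)" by (rule bracket_leibniz)
      also have "\<dots> = 0" using bracket_gr_0[OF v(1) u'] y(2) by (simp add: bracket_simps)
      finally have 0: "bracket v (bracket u' y) = 0" .
      have "killing u (bracket y (bracket u' y)) = killing (bracket u y) (bracket u' y)"
        by (rule killing_invariant[symmetric])
      also have "\<dots> = - killing y' (bracket v (bracket u' y))" unfolding y'(2) by (rule killing_ad_skew)
      finally show "killing (bracket y (bracket u' y)) u = 0" using 0 by (simp add: killing_0_right killing_sym[of _ u])
    qed
    show "bracket y (bracket y z) = 0" for z
    proof (induction z rule: graded_induct)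
      case (neg x)
      then show ?case using bracket_gr_0[OF y(1) neg] by (simp add: bracket_0_right)
    next
      case (zero x)
      then have "bracket y x \<in> gr (-1)" using y by (auto intro: gr_bracket)
      then show ?case using bracket_gr_0[OF y(1)] by simp
    next
      case (pos x)
      then show ?case using yy[OF pos] by (simp add: anticommute[of y x] bracket_neg_right)
    next
      case (add a b) then show ?case by (simp add: bracket_add_right)
    qed
  qed
  then show ?thesis using v(1) by blast
qed

section \<open>Graded sl(2)-triples\<close>

lemma tr_ad_commutator_0:
  assumes Q: "lin Q" "\<And>z. Q (bracket e z) = bracket e (Q z)"
  shows "tr (\<lambda>z. bracket (bracket w e) (Q z)) = 0"
proof -
  note l1 = lin_comp[OF lin_ad Q(1)]
  note l2 = lin_comp[OF lin_ad l1]
  have "tr (\<lambda>z. bracket (bracket w e) (Q z))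
      = tr (\<lambda>z. bracket w (bracket e (Q z)) - bracket e (bracket w (Q z)))"
    by (simp add: bracket_bracket_left)
  also have "\<dots> = tr (\<lambda>z. bracket w (bracket e (Q z))) - tr (\<lambda>z. bracket e (bracket w (Q z)))"
    by (rule tr_minus[OF l2 l2])
  also have "tr (\<lambda>z. bracket e (bracket w (Q z))) = tr (\<lambda>z. bracket w (Q (bracket e z)))"
    by (rule tr_commute[OF lin_ad l1])
  finally show ?thesis by (simp add: Q(2))
qed

text \<open>The main point is \<open>e \<in> [e, [e, gr (-1)]]\<close>. Otherwise some \<open>w \<in> gr (-1)\<close> is orthogonal to this space
  but not to \<open>e\<close>; the former means \<open>[e, [e, w]] = 0\<close>. Then \<open>c = [w, e]\<close> commutes with \<open>e\<close>, so all
  traces of powers of \<open>ad c\<close> vanish and \<open>ad c\<close> is nilpotent. It also commutes with \<open>D\<close>, so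
  \<open>ad c D\<close> is nilpotent and has trace \<open>0\<close>. But this trace is \<open>- \<kappa>(w, e)\<close>. The relation
  \<open>[h, f] = -2 f\<close> follows, since \<open>[h, f] + 2 f\<close> commutes with \<open>e\<close> and \<open>ad e\<close> is
  injective on \<open>gr (-1)\<close>.\<close>

lemma jacobson_morozov_graded:
  assumes e: "e \<in> gr 1" and sur: "(\<lambda>x. bracket x e) ` gr 0 = gr 1"
  obtains f h where "f \<in> gr (-1)" "h \<in> gr 0" "bracket e f = h" "bracket h e = scale 2 e"
    "bracket h f = scale (-2) f"
proof -
  let ?W = "(\<lambda>f. bracket e (bracket e f)) ` gr (-1)"
  have W: "subspace ?W"
    by (rule subspace_lin_image[OF lin_ad_ad subspace_gr])
  have "e \<in> ?W"
  proof (rule ccontr)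
    assume eW: "e \<notin> ?W"
    have eegr: "bracket e (bracket e u) \<in> gr 1" if "u \<in> gr (-1)" for u
      by (rule gr_bracket[OF e gr_bracket[OF e that refl]]) simp
    then have sub: "?W \<subseteq> gr 1" by blast
    obtain w where w: "w \<in> gr (-1)" and wW: "\<And>x. x \<in> ?W \<Longrightarrow> killing w x = 0" and we: "killing w e = 1"
      using separate_by_killing[OF W sub e eW] by blast
    have eew: "bracket e (bracket e w) = 0"
    proof (rule killing_dual[of _ 1])
      show "bracket e (bracket e w) \<in> gr 1" by (rule eegr[OF w])
      fix u assume u: "u \<in> gr (- 1)"
      then have "killing w (bracket e (bracket e u)) = 0" using wW by blast
      then show "killing (bracket e (bracket e w)) u = 0" by (simp add: killing_ad_skew)
    qed
    define c where "c = bracket w e"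
    have c: "c \<in> gr 0" unfolding c_def by (rule gr_bracket[OF w e]) simp
    have ce: "bracket c e = 0"
    proof -
      have "bracket c e = bracket e (bracket e w)"
        unfolding c_def anticommute[of w e] by (simp add: bracket_neg_left anticommute[of e "bracket e w"])
      then show ?thesis using eew by simp
    qed
    have ec: "bracket c (bracket e z) = bracket e (bracket c z)" for z
      using bracket_leibniz[of c e z] ce by (simp add: bracket_0_left)
    have pw: "(bracket c ^^ k) (bracket e z) = bracket e ((bracket c ^^ k) z)" for k z
      by (induction k) (simp_all add: ec)
    have tr0: "tr (bracket c ^^ k) = 0" if k: "k > 0" for k
    proof -
      obtain j where j: "k = Suc j" using gr0_implies_Suc[OF k] by (elim exE)
      have "tr (\<lambda>z. bracket (bracket w e) ((bracket c ^^ j) z)) = 0"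
        by (rule tr_ad_commutator_0[OF lin_pow[OF lin_ad] pw])
      then show ?thesis unfolding j funpow.simps(2) o_def c_def .
    qed
    obtain m where m: "\<And>z. (bracket c ^^ m) z = 0"
      using nilpotent_if_tr_powers_0[OF lin_ad tr0] by blast
    have Dc: "D (bracket c z) = bracket c (D z)" for z
      using D_derivation[of c z] D_gr'[OF c] by (simp add: bracket_0_left)
    have Dpw: "D ((bracket c ^^ j) z) = (bracket c ^^ j) (D z)" for j z
      by (induction j) (simp_all add: Dc)
    have "((\<lambda>z. bracket c (D z)) ^^ j) z = (bracket c ^^ j) ((D ^^ j) z)" for j z
    proof (induction j)
      case (Suc j)
      then show ?case by (simp add: Dpw)
    qed simp
    then have "((\<lambda>z. bracket c (D z)) ^^ m) z = 0" for z using m by simp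
    then have "tr (\<lambda>z. bracket c (D z)) = 0" by (rule tr_nilpotent[OF lin_comp[OF lin_ad lin_D]])
    then have "killing w (D e) = 0" unfolding c_def using tr_ad_D[of w e] by simp
    then show False using D_gr'[OF e] we by simp
  qed
  then obtain f0 where f0: "f0 \<in> gr (-1)" "bracket e (bracket e f0) = e" by (metis imageE)
  define f where "f = scale (-2) f0"
  define h where "h = bracket e f"
  have f: "f \<in> gr (-1)" unfolding f_def by (rule subspace_scale[OF subspace_gr f0(1)])
  have h: "h \<in> gr 0" unfolding h_def by (rule gr_bracket[OF e f]) simp
  have eh: "bracket e h = scale (-2) e" unfolding h_def f_def bracket_scale_right f0(2) by (rule refl)
  have he: "bracket h e = scale 2 e" using anticommute[of h e] eh by simp
  have "bracket h f + scale 2 f = 0"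
  proof (rule ad_injective_if_surjective[OF e sur])
    show "bracket h f + scale 2 f \<in> gr (-1)"
      by (intro subspace_add[OF subspace_gr] subspace_scale[OF subspace_gr] f gr_bracket[OF h f]) simp
    show "bracket e (bracket h f + scale 2 f) = 0"
      by (simp add: bracket_add_right bracket_scale_right bracket_leibniz[of e h f] eh h_def[symmetric]
          bracket_scale_left bracket_neg_left alternating)
  qed
  then have "bracket h f = scale (-2) f" by (simp add: eq_neg_iff_add_eq_0)
  then show ?thesis using that f h h_def he by blast
qed

lemma
  assumes T: "bracket e f = h" "bracket h e = scale 2 e" "bracket h f = scale (-2) f"
  shows sl2_he: "bracket e (bracket h z) = bracket h (bracket e z) - scale 2 (bracket e z)"
    and sl2_hf: "bracket h (bracket f z) = bracket f (bracket h z) - scale 2 (bracket f z)"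
    and sl2_ef: "bracket e (bracket f z) = bracket h z + bracket f (bracket e z)"
  using bracket_leibniz[of h e z] bracket_leibniz[of h f z] bracket_leibniz[of e f z]
  by (simp_all add: T bracket_scale_left bracket_neg_left)

lemma
  assumes T: "bracket e f = h" "bracket h e = scale 2 e" "bracket h f = scale (-2) f"
    and v: "bracket e v = 0"
  shows sl2_ef1: "bracket e (bracket f v) = bracket h v"
    and sl2_ef2: "bracket e (bracket f (bracket f v)) = scale 2 (bracket f (bracket h v - v))"
    and sl2_ef3: "bracket e (bracket f (bracket f (bracket f v)))
        = scale 3 (bracket f (bracket f (bracket h v - scale 2 v)))"
proof -
  show 1: "bracket e (bracket f v) = bracket h v" by (simp add: sl2_ef[OF T] v bracket_0_right)
  have "bracket e (bracket f (bracket f v)) = bracket h (bracket f v) + bracket f (bracket h v)"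
    by (simp add: sl2_ef[OF T, of "bracket f v"] 1)
  then show 2: "bracket e (bracket f (bracket f v)) = scale 2 (bracket f (bracket h v - v))"
    by (simp add: sl2_hf[OF T] bracket_simps scale_2)
  have "bracket e (bracket f (bracket f (bracket f v)))
      = bracket h (bracket f (bracket f v)) + bracket f (scale 2 (bracket f (bracket h v - v)))"
    by (simp add: sl2_ef[OF T, of "bracket f (bracket f v)"] 2)
  then show "bracket e (bracket f (bracket f (bracket f v)))
        = scale 3 (bracket f (bracket f (bracket h v - scale 2 v)))"
    by (simp add: sl2_hf[OF T] bracket_simps scale_2 scale_3)
qed

text \<open>On the kernel of \<open>ad e\<close>, the operator \<open>(ad e)\<^sup>n (ad f)\<^sup>n\<close> is \<open>n!\<close> times
  \<open>H (H - 1) \<cdots> (H - n + 1)\<close> with \<open>H = ad h\<close>. Here \<open>(ad f)\<^sup>2 z = 0\<close> for reasons of degree.\<close>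

lemma centralizer_weights:
  assumes T: "bracket e f = h" "bracket h e = scale 2 e" "bracket h f = scale (-2) f"
    and mem: "e \<in> gr 1" "h \<in> gr 0" "f \<in> gr (-1)"
    and z: "z \<in> gr 0" "bracket e z = 0"
  shows "bracket h (bracket h z) = bracket h z"
proof -
  have "bracket f z \<in> gr (-1)" using gr_bracket[OF mem(3) z(1)] by simp
  then have "bracket f (bracket f z) = 0" using bracket_gr_0[OF mem(3)] by simp
  then have "scale 2 (bracket f (bracket h z - z)) = 0"
    using sl2_ef2[OF T z(2)] by (simp add: bracket_0_right)
  then have F0: "bracket f (bracket h z - z) = 0" by simp
  have E0: "bracket e (bracket h z - z) = 0" using z(2) by (simp add: bracket_simps sl2_he[OF T])
  have "bracket h (bracket h z - z) = 0" using sl2_ef1[OF T E0] F0 by (simp add: bracket_0_right)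
  then show ?thesis by (simp add: bracket_diff_right)
qed

text \<open>Put \<open>H = ad h\<close>. The assumption \<open>no1\<close> and \<open>H (H - 1) = 0\<close> on the centraliser of \<open>e\<close> in \<open>gr 0\<close> show
  that \<open>H\<close> vanishes there. As \<open>(ad f)\<^sup>3\<close> kills \<open>gr 1\<close>, also \<open>H (H - 1) (H - 2) = 0\<close> on \<open>gr 1\<close>. Pulling
  this back along \<open>ad e\<close>, which shifts \<open>H\<close> by \<open>2\<close>, one finds that \<open>(H + 2) (H + 1) H\<close> maps \<open>gr 0\<close> into
  the centraliser, so \<open>(H + 2) (H + 1) H\<^sup>2 = 0\<close> on \<open>gr 0\<close>. Since \<open>H\<close> is skew for the Killing form,
  \<open>(H - 2) (H - 1) H\<^sup>2 = 0\<close> as well; together \<open>H\<^sup>2 = 0\<close> on \<open>gr 0\<close>. Then \<open>(H - 2)\<^sup>2 = 0\<close> on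
  \<open>gr 1 = [e, gr 0]\<close>, and comparison with the cubic relation leaves \<open>H = 2\<close>. Duality gives \<open>H = -2\<close>
  on \<open>gr (-1)\<close>. Finally \<open>H x\<close> for \<open>x \<in> gr 0\<close> commutes with \<open>gr 1\<close> and \<open>gr (-1)\<close>, and the elements of
  \<open>gr 0\<close> with this property form a proper ideal.\<close>

lemma characteristic_of_triple:
  assumes T: "bracket e f = h" "bracket h e = scale 2 e" "bracket h f = scale (-2) f"
    and mem: "e \<in> gr 1" "h \<in> gr 0" "f \<in> gr (-1)"
    and sur: "(\<lambda>x. bracket x e) ` gr 0 = gr 1"
    and no1: "\<And>x. x \<in> gr 0 \<Longrightarrow> bracket x e = 0 \<Longrightarrow> bracket h x = x \<Longrightarrow> x = 0"
  shows "bracket h x = scale 2 (D x)"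
proof -
  let ?H = "bracket h" and ?E = "bracket e" and ?F = "bracket f"
  note he = sl2_he[OF T]
  have hgr: "?H z \<in> gr i" if "z \<in> gr i" for z i by (rule gr_bracket[OF mem(2) that]) simp
  have cent: "?H z = 0" if z: "z \<in> gr 0" "?E z = 0" for z
  proof -
    have "?H (?H z) = ?H z" by (rule centralizer_weights[OF T mem z])
    moreover have "bracket (?H z) e = 0"
      using z(2) anticommute[of "?H z" e] by (simp add: he bracket_0_right)
    ultimately show ?thesis using no1[OF hgr[OF z(1)]] by blast
  qed
  have E1: "?E v = 0" if "v \<in> gr 1" for v using bracket_gr_0[OF mem(1) that] by simp
  have top: "?H (?H (?H v - scale 2 v)) = ?H (?H v - scale 2 v)" if v: "v \<in> gr 1" for v
  proof -
    have "?F (?F v) \<in> gr (-1)" by (rule gr_bracket[OF mem(3) gr_bracket[OF mem(3) v refl]]) simp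
    then have "?F (?F (?F v)) = 0" using bracket_gr_0[OF mem(3)] by simp
    then have "scale 3 (?F (?F (?H v - scale 2 v))) = 0" using sl2_ef3[OF T E1[OF v]] by (simp add: bracket_0_right)
    then have F2: "?F (?F (?H v - scale 2 v)) = 0" by simp
    let ?u = "?H v - scale 2 v"
    have u: "?u \<in> gr 1" using v by (intro subspace_diff subspace_scale subspace_gr hgr)
    have "scale 2 (?F (?H ?u - ?u)) = 0" using sl2_ef2[OF T E1[OF u]] F2 by (simp only: bracket_0_right)
    then have F1: "?F (?H ?u - ?u) = 0" by simp
    have w: "?H ?u - ?u \<in> gr 1" by (rule subspace_diff[OF subspace_gr hgr[OF u] u])
    have "?H (?H ?u - ?u) = 0" using sl2_ef1[OF T E1[OF w]] F1 by (simp only: bracket_0_right)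
    then show ?thesis by (simp only: bracket_diff_right[of h "?H ?u"]) simp
  qed
  have quartic: "?H (?H (?H (?H z))) + scale 3 (?H (?H (?H z))) + scale 2 (?H (?H z)) = 0"
    if z: "z \<in> gr 0" for z
  proof -
    let ?p = "?H (?H (?H z)) + scale 3 (?H (?H z)) + scale 2 (?H z)"
    have Ez: "?E z \<in> gr 1" using gr_bracket[OF mem(1) z] by simp
    have "?E ?p = ?H (?H (?H (?E z) - scale 2 (?E z))) - ?H (?H (?E z) - scale 2 (?E z))"
      by (simp add: he bracket_simps scale_2 scale_3 algebra_simps)
    then have "?E ?p = 0" using top[OF Ez] by simp
    moreover have "?p \<in> gr 0" using z by (intro subspace_add subspace_scale subspace_gr hgr)
    ultimately have "?H ?p = 0" by (intro cent)
    then show ?thesis by (simp add: bracket_simps)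
  qed
  have quartic': "?H (?H (?H (?H z))) - scale 3 (?H (?H (?H z))) + scale 2 (?H (?H z)) = 0"
    if z: "z \<in> gr 0" for z
  proof (rule killing_dual[of _ 0])
    show "?H (?H (?H (?H z))) - scale 3 (?H (?H (?H z))) + scale 2 (?H (?H z)) \<in> gr 0"
      using z by (intro subspace_add subspace_diff subspace_scale subspace_gr hgr)
    fix u assume "u \<in> gr (- 0)"
    then have "killing z (?H (?H (?H (?H u))) + scale 3 (?H (?H (?H u))) + scale 2 (?H (?H u))) = 0"
      using quartic[of u] by (simp add: killing_0_right)
    then show "killing (?H (?H (?H (?H z))) - scale 3 (?H (?H (?H z))) + scale 2 (?H (?H z))) u = 0"
      by (simp add: killing_add_left killing_add_right killing_sym[of _ u] killing_diff_right
            killing_scale_left killing_scale_right)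
         (simp add: killing_sym[of u] killing_ad_skew)
  qed
  have HH: "?H (?H z) = 0" if z: "z \<in> gr 0" for z
  proof -
    have "scale 6 (?H (?H (?H z))) = 0"
    proof -
      have "scale 6 (?H (?H (?H z))) = scale 3 (?H (?H (?H z))) + scale 3 (?H (?H (?H z)))"
        using scale_left_distrib[of 3 3] by simp
      also have "\<dots> = 0" using arg_cong2[OF quartic[OF z] quartic'[OF z], of "(-)"] by simp
      finally show ?thesis .
    qed
    then have 3: "?H (?H (?H z)) = 0" by simp
    show ?thesis using quartic[OF z] by (simp add: 3 bracket_0_right)
  qed
  have pos: "?H v = scale 2 v" if v: "v \<in> gr 1" for v
  proof -
    obtain x where x: "x \<in> gr 0" "v = bracket x e" using v sur by blast
    define z where "z = - x"
    have z: "z \<in> gr 0" "v = ?E z" unfolding z_def x(2)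
      using subspace_neg[OF subspace_gr x(1)] anticommute[of x e] by (auto simp: bracket_neg_right)
    define u where "u = ?H v - scale 2 v"
    have u: "u = ?E (?H z)" unfolding u_def z(2) by (simp add: he)
    have "?E (?H (?H z)) = ?H u - scale 2 u" unfolding u by (rule he)
    then have hu: "?H u = scale 2 u" using HH[OF z(1)] by (simp add: bracket_0_right)
    have "?H (?H u) = ?H u" unfolding u_def by (rule top[OF v])
    then have "scale 2 u = u" unfolding hu bracket_scale_right by simp
    then have "scale (2 - 1) u = 0" unfolding scale_left_diff_distrib by simp
    then show ?thesis by (simp add: u_def)
  qed
  have neg: "?H y = scale (- 2) y" if y: "y \<in> gr (-1)" for y
  proof -
    have "?H y + scale 2 y = 0"
    proof (rule killing_dual[of _ "-1"])
      show "?H y + scale 2 y \<in> gr (- 1)" using y by (intro subspace_add subspace_scale subspace_gr hgr)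
      fix u assume "u \<in> gr (- (- 1))"
      then show "killing (?H y + scale 2 y) u = 0" using pos[of u]
        by (simp add: killing_add_left killing_scale_left killing_scale_right killing_ad_skew)
    qed
    then show ?thesis by (simp add: eq_neg_iff_add_eq_0)
  qed
  have zero: "?H x = 0" if x: "x \<in> gr 0" for x
  proof -
    define Z where "Z = {z \<in> gr 0. (\<forall>u\<in>gr 1. bracket z u = 0) \<and> (\<forall>u\<in>gr (-1). bracket z u = 0)}"
    have sZ: "subspace Z" unfolding Z_def
      by (rule subspaceI) (auto simp: bracket_simps gr_0_mem subspace_add[OF subspace_gr] subspace_scale[OF subspace_gr])
    have Zb: "bracket a z \<in> Z" if z: "z \<in> Z" for a z
    proof (induction a rule: graded_induct)
      case (neg a)
      then have "bracket a z = 0" using z anticommute[of a z] unfolding Z_def by simp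
      then show ?case using subspace_0[OF sZ] by simp
    next
      case (pos a)
      then have "bracket a z = 0" using z anticommute[of a z] unfolding Z_def by simp
      then show ?case using subspace_0[OF sZ] by simp
    next
      case (zero a)
      have z0: "z \<in> gr 0" and z1: "\<And>u. u \<in> gr 1 \<Longrightarrow> bracket z u = 0" and z2: "\<And>u. u \<in> gr (-1) \<Longrightarrow> bracket z u = 0"
        using z unfolding Z_def by auto
      have "bracket (bracket a z) u = 0" if "u \<in> gr i" "i = 1 \<or> i = -1" for u i
      proof -
        have "bracket a u \<in> gr i" using gr_bracket[OF zero that(1)] by simp
        then show ?thesis using that z1 z2 by (auto simp: bracket_bracket_left bracket_simps)
      qed
      then show ?case unfolding Z_def using gr_bracket[OF zero z0] by simp
    next
      case (add a b) then show ?case by (simp add: bracket_add_left subspace_add[OF sZ])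
    qed
    have "lie_ideal Z UNIV" unfolding lie_ideal_def using sZ Zb by blast
    moreover have "Z \<noteq> UNIV"
    proof
      assume "Z = UNIV"
      obtain w where w: "w \<in> gr 1" "w \<noteq> 0" using gr_nontrivial[of 1] by auto
      have "w \<in> gr 0" using \<open>Z = UNIV\<close> unfolding Z_def by blast
      then have "w = 0" using component_gr[of w 0 1] component_gr[OF w(1), of 1] by simp
      then show False using w by simp
    qed
    ultimately have "Z = {0}" using simple unfolding simple_def by blast
    moreover have "?H x \<in> Z"
    proof -
      have "bracket (?H x) u = 0" if "u \<in> gr 1" for u
        using pos[OF that] pos[OF gr_bracket[OF x that]] by (simp add: bracket_bracket_left bracket_scale_right)
      moreover have "bracket (?H x) u = 0" if "u \<in> gr (-1)" for u
        using neg[OF that] neg[OF gr_bracket[OF x that]] by (simp add: bracket_bracket_left bracket_simps)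
      ultimately show ?thesis unfolding Z_def using hgr[OF x] by blast
    qed
    ultimately show ?thesis by blast
  qed
  show ?thesis
  proof (induction x rule: graded_induct)
    case (neg x) then show ?case using \<open>\<And>y. y \<in> gr (-1) \<Longrightarrow> ?H y = scale (- 2) y\<close> D_gr'[OF neg] by simp
  next
    case (zero x) then show ?case using \<open>\<And>x. x \<in> gr 0 \<Longrightarrow> ?H x = 0\<close> D_gr'[OF zero] by simp
  next
    case (pos x) then show ?case using \<open>\<And>y. y \<in> gr 1 \<Longrightarrow> ?H y = scale 2 y\<close> D_gr'[OF pos] by simp
  next
    case (add x y) then show ?case by (simp add: bracket_add_right lin_add[OF lin_D] scale_right_distrib)
  qed
qed

end

section \<open>Triads from sl(2)-triples\<close>

context lie_algebra
begin

text \<open>The exponential series of \<open>ad x\<close> cut off after the quadratic term, exact when \<open>(ad x)\<^sup>3 = 0\<close>.\<close>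

definition expad :: "'g \<Rightarrow> 'g \<Rightarrow> 'g" where
  "expad x z = z + bracket x z + scale (1/2) (bracket x (bracket x z))"

lemma exp_nilpotent_cubic:
  assumes "\<And>z. bracket x (bracket x (bracket x z)) = 0"
  shows "exp_nilpotent (bracket x) = expad x"
proof
  fix z
  have pow: "(bracket x ^^ i) z = 0" if "i \<ge> 3" for i
  proof -
    obtain j where j: "i = 3 + j" using \<open>i \<ge> 3\<close> le_Suc_ex by blast
    show ?thesis unfolding j funpow_add using assms by (simp add: numeral_3_eq_3)
  qed
  have sub: "{i. (bracket x ^^ i) z \<noteq> 0} \<subseteq> {0, 1, 2}"
  proof
    fix i assume "i \<in> {i. (bracket x ^^ i) z \<noteq> 0}"
    then have "\<not> i \<ge> 3" using pow by auto
    then show "i \<in> {0, 1, 2}" by auto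
  qed
  have "exp_nilpotent (bracket x) z = (\<Sum>i\<in>{0,1,2}. scale (1 / fact i) ((bracket x ^^ i) z))"
    unfolding exp_nilpotent_def by (rule sum.mono_neutral_left) (use sub in auto)
  also have "\<dots> = expad x z" by (simp add: expad_def numeral_2_eq_2)
  finally show "exp_nilpotent (bracket x) z = expad x z" .
qed

lemma expad_inverse:
  assumes "\<And>z. bracket x (bracket x (bracket x z)) = 0"
  shows "expad (- x) (expad x z) = z"
proof -
  have h: "scale (1/2) u + scale (1/2) u = u" for u
    using scale_left_distrib[of "1/2" "1/2" u] by simp
  show ?thesis unfolding expad_def using h[of "bracket x (bracket x z)"]
    by (simp add: bracket_simps assms algebra_simps)
qed

lemma lin_expad: "lin (expad x)"
  unfolding expad_def[abs_def] by (intro lin_plus lin_id lin_ad lin_scaled lin_ad_ad)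

text \<open>The terms of degree three and four in the product on the right are, up to constants, the
  Leibniz expansions of \<open>(ad x)\<^sup>3 [y, z]\<close> and \<open>(ad x)\<^sup>4 [y, z]\<close>, which are \<open>0\<close>.\<close>

lemma expad_bracket:
  assumes N3: "\<And>z. bracket x (bracket x (bracket x z)) = 0"
  shows "expad x (bracket y z) = bracket (expad x y) (expad x z)"
proof -
  let ?N = "bracket x"
  have N: "?N (bracket u v) = bracket (?N u) v + bracket u (?N v)" for u v by (rule bracket_leibniz)
  have e2: "?N (?N (bracket y z)) = bracket (?N (?N y)) z + scale 2 (bracket (?N y) (?N z)) + bracket y (?N (?N z))"
    by (simp add: N[of y z] bracket_add_right N[of "?N y" z] N[of y "?N z"] scale_2 algebra_simps)
  have e3: "bracket (?N (?N y)) (?N z) + bracket (?N y) (?N (?N z)) = 0"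
  proof -
    have "?N (?N (?N (bracket y z))) = 0" by (rule N3)
    then have "scale 3 (bracket (?N (?N y)) (?N z) + bracket (?N y) (?N (?N z))) = 0"
      unfolding e2
      by (simp add: bracket_add_right bracket_scale_right N[of "?N (?N y)" z] N[of "?N y" "?N z"]
          N[of y "?N (?N z)"] N3 bracket_0_left bracket_0_right scale_2 scale_3 algebra_simps)
    then show ?thesis by simp
  qed
  have e4: "bracket (?N (?N y)) (?N (?N z)) = 0"
  proof -
    have "?N (bracket (?N (?N y)) (?N z) + bracket (?N y) (?N (?N z))) = 0" unfolding e3 by (rule bracket_0_right)
    then have "scale 2 (bracket (?N (?N y)) (?N (?N z))) = 0"
      by (simp add: bracket_add_right N[of "?N (?N y)" "?N z"] N[of "?N y" "?N (?N z)"] N3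
          bracket_0_left bracket_0_right scale_2)
    then show ?thesis by simp
  qed
  have e3': "bracket (?N (?N y)) (?N z) = - bracket (?N y) (?N (?N z))"
    using e3 by (rule eq_neg_iff_add_eq_0[THEN iffD2])
  have "expad x (bracket y z) = bracket y z + (bracket (?N y) z + bracket y (?N z))
      + (scale (1/2) (bracket (?N (?N y)) z) + bracket (?N y) (?N z) + scale (1/2) (bracket y (?N (?N z))))"
    unfolding expad_def e2 unfolding N[of y z] by (simp add: scale_right_distrib)
  also have "\<dots> = bracket (expad x y) (expad x z)"
    unfolding expad_def by (simp add: bracket_add_left bracket_add_right bracket_scale_left bracket_scale_right e3' e4
        scale_right_distrib scale_right_diff_distrib)
  finally show ?thesis .
qed

lemma inner_comp: "\<tau> \<in> inner_automorphisms \<Longrightarrow> \<tau>' \<in> inner_automorphisms \<Longrightarrow> \<tau> \<circ> \<tau>' \<in> inner_automorphisms"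
  by (induction rule: inner_automorphisms.induct) (auto simp: comp_assoc intro: inner_automorphisms.exp_ad)

lemma expad_inner:
  assumes "\<And>z. bracket x (bracket x (bracket x z)) = 0"
  shows "expad x \<in> inner_automorphisms"
proof -
  have "nilpotent_map (bracket x)" unfolding nilpotent_map_def
    by (rule exI[of _ 3]) (simp add: numeral_3_eq_3 assms)
  then have "exp_nilpotent (bracket x) \<circ> id \<in> inner_automorphisms"
    by (rule inner_automorphisms.exp_ad[OF _ inner_automorphisms.id])
  then show ?thesis using exp_nilpotent_cubic[OF assms] by simp
qed

text \<open>The group of inner automorphisms is given by generators; carrying the inverse along makes it
  explicit as a product of generators.\<close>

definition invertible_inner :: "('g \<Rightarrow> 'g) \<Rightarrow> ('g \<Rightarrow> 'g) \<Rightarrow> bool" where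
  "invertible_inner \<tau> \<tau>' \<longleftrightarrow> \<tau> \<in> inner_automorphisms \<and> \<tau>' \<in> inner_automorphisms \<and>
     \<tau> \<circ> \<tau>' = id \<and> \<tau>' \<circ> \<tau> = id \<and> automorphism \<tau> \<and> automorphism \<tau>'"

lemma automorphism_comp: "automorphism \<sigma> \<Longrightarrow> automorphism \<tau> \<Longrightarrow> automorphism (\<sigma> \<circ> \<tau>)"
  unfolding automorphism_def using lin_comp[of \<sigma> \<tau>] by (auto simp: o_def intro: bij_comp[unfolded o_def])

lemma automorphism_id: "automorphism id"
  unfolding automorphism_def using lin_id bij_id by (simp add: id_def)

lemma invertible_inner_comp:
  assumes "invertible_inner \<tau> \<tau>'" "invertible_inner \<rho> \<rho>'"
  shows "invertible_inner (\<tau> \<circ> \<rho>) (\<rho>' \<circ> \<tau>')"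
proof -
  have "(\<tau> \<circ> \<rho>) \<circ> (\<rho>' \<circ> \<tau>') = \<tau> \<circ> (\<rho> \<circ> \<rho>') \<circ> \<tau>'" "(\<rho>' \<circ> \<tau>') \<circ> (\<tau> \<circ> \<rho>) = \<rho>' \<circ> (\<tau>' \<circ> \<tau>) \<circ> \<rho>"
    by (simp_all add: comp_assoc)
  then show ?thesis using assms unfolding invertible_inner_def
    by (simp add: inner_comp automorphism_comp)
qed

lemma invertible_inner_sym: "invertible_inner \<tau> \<tau>' \<Longrightarrow> invertible_inner \<tau>' \<tau>"
  unfolding invertible_inner_def by simp

lemma invertible_inner_id: "invertible_inner id id"
  unfolding invertible_inner_def by (simp add: inner_automorphisms.id automorphism_id)

lemma expad_invertible_inner:
  assumes "\<And>z. bracket x (bracket x (bracket x z)) = 0"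
  shows "invertible_inner (expad x) (expad (- x))"
proof -
  have n: "\<And>z. bracket (- x) (bracket (- x) (bracket (- x) z)) = 0" by (simp add: bracket_simps assms)
  have i: "expad x \<circ> expad (- x) = id" "expad (- x) \<circ> expad x = id"
    using expad_inverse[OF n] expad_inverse[OF assms] by (auto simp: fun_eq_iff)
  have "bij (expad x)" "bij (expad (- x))" using i by (auto intro: o_bij)
  then show ?thesis unfolding invertible_inner_def automorphism_def
    using i lin_expad expad_bracket[OF assms] expad_bracket[OF n] expad_inner[OF assms] expad_inner[OF n] by simp
qed

lemma triad_from_conjugates:
  assumes s1: "involution \<sigma>"
    and t: "invertible_inner \<tau> \<tau>'" "invertible_inner \<rho> \<rho>'"
    and prod: "\<sigma> \<circ> (\<tau> \<circ> \<sigma> \<circ> \<tau>') = \<rho> \<circ> \<sigma> \<circ> \<rho>'"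
  shows "triad {\<sigma>, \<tau> \<circ> \<sigma> \<circ> \<tau>', \<rho> \<circ> \<sigma> \<circ> \<rho>'}"
proof -
  define C where "C = {\<alpha> \<circ> \<sigma> \<circ> \<alpha>' | \<alpha> \<alpha>'. invertible_inner \<alpha> \<alpha>'}"
  have CI: "\<alpha> \<circ> \<sigma> \<circ> \<alpha>' \<in> C" if "invertible_inner \<alpha> \<alpha>'" for \<alpha> \<alpha>' using that unfolding C_def by blast
  have \<sigma>: "automorphism \<sigma>" "\<sigma> \<circ> \<sigma> = id" "\<sigma> \<noteq> id" using s1 unfolding involution_def by auto
  have inv: "involution \<beta>" if bC: "\<beta> \<in> C" for \<beta>
  proof -
    obtain \<alpha> \<alpha>' where a: "\<beta> = \<alpha> \<circ> \<sigma> \<circ> \<alpha>'" "invertible_inner \<alpha> \<alpha>'" using bC unfolding C_def by blast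
    note i = a(2)[unfolded invertible_inner_def]
    have "\<beta> \<circ> \<beta> = \<alpha> \<circ> \<sigma> \<circ> (\<alpha>' \<circ> \<alpha>) \<circ> \<sigma> \<circ> \<alpha>'" unfolding a(1) by (simp add: comp_assoc)
    also have "\<dots> = \<alpha> \<circ> (\<sigma> \<circ> \<sigma>) \<circ> \<alpha>'" using i by (simp add: comp_assoc)
    also have "\<dots> = id" using i \<sigma> by simp
    finally have 1: "\<beta> \<circ> \<beta> = id" .
    have "\<beta> \<noteq> id"
    proof
      assume "\<beta> = id"
      then have "\<alpha>' \<circ> (\<alpha> \<circ> \<sigma> \<circ> \<alpha>') \<circ> \<alpha> = \<alpha>' \<circ> \<alpha>" unfolding a(1) by simp
      then have "(\<alpha>' \<circ> \<alpha>) \<circ> \<sigma> \<circ> (\<alpha>' \<circ> \<alpha>) = \<alpha>' \<circ> \<alpha>" by (simp add: comp_assoc)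
      then show False using i \<sigma> by simp
    qed
    then show ?thesis unfolding involution_def using 1 a i \<sigma> by (simp add: automorphism_comp)
  qed
  have conj: "conjugate_inv \<beta> \<gamma>" if "\<beta> \<in> C" "\<gamma> \<in> C" for \<beta> \<gamma>
  proof -
    obtain \<alpha> \<alpha>' where a: "\<beta> = \<alpha> \<circ> \<sigma> \<circ> \<alpha>'" "invertible_inner \<alpha> \<alpha>'" using \<open>\<beta> \<in> C\<close> unfolding C_def by blast
    obtain \<delta> \<delta>' where d: "\<gamma> = \<delta> \<circ> \<sigma> \<circ> \<delta>'" "invertible_inner \<delta> \<delta>'" using \<open>\<gamma> \<in> C\<close> unfolding C_def by blast
    have i: "invertible_inner (\<delta> \<circ> \<alpha>') (\<alpha> \<circ> \<delta>')"
      by (rule invertible_inner_comp[OF d(2) invertible_inner_sym[OF a(2)]])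
    have iv: "inv (\<delta> \<circ> \<alpha>') = \<alpha> \<circ> \<delta>'"
      using i unfolding invertible_inner_def by (intro inv_unique_comp) auto
    have "(\<delta> \<circ> \<alpha>') \<circ> \<beta> \<circ> inv (\<delta> \<circ> \<alpha>') = \<delta> \<circ> (\<alpha>' \<circ> \<alpha>) \<circ> \<sigma> \<circ> (\<alpha>' \<circ> \<alpha>) \<circ> \<delta>'"
      unfolding iv a(1) by (simp add: comp_assoc)
    also have "\<dots> = \<gamma>" using a(2) unfolding d(1) invertible_inner_def by simp
    finally show ?thesis unfolding conjugate_inv_def using i unfolding invertible_inner_def by metis
  qed
  let ?s2 = "\<tau> \<circ> \<sigma> \<circ> \<tau>'" and ?s3 = "\<rho> \<circ> \<sigma> \<circ> \<rho>'"
  have m: "\<sigma> \<in> C" "?s2 \<in> C" "?s3 \<in> C" using CI[OF invertible_inner_id] CI t by simp_all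
  have p: "\<sigma> \<circ> ?s2 = ?s3" by (rule prod)
  have n: "?s2 \<noteq> id" "?s3 \<noteq> id" using inv[OF m(2)] inv[OF m(3)] unfolding involution_def by auto
  have d1: "\<sigma> \<noteq> ?s2" using p \<sigma>(2) n(2) by metis
  have d2: "?s2 \<noteq> ?s3"
  proof
    assume e: "?s2 = ?s3"
    have "\<sigma> \<circ> ?s2 \<circ> ?s2 = ?s2 \<circ> ?s2" using p e by simp
    then have "\<sigma> \<circ> (?s2 \<circ> ?s2) = ?s2 \<circ> ?s2" by (simp only: comp_assoc)
    moreover have "?s2 \<circ> ?s2 = id" using inv[OF m(2)] unfolding involution_def by blast
    ultimately show False using \<sigma>(3) by simp
  qed
  have d3: "\<sigma> \<noteq> ?s3"
  proof
    assume e: "\<sigma> = ?s3"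
    have "\<sigma> \<circ> (\<sigma> \<circ> ?s2) = \<sigma> \<circ> \<sigma>" using p e by simp
    then have "(\<sigma> \<circ> \<sigma>) \<circ> ?s2 = \<sigma> \<circ> \<sigma>" by (simp only: comp_assoc)
    then show False unfolding \<sigma>(2) using n(1) by simp
  qed
  have c3: "card {\<sigma>, ?s2, ?s3} = 3" using d1 d2 d3 by simp
  have i3: "\<forall>\<beta>\<in>{\<sigma>, ?s2, ?s3}. involution \<beta>" using inv[OF m(1)] inv[OF m(2)] inv[OF m(3)] by blast
  have sub: "{\<sigma>, ?s2, ?s3} \<subseteq> C" using m by simp
  have k3: "\<forall>\<beta>\<in>{\<sigma>, ?s2, ?s3}. \<forall>\<gamma>\<in>{\<sigma>, ?s2, ?s3}. conjugate_inv \<beta> \<gamma>"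
    by (intro ballI conj subsetD[OF sub])
  have e3: "\<exists>\<sigma>\<^sub>1 \<sigma>\<^sub>2 \<sigma>\<^sub>3. {\<sigma>, ?s2, ?s3} = {\<sigma>\<^sub>1, \<sigma>\<^sub>2, \<sigma>\<^sub>3} \<and> \<sigma>\<^sub>1 \<circ> \<sigma>\<^sub>2 = \<sigma>\<^sub>3"
    by (intro exI conjI, rule refl, rule p)
  show ?thesis unfolding triad_def by (intro conjI c3 i3 k3 e3)
qed

end

context short_graded_algebra
begin

lemma ad_cubed_0:
  assumes "x \<in> gr i" "i = 1 \<or> i = -1"
  shows "bracket x (bracket x (bracket x z)) = 0"
proof -
  have *: "bracket x (bracket x (bracket x z)) = 0" if "z \<in> gr j" "j = -1 \<or> j = 0 \<or> j = 1" for z j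
  proof (rule gr_trivial)
    show "bracket x (bracket x (bracket x z)) \<in> gr (i + (i + (i + j)))"
      by (intro gr_bracket[OF assms(1) _ refl] that)
    show "i + (i + (i + j)) \<notin> {- 1, 0, 1}" using assms(2) that(2) by auto
  qed
  show ?thesis
    by (induction z rule: graded_induct) (use * in \<open>simp_all add: bracket_add_right\<close>)
qed

text \<open>For \<open>2 a b = -1\<close>, the automorphism \<open>\<tau> = exp (b ad f) exp (a ad e)\<close> is the action of a matrix that
  conjugates \<open>diag(1, -1)\<close> into \<open>(0 1; b\<^sup>2 0)\<close> up to scalars. The operator \<open>S a b\<close> is the action of the
  latter, computed on the one- and three-dimensional modules: it exchanges \<open>gr 1\<close> and \<open>gr (-1)\<close>, and on
  \<open>gr 0\<close> it is \<open>-1\<close> on \<open>[e, gr (-1)]\<close> and \<open>1\<close> on the centraliser of the triple. The values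
  \<open>b\<^sup>2 = 1\<close> and \<open>b\<^sup>2 = -1\<close> give the two involutions that complete the triad.\<close>

lemma triad_from_triple:
  assumes T: "bracket e f = h" "bracket h e = scale 2 e" "bracket h f = scale (-2) f"
    and mem: "e \<in> gr 1" "f \<in> gr (-1)"
    and hD: "\<And>x. bracket h x = scale 2 (D x)"
    and inv: "involution \<sigma>"
    and \<sigma>: "\<And>x. x \<in> gr 0 \<Longrightarrow> \<sigma> x = x" "\<And>x. x \<in> gr 1 \<Longrightarrow> \<sigma> x = - x" "\<And>x. x \<in> gr (-1) \<Longrightarrow> \<sigma> x = - x"
  shows "\<exists>\<sigma>\<^sub>2 \<sigma>\<^sub>3. triad {\<sigma>, \<sigma>\<^sub>2, \<sigma>\<^sub>3}"
proof -
  let ?E = "bracket e" and ?F = "bracket f"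
  have lin\<sigma>: "lin \<sigma>" using inv unfolding involution_def automorphism_def by blast
  note ef = sl2_ef[OF T]
  have gE: "?E z \<in> gr j" if "z \<in> gr i" "j = 1 + i" for z i j by (rule gr_bracket[OF mem(1) that])
  have gF: "?F z \<in> gr j" if "z \<in> gr i" "j = -1 + i" for z i j by (rule gr_bracket[OF mem(2) that])
  have EFv: "?E (?F v) = scale 2 v" and Ev: "?E v = 0" if "v \<in> gr 1" for v
    using bracket_gr_0[OF mem(1) that] D_gr'[OF that] by (simp_all add: ef hD bracket_0_right)
  have Fy: "?F y = 0" and FEy: "?F (?E y) = scale 2 y" if "y \<in> gr (-1)" for y
  proof -
    show 0: "?F y = 0" using bracket_gr_0[OF mem(2) that] by simp
    show "?F (?E y) = scale 2 y" using ef[of y] D_gr'[OF that] by (simp add: 0 hD bracket_0_right)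
  qed
  have EFx: "?E (?F x) = ?F (?E x)" and FFx: "?F (?F x) = 0" and EEx: "?E (?E x) = 0" if "x \<in> gr 0" for x
  proof -
    show "?E (?F x) = ?F (?E x)" using D_gr'[OF that] by (simp add: ef hD)
    show "?F (?F x) = 0" by (rule Fy[OF gF[OF that]]) simp
    show "?E (?E x) = 0" by (rule Ev[OF gE[OF that]]) simp
  qed
  define S where "S = (\<lambda>a b z. scale (- (b^2 / 2)) (?F (?F z)) - scale (2 * a^2) (?E (?E z))
      + (component 0 z - ?E (?F (component 0 z))))"
  have linS: "lin (S a b)" for a b
  proof -
    have p: "lin (component 0)" by (rule lin_pr) simp
    show ?thesis unfolding S_def by (intro lin_plus lin_minus lin_scaled lin_ad_ad p lin_comp[OF lin_ad_ad p])
  qed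
  have Sv: "S a b v = scale (- (b^2 / 2)) (?F (?F v))" if "v \<in> gr 1" for v a b
    using component_gr[OF that, of 0] by (simp add: S_def Ev[OF that] bracket_0_right)
  have Sy: "S a b y = scale (- (2 * a^2)) (?E (?E y))" if "y \<in> gr (-1)" for y a b
    using component_gr[OF that, of 0] by (simp add: S_def Fy[OF that] bracket_0_right)
  have Sx: "S a b x = x - ?E (?F x)" if "x \<in> gr 0" for x a b
    using component_gr[OF that, of 0] by (simp add: S_def FFx[OF that] EEx[OF that])
  define \<tau> where "\<tau> = (\<lambda>a b. expad (scale b f) \<circ> expad (scale a e))"
  define \<tau>' where "\<tau>' = (\<lambda>a b. expad (- scale a e) \<circ> expad (- scale b f))"
  have ii: "invertible_inner (\<tau> a b) (\<tau>' a b)" for a b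
    unfolding \<tau>_def \<tau>'_def
    by (intro invertible_inner_comp expad_invertible_inner ad_cubed_0[of _ 1] ad_cubed_0[of _ "-1"]
          subspace_scale subspace_gr mem disjI1 disjI2 refl)
  have lin\<tau>: "lin (\<tau> a b)" for a b unfolding \<tau>_def o_def by (rule lin_comp[OF lin_expad lin_expad])
  have X: "expad (scale a e) z = z + scale a (?E z) + scale (a^2/2) (?E (?E z))" for a z
    by (simp add: expad_def bracket_scale_left bracket_scale_right power2_eq_square)
  have Y: "expad (scale b f) z = z + scale b (?F z) + scale (b^2/2) (?F (?F z))" for b z
    by (simp add: expad_def bracket_scale_left bracket_scale_right power2_eq_square)
  have key: "\<tau> a b (\<sigma> z) = S a b (\<tau> a b z)" if ab: "2 * a * b = -1" for a b z
  proof (induction z rule: graded_induct)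
    case (pos v)
    have Fv: "?F v \<in> gr 0" and FFv: "?F (?F v) \<in> gr (-1)" using gF[OF pos, of 0] gF[OF gF[OF pos refl], of "-1"] by simp_all
    have t: "\<tau> a b v = v + scale b (?F v) + scale (b^2/2) (?F (?F v))"
      by (simp add: \<tau>_def X Y Ev[OF pos] bracket_0_right)
    have 1: "?E (?F (?F v)) = scale 2 (?F v)" by (simp add: EFx[OF Fv] EFv[OF pos] bracket_scale_right)
    have 2: "?E (?E (?F (?F v))) = scale 4 v" by (simp add: 1 EFv[OF pos] bracket_scale_right)
    have two: "?E (scale 2 (?F v)) = scale 4 v" using 2 unfolding 1 .
    have ab2: "a^2 * b^2 * 4 = 1" using arg_cong[OF ab, of "\<lambda>x. x^2"] by (simp add: power_mult_distrib mult_ac)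
    have "S a b (\<tau> a b v) = scale (- (b^2 / 2)) (?F (?F v)) + scale b (?F v - scale 2 (?F v))
        + scale (b^2/2) (scale (- (2 * a^2)) (scale 4 v))"
      unfolding t by (simp only: lin_add[OF linS] lin_scale[OF linS] Sv[OF pos] Sx[OF Fv] Sy[OF FFv] 1 two)
    also have "\<dots> = - \<tau> a b v"
      unfolding t using ab2 by (simp add: scale_2 algebra_simps scale_right_distrib)
    also have "\<dots> = \<tau> a b (\<sigma> v)" by (simp add: \<sigma>(2)[OF pos] lin_neg[OF lin\<tau>])
    finally show ?case by simp
  next
    case (zero x)
    have Ex: "?E x \<in> gr 1" and Fx: "?F x \<in> gr (-1)" and FEx: "?F (?E x) \<in> gr 0"
      using gE[OF zero, of 1] gF[OF zero, of "-1"] gF[OF gE[OF zero refl], of 0] by simp_all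
    have 1: "?F (?F (?E x)) = scale 2 (?F x)" using FEy[OF Fx] by (simp add: EFx[OF zero])
    have 2: "?E (?E (?F x)) = scale 2 (?E x)" using EFv[OF Ex] by (simp add: EFx[OF zero])
    have t: "\<tau> a b x = (x - scale (1/2) (?F (?E x))) + scale a (?E x) + scale (b/2) (?F x)"
    proof -
      have "\<tau> a b x = x + scale a (?E x) + scale b (?F x) + scale (a * b) (?F (?E x)) + scale (b^2/2*a*2) (?F x)"
        by (simp add: \<tau>_def X Y EEx[OF zero] FFx[OF zero] bracket_simps scale_right_distrib 1 mult_ac)
      moreover have "a * b = - (1/2)" using ab by (simp add: field_simps)
      moreover have "b^2/2*a*2 = (2 * a * b) * b / 2" by (simp add: power2_eq_square)
      then have "b^2/2*a*2 = - (b/2)" unfolding ab by simp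
      moreover have "scale b (?F x) = scale (b/2) (?F x) + scale (b/2) (?F x)" by (simp flip: scale_left_distrib)
      ultimately show ?thesis by simp
    qed
    have 3: "?E (?F (?F (?E x))) = scale 2 (?F (?E x))" by (simp add: 1 bracket_scale_right EFx[OF zero])
    have x': "x - scale (1/2) (?F (?E x)) \<in> gr 0" using zero FEx by (intro subspace_diff subspace_scale subspace_gr)
    have 4: "?E (?F (x - scale (1/2) (?F (?E x)))) = 0"
      by (simp add: bracket_simps 3 EFx[OF zero])
    have "S a b (\<tau> a b x) = (x - scale (1/2) (?F (?E x))) + scale a (scale (- (b^2 / 2)) (scale 2 (?F x)))
       + scale (b/2) (scale (- (2 * a^2)) (scale 2 (?E x)))"
      unfolding t by (simp only: lin_add[OF linS] lin_scale[OF linS] Sx[OF x'] Sv[OF Ex] Sy[OF Fx] 1 2 4 diff_zero)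
    also have "\<dots> = (x - scale (1/2) (?F (?E x))) + scale (- (a * b^2)) (?F x) + scale (- (2 * a^2 * b)) (?E x)"
      by (simp add: mult_ac)
    also have "- (a * b^2) = - (2 * a * b) * b / 2" by (simp add: power2_eq_square)
    also have "\<dots> = b/2" unfolding ab by simp
    also have "- (2 * a^2 * b) = - (2 * a * b) * a" by (simp add: power2_eq_square)
    also have "\<dots> = a" unfolding ab by simp
    finally have "S a b (\<tau> a b x) = \<tau> a b x" unfolding t by (simp add: algebra_simps)
    then show ?case by (simp add: \<sigma>(1)[OF zero])
  next
    case (neg y)
    have Ey: "?E y \<in> gr 0" and EEy: "?E (?E y) \<in> gr 1" using gE[OF neg, of 0] gE[OF gE[OF neg refl], of "1"] by simp_all
    have 1: "?F (?E (?E y)) = scale 2 (?E y)" using EFx[OF Ey] by (simp add: FEy[OF neg] bracket_scale_right)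
    have 2: "?F (?F (?E (?E y))) = scale 4 y" by (simp add: 1 FEy[OF neg] bracket_scale_right)
    have "a^2 * b = (2 * a * b) * a / 2" "a^2 * b^2 = (2 * a * b)^2 / 4" "a * b = (2 * a * b) / 2"
      by (simp_all add: power2_eq_square)
    then have a2b: "a^2 * b = - (a / 2)" "a^2 * b^2 = 1/4" "a * b = - (1/2)" unfolding ab by simp_all
    have t: "\<tau> a b y = scale (1/4) y + scale (a/2) (?E y) + scale (a^2/2) (?E (?E y))"
    proof -
      have "\<tau> a b y = y + scale (2 * (a * b)) y + scale (a^2 * b^2) y + scale a (?E y) + scale (a^2 * b) (?E y)
         + scale (a^2/2) (?E (?E y))"
        by (simp add: \<tau>_def X Y Fy[OF neg] FEy[OF neg] bracket_simps scale_right_distrib 1 2 mult_ac)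
      moreover have "scale a (?E y) = scale (a/2) (?E y) + scale (a/2) (?E y)" by (simp flip: scale_left_distrib)
      ultimately show ?thesis unfolding a2b by simp
    qed
    have 3: "?E y - ?E (?F (?E y)) = - ?E y" by (simp add: FEy[OF neg] bracket_scale_right scale_2 bracket_add_right)
    have "S a b (\<tau> a b y) = scale (1/4) (scale (- (2 * a^2)) (?E (?E y))) + scale (a/2) (- ?E y)
       + scale (a^2/2) (scale (- (b^2 / 2)) (scale 4 y))"
      unfolding t by (simp only: lin_add[OF linS] lin_scale[OF linS] Sx[OF Ey] Sv[OF EEy] Sy[OF neg] 2 3)
    also have "\<dots> = - scale (a^2/2) (?E (?E y)) - scale (a/2) (?E y) - scale (a^2 * b^2) y"
      by (simp add: mult_ac)
    also have "\<dots> = - \<tau> a b y" unfolding t a2b by simp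
    also have "\<dots> = \<tau> a b (\<sigma> y)" by (simp add: \<sigma>(3)[OF neg] lin_neg[OF lin\<tau>])
    finally show ?case by simp
  next
    case (add x y)
    then show ?case by (simp add: lin_add[OF lin\<sigma>] lin_add[OF lin\<tau>] lin_add[OF linS])
  qed
  have conj: "\<tau> a b \<circ> \<sigma> \<circ> \<tau>' a b = S a b" if "2 * a * b = -1" for a b
  proof
    fix z
    have "\<tau> a b (\<tau>' a b z) = z" using ii[of a b] unfolding invertible_inner_def by (metis comp_apply id_apply)
    then show "(\<tau> a b \<circ> \<sigma> \<circ> \<tau>' a b) z = S a b z" using key[OF that] by simp
  qed
  obtain i :: 'k where i: "i^2 = -1" using nth_root_exists[of 2 "-1 :: 'k"] by auto
  have ab1: "2 * (1/2) * (-1) = (-1::'k)" and ab2: "2 * (i/2) * i = -1" using i by (simp_all add: power2_eq_square)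
  have "\<sigma> \<circ> S (1/2) (-1) = S (i/2) i"
  proof
    fix z show "(\<sigma> \<circ> S (1/2) (-1)) z = S (i/2) i z"
    proof (induction z rule: graded_induct)
      case (pos v)
      have FFv: "?F (?F v) \<in> gr (-1)" using gF[OF gF[OF pos refl], of "-1"] by simp
      show ?case using i by (simp add: Sv[OF pos] lin_scale[OF lin\<sigma>] lin_neg[OF lin\<sigma>] \<sigma>(3)[OF FFv])
    next
      case (neg v)
      have FFv: "?E (?E v) \<in> gr 1" using gE[OF gE[OF neg refl], of "1"] by simp
      show ?case using i by (simp add: Sy[OF neg] lin_scale[OF lin\<sigma>] lin_neg[OF lin\<sigma>] \<sigma>(2)[OF FFv] power_divide)
    next
      case (zero x)
      have "?E (?F x) \<in> gr 0" using gE[OF gF[OF zero refl], of 0] by simp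
      then have "x - ?E (?F x) \<in> gr 0" using zero by (intro subspace_diff subspace_gr)
      then show ?case by (simp add: Sx[OF zero] \<sigma>(1))
    next
      case (add x y)
      then show ?case by (simp add: lin_add[OF lin\<sigma>] lin_add[OF linS])
    qed
  qed
  then have "\<sigma> \<circ> (\<tau> (1/2) (-1) \<circ> \<sigma> \<circ> \<tau>' (1/2) (-1)) = \<tau> (i/2) i \<circ> \<sigma> \<circ> \<tau>' (i/2) i"
    unfolding conj[OF ab1] conj[OF ab2] .
  then show ?thesis using triad_from_conjugates[OF inv ii ii] by blast
qed

end

section \<open>Polynomial functions\<close>

lemma polynomial_fun_compose_linear:
  assumes "polynomial_fun s' p" and L: "Vector_Spaces.linear s s' L"
  shows "polynomial_fun s (\<lambda>x. p (L x))"
  using assms(1)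
proof induction
  case (const c) show ?case by (rule polynomial_fun.const)
next
  case (functional f)
  then have "Vector_Spaces.linear s (*) (f \<circ> L)" using L
    by (intro Vector_Spaces.linear_compose)
  then show ?case using polynomial_fun.functional[of s "f \<circ> L"] by (simp add: o_def)
next
  case (add p q) then show ?case by (intro polynomial_fun.add)
next
  case (mult p q) then show ?case by (intro polynomial_fun.mult)
qed

text \<open>The curve \<open>t \<mapsto> \<Sum>i. c\<^sub>i(t) a\<^sub>i\<close> has polynomial coordinates \<open>c\<^sub>i\<close>.\<close>

lemma polynomial_fun_on_curve:
  fixes s :: "'k::field \<Rightarrow> 'v::ab_group_add \<Rightarrow> 'v"
  assumes "polynomial_fun s p"
  shows "\<exists>r. \<forall>t. p (\<Sum>i\<in>I. s (poly (c i) t) (a i)) = poly r t"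
  using assms
proof induction
  case (const c)
  have "\<forall>t. c = poly [:c:] t" by simp
  then show ?case by blast
next
  case (functional f)
  then interpret f: Vector_Spaces.linear s "(*)" f .
  have "\<forall>t. f (\<Sum>i\<in>I. s (poly (c i) t) (a i)) = poly (\<Sum>i\<in>I. smult (f (a i)) (c i)) t"
    by (simp add: f.sum f.scale poly_sum mult.commute)
  then show ?case by blast
next
  case (add p q)
  let ?g = "\<lambda>t. \<Sum>i\<in>I. s (poly (c i) t) (a i)"
  obtain p' q' where "\<forall>t. p (?g t) = poly p' t" "\<forall>t. q (?g t) = poly q' t" using add.IH by blast
  then have "\<forall>t. p (?g t) + q (?g t) = poly (p' + q') t" by simp
  then show ?case by blast
next
  case (mult p q)
  let ?g = "\<lambda>t. \<Sum>i\<in>I. s (poly (c i) t) (a i)"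
  obtain p' q' where "\<forall>t. p (?g t) = poly p' t" "\<forall>t. q (?g t) = poly q' t" using mult.IH by blast
  then have "\<forall>t. p (?g t) * q (?g t) = poly (p' * q') t" by simp
  then show ?case by blast
qed

lemma topspace_zariski:
  fixes s :: "'k::field \<Rightarrow> 'v::ab_group_add \<Rightarrow> 'v"
  shows "topspace (zariski_topology s) = UNIV"
proof -
  have "{\<lambda>_. 1 :: 'k} \<subseteq> {p. polynomial_fun s p}" by (simp add: polynomial_fun.const)
  moreover have "(UNIV :: 'v set) = {x. \<exists>p\<in>{\<lambda>_. 1 :: 'k}. p x \<noteq> 0}" by simp
  ultimately have "openin (zariski_topology s) UNIV" unfolding openin_zariski_topology
    by (intro exI conjI)
  then show ?thesis using openin_subset by blast
qed

lemma closedin_zariski_zero_set: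
  assumes "P \<subseteq> {p. polynomial_fun s p}"
  shows "closedin (zariski_topology s) {x. \<forall>p\<in>P. p x = 0}"
proof -
  have "UNIV - {x. \<forall>p\<in>P. p x = 0} = {x. \<exists>p\<in>P. p x \<noteq> 0}" by blast
  then show ?thesis unfolding closedin_def topspace_zariski openin_zariski_topology using assms by auto
qed

lemma closedin_zariskiE:
  assumes "closedin (zariski_topology s) C"
  obtains P where "P \<subseteq> {p. polynomial_fun s p}" "C = {x. \<forall>p\<in>P. p x = 0}"
proof -
  have "openin (zariski_topology s) (UNIV - C)"
    using assms unfolding closedin_def topspace_zariski by (rule conjunct2)
  then obtain P where P: "P \<subseteq> {p. polynomial_fun s p}" "UNIV - C = {x. \<exists>p\<in>P. p x \<noteq> 0}"
    unfolding openin_zariski_topology by (elim exE conjE)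
  have "C = - (UNIV - C)" by blast
  also have "\<dots> = {x. \<forall>p\<in>P. p x = 0}" unfolding P(2) by blast
  finally show ?thesis by (rule that[OF P(1)])
qed

section \<open>Matrices\<close>

interpretation M: vector_space mscale by (rule vector_space_mscale)

lemma mscale_mult_left: "mscale c A ** B = mscale c (A ** B)"
  by (simp add: mscale_def matrix_matrix_mult_def vec_eq_iff sum_distrib_left mult_ac)
lemma mscale_mult_right: "A ** mscale c B = mscale c (A ** B)"
  by (simp add: mscale_def matrix_matrix_mult_def vec_eq_iff sum_distrib_left mult_ac)
lemma mat_add_rdistrib: "(A + B) ** C = A ** C + B ** (C :: 'k::field^'n^'n)"
  by (simp add: matrix_matrix_mult_def vec_eq_iff sum.distrib distrib_right)
lemma mat_neg_left: "(- A) ** B = - (A ** (B :: 'k::field^'n^'n))"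
  by (simp add: matrix_matrix_mult_def vec_eq_iff sum_negf)
lemma mat_neg_right: "A ** (- B) = - (A ** (B :: 'k::field^'n^'n))"
  by (simp add: matrix_matrix_mult_def vec_eq_iff sum_negf)
lemma mat_diff_left: "(A - B) ** C = A ** C - B ** (C :: 'k::field^'n^'n)"
  using mat_add_rdistrib[of A "- B" C] by (simp add: mat_neg_left)
lemma mat_diff_right: "C ** (A - B) = C ** A - C ** (B :: 'k::field^'n^'n)"
  using matrix_add_ldistrib[of C A "- B"] by (simp add: mat_neg_right)
lemma mat_sum_left: "(\<Sum>i\<in>I. A i) ** B = (\<Sum>i\<in>I. A i ** (B :: 'k::field^'n^'n))"
  by (induction I rule: infinite_finite_induct) (simp_all add: mat_add_rdistrib)
lemma mat_sum_right: "B ** (\<Sum>i\<in>I. A i) = (\<Sum>i\<in>I. B ** (A i :: 'k::field^'n^'n))"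
  by (induction I rule: infinite_finite_induct) (simp_all add: matrix_add_ldistrib)

lemma trace_mscale: "trace (mscale c A) = c * trace (A :: 'k::field^'n^'n)"
  by (simp add: trace_def mscale_def sum_distrib_left)

lemma linear_mscaleI:
  assumes "\<And>A B. f (A + B) = f A + f B" "\<And>c A. f (mscale c A) = mscale c (f A)"
  shows "Vector_Spaces.linear mscale mscale f"
  using assms by (simp add: Vector_Spaces.linear_iff M.vector_space_axioms)

lemma linear_mult_left: "Vector_Spaces.linear mscale mscale (\<lambda>X. A ** (X :: 'k::field^'n^'n))"
  by (rule linear_mscaleI) (simp_all add: matrix_add_ldistrib mscale_mult_right)
lemma linear_mult_right: "Vector_Spaces.linear mscale mscale (\<lambda>X. X ** (A :: 'k::field^'n^'n))"
  by (rule linear_mscaleI) (simp_all add: mat_add_rdistrib mscale_mult_left)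
lemma linear_mult_both: "Vector_Spaces.linear mscale mscale (\<lambda>X. A ** X ** (B :: 'k::field^'n^'n))"
  by (rule linear_mscaleI) (simp_all add: mat_add_rdistrib matrix_add_ldistrib mscale_mult_left mscale_mult_right)

lemma matrix_inv_props:
  assumes "invertible (A :: 'k::field^'n^'n)"
  shows "A ** matrix_inv A = mat 1" "matrix_inv A ** A = mat 1"
  using assms unfolding invertible_def matrix_inv_def by (metis (mono_tags, lifting) someI_ex)+

primrec mpow :: "'k::field^'n^'n \<Rightarrow> nat \<Rightarrow> 'k^'n^'n" where
  "mpow A 0 = mat 1"
| "mpow A (Suc i) = A ** mpow A i"

lemma mpow_Suc_right: "mpow A (Suc i) = mpow A i ** A"
proof (induction i)
  case (Suc i)
  have "mpow A (Suc (Suc i)) = A ** mpow A (Suc i)" by simp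
  also have "\<dots> = A ** (mpow A i ** A)" unfolding Suc ..
  also have "\<dots> = mpow A (Suc i) ** A" by (simp add: matrix_mul_assoc)
  finally show ?case .
qed simp

lemma mpow_neg_zero: "mpow A m = 0 \<Longrightarrow> mpow (- A) m = 0"
proof -
  have "mpow (- A) m = mpow A m \<or> mpow (- A) m = - mpow A m" for m
    by (induction m) (auto simp: mat_neg_left mat_neg_right)
  then show "mpow A m = 0 \<Longrightarrow> mpow (- A) m = 0" by (metis neg_equal_0_iff_equal)
qed

lemma geometric_sum_inverse:
  assumes "mpow A m = 0"
  shows "(mat 1 - A) ** (\<Sum>i<m. mpow A i) = mat 1"
proof -
  have "(mat 1 - A) ** (\<Sum>i<m. mpow A i) = mat 1 - mpow A m" for m
  proof (induction m)
    case (Suc m)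
    then show ?case by (simp add: matrix_add_ldistrib) (simp add: mat_diff_left)
  qed simp
  then show ?thesis using assms by simp
qed

lemma invertible_one_plus_nilpotent:
  assumes "mpow A m = 0"
  shows "invertible (mat 1 + A)" "matrix_inv (mat 1 + A) = (\<Sum>i<m. mpow (- A) i)"
proof -
  have 1: "(mat 1 + A) ** (\<Sum>i<m. mpow (- A) i) = mat 1"
    using geometric_sum_inverse[OF mpow_neg_zero[OF assms]] by simp
  then show i: "invertible (mat 1 + A)" using invertible_right_inverse by blast
  have "matrix_inv (mat 1 + A) = matrix_inv (mat 1 + A) ** ((mat 1 + A) ** (\<Sum>i<m. mpow (- A) i))" using 1 by simp
  also have "\<dots> = (\<Sum>i<m. mpow (- A) i)" unfolding matrix_mul_assoc matrix_inv_props(2)[OF i] by simp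
  finally show "matrix_inv (mat 1 + A) = (\<Sum>i<m. mpow (- A) i)" .
qed

interpretation cart: alg_closed_space "(*s) :: 'k::{alg_closed_field,field_char_0} \<Rightarrow> 'k^'n \<Rightarrow> 'k^'n" cart_basis
  by unfold_locales

lemma tr_cart:
  fixes A :: "'k::{alg_closed_field,field_char_0}^'n^'n"
  shows "cart.tr (\<lambda>v. A *v v) = trace A"
proof -
  have inj: "inj (\<lambda>i::'n. axis i (1::'k))" by (rule injI) (simp add: axis_eq_axis)
  have cb: "(cart_basis :: ('k^'n) set) = range (\<lambda>i. axis i 1)" unfolding cart_basis_def by auto
  have rep: "vec.representation cart_basis v (axis i 1) = v $ i" for v :: "'k^'n" and i
  proof -
    have "v = (\<Sum>b\<in>cart_basis. vec.representation cart_basis v b *s b)"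
      using vec.sum_representation_eq[OF vec.independent_Basis _ vec.finite_Basis subset_refl, of v] by simp
    then have "v $ i = (\<Sum>b\<in>cart_basis. vec.representation cart_basis v b *s b) $ i" by simp
    also have "\<dots> = (\<Sum>j\<in>UNIV. vec.representation cart_basis v (axis j 1) * (axis j 1 $ i))"
      unfolding cb by (simp add: sum.reindex[OF inj])
    also have "\<dots> = (\<Sum>j\<in>UNIV. if j = i then vec.representation cart_basis v (axis j 1) else 0)"
      by (intro sum.cong refl) (auto simp: axis_def)
    finally show ?thesis by simp
  qed
  have "cart.tr (\<lambda>v. A *v v) = (\<Sum>b\<in>cart_basis. vec.representation cart_basis (A *v b) b)"
    unfolding cart.tr_def ..
  also have "\<dots> = (\<Sum>i\<in>UNIV. (A *v axis i 1) $ i)"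
    unfolding cb sum.reindex[OF inj] o_def unfolding cb[symmetric] rep ..
  also have "\<dots> = trace A"
    unfolding trace_def by (simp add: matrix_vector_mult_def axis_def if_distrib cong: if_cong)
  finally show ?thesis .
qed

lemma mpow_mult_vec: "((\<lambda>v. A *v v) ^^ k) v = mpow A k *v v"
  by (induction k) (simp_all add: matrix_vector_mul_assoc)

lemma matrix_eq_0I:
  assumes "\<And>v. (A :: 'k::field^'n^'n) *v v = 0" shows "A = 0"
proof -
  have "\<forall>v. A *v v = 0 *v v" using assms by simp
  then show ?thesis by (subst matrix_eq)
qed

lemma nilpotent_matrix_if_traces_0:
  fixes A :: "'k::{alg_closed_field,field_char_0}^'n^'n"
  assumes "\<And>k. k > 0 \<Longrightarrow> trace (mpow A k) = 0"
  shows "\<exists>m. mpow A m = 0"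
proof -
  have L: "cart.lin (\<lambda>v. A *v v)"
    by (rule cart.linI) (simp_all add: matrix_vector_mult_def vec_eq_iff sum.distrib distrib_left sum_distrib_left mult_ac)
  have "cart.tr ((\<lambda>v. A *v v) ^^ k) = 0" if "k > 0" for k
  proof -
    have "(\<lambda>v. A *v v) ^^ k = (\<lambda>v. mpow A k *v v)" by (rule ext) (rule mpow_mult_vec)
    then show ?thesis using assms[OF that] by (simp only: tr_cart)
  qed
  then obtain m where "\<forall>v. ((\<lambda>v. A *v v) ^^ m) v = 0" using cart.nilpotent_if_tr_powers_0[OF L] by blast
  then have "mpow A m *v v = 0" for v unfolding mpow_mult_vec by blast
  then show ?thesis using matrix_eq_0I by blast
qed

lemma unipotent_matrix_if_mpow:
  assumes "mpow (A - mat 1) m = 0" shows "unipotent_matrix A"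
proof -
  have "(\<lambda>v. A *v v - v) = (\<lambda>v. (A - mat 1) *v v)" by (auto simp: matrix_vector_mult_diff_rdistrib)
  then show ?thesis unfolding unipotent_matrix_def nilpotent_map_def
    using mpow_mult_vec[where A = "A - mat 1" and k = m] assms by (intro exI[of _ m]) simp
qed

section \<open>Linear algebraic groups\<close>

lemma linear_algebraic_groupD:
  assumes "linear_algebraic_group G"
  shows "A \<in> G \<Longrightarrow> invertible A" "mat 1 \<in> G" "A \<in> G \<Longrightarrow> B \<in> G \<Longrightarrow> A ** B \<in> G" "A \<in> G \<Longrightarrow> matrix_inv A \<in> G"
  using assms closedin_subset unfolding linear_algebraic_group_def by fastforce+

lemma mem_linear_algebraic_groupI:
  assumes "linear_algebraic_group G" "invertible A"
    and "\<And>p. polynomial_fun mscale p \<Longrightarrow> (\<forall>B\<in>G. p B = 0) \<Longrightarrow> p A = 0"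
  shows "A \<in> G"
proof -
  obtain C where C: "closedin (zariski_topology mscale) C" "G = C \<inter> {A. invertible A}"
    using assms(1) unfolding linear_algebraic_group_def closedin_subtopology by blast
  obtain P where P: "P \<subseteq> {p. polynomial_fun mscale p}" "C = {x. \<forall>p\<in>P. p x = 0}"
    using closedin_zariskiE[OF C(1)] by blast
  have "p A = 0" if "p \<in> P" for p using assms(3)[of p] P C(2) that by blast
  then show ?thesis using C(2) P(2) assms(2) by blast
qed

lemma lie_algebra_ofD:
  assumes "X \<in> lie_algebra_of G" "polynomial_fun mscale p" "\<And>A. A \<in> G \<Longrightarrow> p A = 0"
  shows "\<exists>q. (\<forall>t. p (mat 1 + mscale t X) = poly q t) \<and> poly (pderiv q) 0 = 0"
  using assms unfolding lie_algebra_of_def by simp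

lemma lie_algebra_of_conj:
  assumes G: "linear_algebraic_group G" and A: "A \<in> G" and X: "X \<in> lie_algebra_of G"
  shows "A ** X ** matrix_inv A \<in> lie_algebra_of G"
  unfolding lie_algebra_of_def
proof (intro CollectI allI impI)
  fix p assume p: "polynomial_fun mscale p \<and> (\<forall>A\<in>G. p A = 0)"
  let ?p = "\<lambda>B. p (A ** B ** matrix_inv A)"
  have "polynomial_fun mscale ?p"
    using polynomial_fun_compose_linear[OF _ linear_mult_both] p by blast
  moreover have "\<forall>B\<in>G. ?p B = 0"
  proof
    fix B assume "B \<in> G"
    then have "A ** B ** matrix_inv A \<in> G"
      by (rule linear_algebraic_groupD(3)[OF G linear_algebraic_groupD(3)[OF G A] linear_algebraic_groupD(4)[OF G A]])
    then show "?p B = 0" using p by blast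
  qed
  ultimately have "\<exists>q. (\<forall>t. ?p (mat 1 + mscale t X) = poly q t) \<and> poly (pderiv q) 0 = 0"
    by (intro lie_algebra_ofD[OF X]) auto
  then obtain q where q: "\<And>t. ?p (mat 1 + mscale t X) = poly q t" "poly (pderiv q) 0 = 0" by blast
  have "A ** (mat 1 + mscale t X) ** matrix_inv A = mat 1 + mscale t (A ** X ** matrix_inv A)" for t
    using matrix_inv_props(1)[OF linear_algebraic_groupD(1)[OF G A]]
    by (simp add: matrix_add_ldistrib mat_add_rdistrib mscale_mult_left mscale_mult_right)
  then show "\<exists>q. (\<forall>t. p (mat 1 + mscale t (A ** X ** matrix_inv A)) = poly q t) \<and> poly (pderiv q) 0 = 0"
    using q by metis
qed

text \<open>The exponential \<open>exp (t X)\<close> of a matrix with \<open>X\<^sup>m = 0\<close>.\<close>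

definition mexp_poly :: "'k::field_char_0^'n^'n \<Rightarrow> nat \<Rightarrow> 'k \<Rightarrow> 'k^'n^'n" where
  "mexp_poly X m t = (\<Sum>i<m. mscale (t ^ i / fact i) (mpow X i))"

text \<open>The function \<open>p'\<close> is the derivative of \<open>p\<close> along the left-invariant vector field of \<open>X\<close>: both in
  the infinitesimal form that occurs in the definition of the Lie algebra and along \<open>exp (t X)\<close>.\<close>

definition is_derivative ::
    "'k::field_char_0^'n^'n \<Rightarrow> nat \<Rightarrow> ('k^'n^'n \<Rightarrow> 'k) \<Rightarrow> ('k^'n^'n \<Rightarrow> 'k) \<Rightarrow> bool" where
  "is_derivative X m p p' \<longleftrightarrow>
     (\<forall>A. \<exists>q. (\<forall>t. p (A + mscale t (A ** X)) = poly q t) \<and> poly (pderiv q) 0 = p' A) \<and>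
     (\<exists>r. (\<forall>t. p (mexp_poly X m t) = poly r t) \<and> (\<forall>t. p' (mexp_poly X m t) = poly (pderiv r) t))"

lemma is_derivative_add:
  assumes "is_derivative X m p1 d1" "is_derivative X m p2 d2"
  shows "is_derivative X m (\<lambda>A. p1 A + p2 A) (\<lambda>A. d1 A + d2 A)"
  unfolding is_derivative_def
proof (intro conjI allI)
  fix A
  obtain q1 q2 where "\<And>t. p1 (A + mscale t (A ** X)) = poly q1 t" "poly (pderiv q1) 0 = d1 A"
    "\<And>t. p2 (A + mscale t (A ** X)) = poly q2 t" "poly (pderiv q2) 0 = d2 A"
    using assms unfolding is_derivative_def by blast
  then show "\<exists>q. (\<forall>t. p1 (A + mscale t (A ** X)) + p2 (A + mscale t (A ** X)) = poly q t) \<and>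
      poly (pderiv q) 0 = d1 A + d2 A"
    by (intro exI[of _ "q1 + q2"]) (simp add: pderiv_add)
next
  obtain r1 r2 where "\<And>t. p1 (mexp_poly X m t) = poly r1 t" "\<And>t. d1 (mexp_poly X m t) = poly (pderiv r1) t"
    "\<And>t. p2 (mexp_poly X m t) = poly r2 t" "\<And>t. d2 (mexp_poly X m t) = poly (pderiv r2) t"
    using assms unfolding is_derivative_def by blast
  then show "\<exists>r. (\<forall>t. p1 (mexp_poly X m t) + p2 (mexp_poly X m t) = poly r t) \<and>
       (\<forall>t. d1 (mexp_poly X m t) + d2 (mexp_poly X m t) = poly (pderiv r) t)"
    by (intro exI[of _ "r1 + r2"]) (simp add: pderiv_add)
qed

lemma is_derivative_mult:
  assumes "is_derivative X m p1 d1" "is_derivative X m p2 d2"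
  shows "is_derivative X m (\<lambda>A. p1 A * p2 A) (\<lambda>A. p1 A * d2 A + p2 A * d1 A)"
  unfolding is_derivative_def
proof (intro conjI allI)
  fix A
  obtain q1 q2 where q: "\<And>t. p1 (A + mscale t (A ** X)) = poly q1 t" "poly (pderiv q1) 0 = d1 A"
    "\<And>t. p2 (A + mscale t (A ** X)) = poly q2 t" "poly (pderiv q2) 0 = d2 A"
    using assms unfolding is_derivative_def by blast
  have "p1 A = poly q1 0" "p2 A = poly q2 0" using q(1)[of 0] q(3)[of 0] by simp_all
  then show "\<exists>q. (\<forall>t. p1 (A + mscale t (A ** X)) * p2 (A + mscale t (A ** X)) = poly q t) \<and>
      poly (pderiv q) 0 = p1 A * d2 A + p2 A * d1 A"
    using q by (intro exI[of _ "q1 * q2"]) (simp add: pderiv_mult)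
next
  obtain r1 r2 where "\<And>t. p1 (mexp_poly X m t) = poly r1 t" "\<And>t. d1 (mexp_poly X m t) = poly (pderiv r1) t"
    "\<And>t. p2 (mexp_poly X m t) = poly r2 t" "\<And>t. d2 (mexp_poly X m t) = poly (pderiv r2) t"
    using assms unfolding is_derivative_def by blast
  then show "\<exists>r. (\<forall>t. p1 (mexp_poly X m t) * p2 (mexp_poly X m t) = poly r t) \<and>
       (\<forall>t. p1 (mexp_poly X m t) * d2 (mexp_poly X m t) + p2 (mexp_poly X m t) * d1 (mexp_poly X m t)
          = poly (pderiv r) t)"
    by (intro exI[of _ "r1 * r2"]) (simp add: pderiv_mult)
qed

lemma invariant_derivative:
  fixes X :: "'k::{field_char_0}^'n^'n"
  assumes "polynomial_fun mscale p" and X: "mpow X m = 0"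
  shows "\<exists>p'. polynomial_fun mscale p' \<and> is_derivative X m p p'"
  using assms(1)
proof induction
  case (const c)
  show ?case unfolding is_derivative_def
    by (rule exI[of _ "\<lambda>_. 0"], intro conjI allI exI[of _ "[:c:]"] polynomial_fun.const) (auto simp: pderiv_pCons)
next
  case (functional f)
  then interpret f: Vector_Spaces.linear mscale "(*)" f .
  have 1: "polynomial_fun mscale (\<lambda>A. f (A ** X))"
    by (rule polynomial_fun_compose_linear[OF polynomial_fun.functional[OF functional] linear_mult_right])
  have 2: "\<exists>q. (\<forall>t. f (A + mscale t (A ** X)) = poly q t) \<and> poly (pderiv q) 0 = f (A ** X)" for A
    by (rule exI[of _ "[:f A, f (A ** X):]"]) (simp add: f.add f.scale pderiv_pCons)
  let ?r = "\<Sum>i<m. monom (f (mpow X i) / fact i) i"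
  have r: "f (mexp_poly X m t) = poly ?r t" for t
    unfolding mexp_poly_def by (simp add: f.sum f.scale poly_sum poly_monom mult_ac)
  have r': "f (mexp_poly X m t ** X) = poly (pderiv ?r) t" for t
  proof (cases m)
    case 0
    then show ?thesis by (simp add: mexp_poly_def f.zero)
  next
    case (Suc n)
    have pd: "pderiv ?r = (\<Sum>i<m. monom (of_nat i * (f (mpow X i) / fact i)) (i - 1))"
      by (simp add: higher_pderiv_sum[of 1, simplified] pderiv_monom)
    have "f (mexp_poly X m t ** X) = (\<Sum>i<m. t ^ i / fact i * f (mpow X (Suc i)))"
      unfolding mexp_poly_def mpow_Suc_right
      by (simp add: mat_sum_left mscale_mult_left f.sum f.scale)
    also have "\<dots> = (\<Sum>i<n. t ^ i / fact i * f (mpow X (Suc i)))"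
      using X unfolding Suc by (simp add: f.zero del: mpow.simps)
    also have "\<dots> = (\<Sum>i<n. of_nat (Suc i) * (f (mpow X (Suc i)) / fact (Suc i)) * t ^ i)"
    proof (intro sum.cong refl)
      fix i
      have "(of_nat (Suc i) :: 'k) \<noteq> 0" using of_nat_neq_0 by blast
      then show "t ^ i / fact i * f (mpow X (Suc i)) = of_nat (Suc i) * (f (mpow X (Suc i)) / fact (Suc i)) * t ^ i"
        unfolding fact_Suc by (simp add: field_simps del: mpow.simps of_nat_Suc)
    qed
    also have "\<dots> = poly (pderiv ?r) t"
      unfolding pd unfolding Suc by (simp add: poly_sum poly_monom sum.lessThan_Suc_shift del: mpow.simps fact_Suc of_nat_Suc sum.lessThan_Suc)
    finally show ?thesis .
  qed
  show ?case unfolding is_derivative_def using 1 2 r r' by blast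
next
  case (add p1 p2)
  then show ?case by (blast intro: is_derivative_add polynomial_fun.add)
next
  case (mult p1 p2)
  then obtain d1 d2 where d: "polynomial_fun mscale d1" "is_derivative X m p1 d1"
    "polynomial_fun mscale d2" "is_derivative X m p2 d2" by blast
  have "polynomial_fun mscale (\<lambda>A. p1 A * d2 A + p2 A * d1 A)"
    by (intro polynomial_fun.add polynomial_fun.mult mult.hyps d)
  then show ?case using is_derivative_mult[OF d(2,4)] by blast
qed

lemma poly_eqI_pointwise: "(\<And>t. poly p t = poly q t) \<Longrightarrow> p = (q :: 'k::field_char_0 poly)"
  using poly_eq_poly_eq_iff[of p q] by (simp add: fun_eq_iff)

text \<open>The left-invariant derivative along \<open>X\<close> preserves the ideal of functions that vanish on \<open>G\<close>, by
  translation to the identity. Hence all derivatives of \<open>p (exp (t X))\<close> at \<open>t = 0\<close> vanish, and in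
  characteristic \<open>0\<close> this polynomial in \<open>t\<close> is zero.\<close>

lemma exp_in_group:
  fixes X :: "'k::{field_char_0}^'n^'n"
  assumes G: "linear_algebraic_group G" and X: "X \<in> lie_algebra_of G" "mpow X m = 0" and m: "m > 0"
    and p: "polynomial_fun mscale p" "\<And>B. B \<in> G \<Longrightarrow> p B = 0"
  shows "p (mexp_poly X m t) = 0"
proof -
  define I where "I = {p. polynomial_fun mscale p \<and> (\<forall>B\<in>G. p B = 0)}"
  define R where "R = {r. \<exists>p\<in>I. \<forall>t. p (mexp_poly X m t) = poly r t}"
  have e0: "mexp_poly X m 0 = mat 1"
  proof -
    obtain n where "m = Suc n" using m gr0_implies_Suc by blast
    then show ?thesis unfolding mexp_poly_def by (simp add: sum.lessThan_Suc_shift del: sum.lessThan_Suc)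
  qed
  have R_deriv: "pderiv r \<in> R" if rR: "r \<in> R" for r
  proof -
    obtain p where p: "p \<in> I" "\<And>t. p (mexp_poly X m t) = poly r t" using rR unfolding R_def by blast
    obtain p' where p': "polynomial_fun mscale p'"
      "\<And>A. \<exists>q. (\<forall>t. p (A + mscale t (A ** X)) = poly q t) \<and> poly (pderiv q) 0 = p' A"
      "\<exists>r. (\<forall>t. p (mexp_poly X m t) = poly r t) \<and> (\<forall>t. p' (mexp_poly X m t) = poly (pderiv r) t)"
      using invariant_derivative[OF _ X(2), of p] p(1) unfolding I_def is_derivative_def by blast
    obtain r' where r': "\<And>t. p (mexp_poly X m t) = poly r' t" "\<And>t. p' (mexp_poly X m t) = poly (pderiv r') t" using p'(3) by blast
    have "r' = r" by (rule poly_eqI_pointwise) (metis p(2) r'(1))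
    have "p' A = 0" if A: "A \<in> G" for A
    proof -
      obtain q where q: "\<And>t. p (A + mscale t (A ** X)) = poly q t" "poly (pderiv q) 0 = p' A" using p'(2) by blast
      have "polynomial_fun mscale (\<lambda>B. p (A ** B))"
        using polynomial_fun_compose_linear[OF _ linear_mult_left] p(1) unfolding I_def by blast
      moreover have "\<forall>B\<in>G. p (A ** B) = 0"
        using p(1) linear_algebraic_groupD(3)[OF G A] unfolding I_def by simp
      ultimately have "\<exists>q. (\<forall>t. p (A ** (mat 1 + mscale t X)) = poly q t) \<and> poly (pderiv q) 0 = 0"
        by (intro lie_algebra_ofD[OF X(1)]) auto
      then obtain q' where q': "\<And>t. p (A ** (mat 1 + mscale t X)) = poly q' t" "poly (pderiv q') 0 = 0" by blast
      have "A ** (mat 1 + mscale t X) = A + mscale t (A ** X)" for t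
        by (simp add: matrix_add_ldistrib mscale_mult_right)
      then have "q = q'" using q(1) q'(1) by (intro poly_eqI_pointwise) metis
      then show ?thesis using q(2) q'(2) by simp
    qed
    then have "p' \<in> I" using p'(1) unfolding I_def by blast
    then show ?thesis unfolding R_def using r'(2) \<open>r' = r\<close> by blast
  qed
  have c0: "coeff r 0 = 0" if rR: "r \<in> R" for r
  proof -
    obtain p where p: "p \<in> I" "\<And>t. p (mexp_poly X m t) = poly r t" using rR unfolding R_def by blast
    have "poly r 0 = p (mat 1)" using p(2)[of 0] e0 by simp
    also have "\<dots> = 0" using p(1) linear_algebraic_groupD(2)[OF G] unfolding I_def by blast
    finally show ?thesis by (simp add: poly_0_coeff_0)
  qed
  have "coeff r k = 0" if "r \<in> R" for r k
    using that
  proof (induction k arbitrary: r)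
    case 0 then show ?case by (rule c0)
  next
    case (Suc k)
    have "coeff (pderiv r) k = 0" by (rule Suc.IH[OF R_deriv[OF Suc.prems]])
    then have "of_nat (Suc k) * coeff r (Suc k) = 0" by (simp only: coeff_pderiv)
    then show ?case using of_nat_neq_0[of k, where 'a='k] by (simp only: mult_eq_0_iff) simp
  qed
  then have R0: "r = 0" if "r \<in> R" for r using that by (simp add: poly_eq_iff)
  have pI: "p \<in> I" using p unfolding I_def by blast
  have "mexp_poly X m t = (\<Sum>i<m. mscale (poly (monom (1 / fact i) i) t) (mpow X i))" for t
    by (simp add: mexp_poly_def poly_monom)
  then obtain r where r: "\<forall>t. p (mexp_poly X m t) = poly r t"
    using polynomial_fun_on_curve[OF p(1), where I = "{..<m}" and c = "\<lambda>i. monom (1 / fact i) i" and a = "mpow X"] by auto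
  then have "r \<in> R" using pI unfolding R_def by blast
  then have "r = 0" by (rule R0)
  then show ?thesis using r by simp
qed


section \<open>A nilpotent ideal from the trace form\<close>

inductive_set generated_algebra :: "('k::field^'n^'n) set \<Rightarrow> ('k^'n^'n) set" for L where
  one: "mat 1 \<in> generated_algebra L"
| gen: "X \<in> L \<Longrightarrow> X \<in> generated_algebra L"
| add: "A \<in> generated_algebra L \<Longrightarrow> B \<in> generated_algebra L \<Longrightarrow> A + B \<in> generated_algebra L"
| mult: "A \<in> generated_algebra L \<Longrightarrow> B \<in> generated_algebra L \<Longrightarrow> A ** B \<in> generated_algebra L"
| scale: "A \<in> generated_algebra L \<Longrightarrow> mscale c A \<in> generated_algebra L"

definition trace_radical :: "('k::field^'n^'n) set \<Rightarrow> ('k^'n^'n) set" where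
  "trace_radical L = {A \<in> generated_algebra L. \<forall>B\<in>generated_algebra L. trace (A ** B) = 0}"

lemma trace_radicalD:
  "A \<in> trace_radical L \<Longrightarrow> A \<in> generated_algebra L"
  "A \<in> trace_radical L \<Longrightarrow> B \<in> generated_algebra L \<Longrightarrow> trace (A ** B) = 0"
  unfolding trace_radical_def by auto

lemma trace_radical_zero: "0 \<in> trace_radical L"
proof -
  have "mscale 0 (mat 1) \<in> generated_algebra L" by (intro generated_algebra.intros)
  moreover have "mscale 0 (mat 1 :: 'a^'n^'n) = 0" by (rule M.scale_zero_left)
  ultimately show ?thesis unfolding trace_radical_def by (simp add: trace_def)
qed

lemma trace_radical_add: "A \<in> trace_radical L \<Longrightarrow> B \<in> trace_radical L \<Longrightarrow> A + B \<in> trace_radical L"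
  unfolding trace_radical_def by (auto simp: mat_add_rdistrib trace_add intro: generated_algebra.add)

lemma trace_radical_scale: "A \<in> trace_radical L \<Longrightarrow> mscale c A \<in> trace_radical L"
  unfolding trace_radical_def by (auto simp: mscale_mult_left trace_mscale intro: generated_algebra.scale)

lemma trace_radical_mult_right: "A \<in> trace_radical L \<Longrightarrow> B \<in> generated_algebra L \<Longrightarrow> A ** B \<in> trace_radical L"
  unfolding trace_radical_def by (auto simp: matrix_mul_assoc[symmetric] intro: generated_algebra.mult)

lemma subspace_trace_radical: "M.subspace (trace_radical L)"
  by (rule M.subspaceI) (auto intro: trace_radical_zero trace_radical_add trace_radical_scale)

lemma generated_algebra_mpow: "A \<in> generated_algebra L \<Longrightarrow> mpow A i \<in> generated_algebra L"
  by (induction i) (auto intro: generated_algebra.intros)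

text \<open>The powers of an element of the radical are again products with elements of the algebra.\<close>

lemma trace_radical_nilpotent:
  fixes A :: "'k::{alg_closed_field,field_char_0}^'n^'n"
  assumes "A \<in> trace_radical L" shows "\<exists>m. mpow A m = 0"
proof (rule nilpotent_matrix_if_traces_0)
  fix k :: nat assume "k > 0"
  then obtain j where "k = Suc j" using gr0_implies_Suc by blast
  then show "trace (mpow A k) = 0"
    using trace_radicalD(2)[OF assms generated_algebra_mpow[OF trace_radicalD(1)[OF assms]]] by simp
qed

lemma trace_conj:
  assumes "invertible (A :: 'k::field^'n^'n)" shows "trace (A ** X ** matrix_inv A) = trace X"
  using trace_mul_sym[of "A ** X" "matrix_inv A"] matrix_inv_props[OF assms] by (simp add: matrix_mul_assoc)

lemma conj_mult:
  assumes "invertible (A :: 'k::field^'n^'n)"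
  shows "A ** (X ** Y) ** matrix_inv A = (A ** X ** matrix_inv A) ** (A ** Y ** matrix_inv A)"
proof -
  have "(A ** X ** matrix_inv A) ** (A ** Y ** matrix_inv A) = A ** X ** (matrix_inv A ** A) ** Y ** matrix_inv A"
    by (simp only: matrix_mul_assoc)
  then show ?thesis by (simp add: matrix_inv_props[OF assms] matrix_mul_assoc)
qed

lemma generated_algebra_conj:
  assumes A: "invertible A" and L: "\<And>X. X \<in> L \<Longrightarrow> A ** X ** matrix_inv A \<in> L"
    and B: "B \<in> generated_algebra L"
  shows "A ** B ** matrix_inv A \<in> generated_algebra L"
  using B
proof induction
  case one then show ?case using matrix_inv_props[OF A] by (simp add: generated_algebra.one)
next
  case (gen X) then show ?case by (intro generated_algebra.gen L)
next
  case (add X Y) then show ?case by (simp add: matrix_add_ldistrib mat_add_rdistrib generated_algebra.add)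
next
  case (mult X Y) show ?case unfolding conj_mult[OF A] by (rule generated_algebra.mult[OF mult.IH])
next
  case (scale X c) then show ?case by (simp add: mscale_mult_left mscale_mult_right generated_algebra.scale)
qed

lemma conj_conj_inv:
  assumes "invertible (A :: 'k::field^'n^'n)"
  shows "A ** (matrix_inv A ** X ** A) ** matrix_inv A = X"
proof -
  have "A ** (matrix_inv A ** X ** A) ** matrix_inv A = (A ** matrix_inv A) ** X ** (A ** matrix_inv A)"
    by (simp only: matrix_mul_assoc)
  then show ?thesis by (simp add: matrix_inv_props[OF assms])
qed

lemma matrix_inv_matrix_inv:
  assumes "invertible (A :: 'k::field^'n^'n)"
  shows "invertible (matrix_inv A)" "matrix_inv (matrix_inv A) = A"
proof -
  show i: "invertible (matrix_inv A)" using matrix_inv_props[OF assms] unfolding invertible_def by blast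
  have "matrix_inv (matrix_inv A) = (A ** matrix_inv A) ** matrix_inv (matrix_inv A)"
    by (simp add: matrix_inv_props[OF assms])
  also have "\<dots> = A" by (simp add: matrix_mul_assoc[symmetric] matrix_inv_props[OF i])
  finally show "matrix_inv (matrix_inv A) = A" .
qed

lemma trace_radical_conj:
  assumes A: "invertible A" and L: "\<And>X. X \<in> L \<Longrightarrow> A ** X ** matrix_inv A \<in> L"
    "\<And>X. X \<in> L \<Longrightarrow> matrix_inv A ** X ** A \<in> L"
    and B: "B \<in> trace_radical L"
  shows "A ** B ** matrix_inv A \<in> trace_radical L"
proof -
  have "trace (A ** B ** matrix_inv A ** C) = 0" if C: "C \<in> generated_algebra L" for C
  proof -
    have C': "matrix_inv A ** C ** A \<in> generated_algebra L"
      using generated_algebra_conj[OF matrix_inv_matrix_inv(1)[OF A] _ C] L(2)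
      unfolding matrix_inv_matrix_inv(2)[OF A] by blast
    have "A ** B ** matrix_inv A ** C = A ** (B ** (matrix_inv A ** C ** A)) ** matrix_inv A"
      using conj_mult[OF A, of B "matrix_inv A ** C ** A"] unfolding conj_conj_inv[OF A] by simp
    then show ?thesis using trace_conj[OF A] trace_radicalD(2)[OF B C'] by simp
  qed
  then show ?thesis unfolding trace_radical_def
    using generated_algebra_conj[OF A L(1) trace_radicalD(1)[OF B]] by simp
qed

section \<open>One-parameter groups\<close>

text \<open>The power \<open>(1 + A)\<^sup>t\<close> for a scalar \<open>t\<close> and a matrix with \<open>A\<^sup>m = 0\<close>.\<close>

definition binomial_curve :: "'k::field_char_0^'n^'n \<Rightarrow> nat \<Rightarrow> 'k \<Rightarrow> 'k^'n^'n" where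
  "binomial_curve A m t = (\<Sum>i<m. mscale (t gchoose i) (mpow A i))"

lemma binomial_curve_0: "m > 0 \<Longrightarrow> binomial_curve A m 0 = mat 1"
proof -
  assume "m > 0"
  then obtain n where "m = Suc n" using gr0_implies_Suc by blast
  then show ?thesis unfolding binomial_curve_def
    by (simp add: sum.lessThan_Suc_shift gbinomial_0 del: sum.lessThan_Suc)
qed

lemma binomial_curve_Suc:
  assumes "mpow A m = 0" "m > 0"
  shows "binomial_curve A m (t + 1) = binomial_curve A m t ** (mat 1 + A)"
proof -
  obtain n where n: "m = Suc n" using \<open>m > 0\<close> gr0_implies_Suc by blast
  have "binomial_curve A m t ** A = (\<Sum>i<m. mscale (t gchoose i) (mpow A (Suc i)))"
    unfolding binomial_curve_def mpow_Suc_right by (simp add: mat_sum_left mscale_mult_left)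
  also have "\<dots> = (\<Sum>i<n. mscale (t gchoose i) (mpow A (Suc i)))"
    using assms(1) unfolding n by (simp del: mpow.simps)
  finally have 1: "binomial_curve A m t ** A = (\<Sum>i<n. mscale (t gchoose i) (mpow A (Suc i)))" .
  have sh: "binomial_curve A m u = mat 1 + (\<Sum>i<n. mscale (u gchoose Suc i) (mpow A (Suc i)))" for u
    unfolding binomial_curve_def n by (simp add: sum.lessThan_Suc_shift del: sum.lessThan_Suc mpow.simps) simp
  have "binomial_curve A m (t + 1) = mat 1 + ((\<Sum>i<n. mscale (t gchoose i) (mpow A (Suc i))) + (\<Sum>i<n. mscale (t gchoose Suc i) (mpow A (Suc i))))"
    unfolding sh gbinomial_Suc_Suc by (simp add: M.scale_left_distrib sum.distrib del: mpow.simps)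
  also have "\<dots> = binomial_curve A m t + binomial_curve A m t ** A" unfolding 1 unfolding sh by (simp add: algebra_simps del: mpow.simps)
  finally show ?thesis by (simp add: matrix_add_ldistrib)
qed

lemma gbinomial_poly: "\<exists>q. \<forall>t. (t::'k::field_char_0) gchoose i = poly q t"
proof -
  have "t gchoose i = poly (smult (1 / fact i) (\<Prod>j=0..<i. [:- of_nat j, 1:])) t" for t :: 'k
    by (simp add: gbinomial_prod_rev poly_prod algebra_simps)
  then show ?thesis by blast
qed

lemma polynomial_fun_on_binomial_curve:
  assumes "polynomial_fun mscale p"
  shows "\<exists>r. \<forall>t. p (binomial_curve A m t) = poly r t"
proof -
  obtain c where c: "\<And>i t. (t::'a) gchoose i = poly (c i) t" using gbinomial_poly by metis
  show ?thesis unfolding binomial_curve_def c by (rule polynomial_fun_on_curve[OF assms])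
qed

lemma poly_0_if_nat_zeros:
  assumes "\<And>n. poly p (of_nat n :: 'k::field_char_0) = 0" shows "p = 0"
proof (rule ccontr)
  assume "p \<noteq> 0"
  then have "finite {x. poly p x = 0}" by (rule poly_roots_finite)
  moreover have "range (of_nat :: nat \<Rightarrow> 'k) \<subseteq> {x. poly p x = 0}" using assms by auto
  ultimately have "finite (range (of_nat :: nat \<Rightarrow> 'k))" using finite_subset by blast
  then have "finite (UNIV :: nat set)" by (rule finite_imageD[OF _ inj_of_nat])
  then show False by simp
qed

section \<open>The unipotent radical\<close>

text \<open>The set \<open>U\<close> of all \<open>A \<in> H\<close> for which \<open>A - 1\<close> lies in the trace radical \<open>R\<close> is a closed subgroup, normal
  because conjugation by \<open>H\<close> preserves the Lie algebra and hence \<open>R\<close>, and unipotent because \<open>R\<close> consists of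
  nilpotent matrices. It is connected: the curve \<open>t \<mapsto> A\<^sup>t\<close> joins \<open>1\<close> to \<open>A\<close>, and it stays in \<open>U\<close> since it
  does so for all natural numbers \<open>t\<close>, which are Zariski dense in the line. So \<open>U\<close> is trivial. But \<open>U\<close>
  contains \<open>exp X\<close> for \<open>X\<close> in the Lie algebra and in \<open>R\<close>.\<close>

lemma reductive_trace_radical:
  fixes H :: "('k::{alg_closed_field,field_char_0}^'n^'n) set"
  assumes red: "reductive_group H"
    and X: "X \<in> lie_algebra_of H" "X \<in> trace_radical (lie_algebra_of H)"
  shows "X = 0"
proof -
  define R where "R = trace_radical (lie_algebra_of H)"
  have H: "linear_algebraic_group H" using red unfolding reductive_group_def by blast
  note HD = linear_algebraic_groupD[OF H]
  define U where "U = {A \<in> H. A - mat 1 \<in> R}"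
  have sR: "M.subspace R" unfolding R_def by (rule subspace_trace_radical)
  have nilR: "\<exists>m. mpow A m = 0" if "A \<in> R" for A using that unfolding R_def by (rule trace_radical_nilpotent)
  have Rmul: "A \<in> R \<Longrightarrow> B \<in> R \<Longrightarrow> A ** B \<in> R" for A B
    unfolding R_def by (rule trace_radical_mult_right[OF _ trace_radicalD(1)])
  have Rpow: "mpow A (Suc i) \<in> R" if "A \<in> R" for A i
    using that Rmul by (induction i) simp_all
  have Rsum: "(\<Sum>i<m. mscale (c i) (mpow A i)) - mat 1 \<in> R" if A: "A \<in> R" and m: "m > 0" and c: "c 0 = 1" for A m c
  proof -
    obtain n where n: "m = Suc n" using m gr0_implies_Suc by blast
    have "(\<Sum>i<m. mscale (c i) (mpow A i)) - mat 1 = (\<Sum>i<n. mscale (c (Suc i)) (mpow A (Suc i)))"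
      unfolding n by (simp add: sum.lessThan_Suc_shift c del: sum.lessThan_Suc mpow.simps(2))
    also have "\<dots> \<in> R" by (intro M.subspace_sum[OF sR] M.subspace_scale[OF sR] Rpow[OF A])
    finally show ?thesis .
  qed
  have inH: "A \<in> H" if A: "A - mat 1 \<in> R" and p: "\<And>p. polynomial_fun mscale p \<Longrightarrow> (\<forall>B\<in>H. p B = 0) \<Longrightarrow> p A = 0" for A
  proof (rule mem_linear_algebraic_groupI[OF H _ p])
    obtain m where "mpow (A - mat 1) m = 0" using nilR[OF A] by blast
    then have "invertible (mat 1 + (A - mat 1))" by (rule invertible_one_plus_nilpotent)
    then show "invertible A" by simp
  qed
  have one: "mat 1 \<in> U" unfolding U_def using HD(2) M.subspace_0[OF sR] by simp
  have mul: "A ** B \<in> U" if "A \<in> U" "B \<in> U" for A B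
  proof -
    have "A ** B - mat 1 = (A - mat 1) ** (B - mat 1) + (A - mat 1) + (B - mat 1)"
      by (simp add: mat_diff_left mat_diff_right)
    also have "\<dots> \<in> R" using that unfolding U_def by (intro M.subspace_add[OF sR] Rmul) auto
    finally show ?thesis using that HD(3) unfolding U_def by blast
  qed
  have inv: "matrix_inv A \<in> U" if A: "A \<in> U" for A
  proof -
    have AR: "A - mat 1 \<in> R" and AH: "A \<in> H" using A unfolding U_def by auto
    obtain m where m: "mpow (A - mat 1) m = 0" using nilR[OF AR] by blast
    have m': "mpow (A - mat 1) (Suc m) = 0" using m by simp
    have "matrix_inv A = (\<Sum>i<Suc m. mpow (- (A - mat 1)) i)"
      using invertible_one_plus_nilpotent(2)[OF m'] by (simp only: add_diff_cancel_left' diff_add_cancel add.commute[of "mat 1"])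
    then have "matrix_inv A - mat 1 = (\<Sum>i<Suc m. mscale 1 (mpow (- (A - mat 1)) i)) - mat 1"
      by (simp only: M.scale_one)
    also have "\<dots> \<in> R" by (rule Rsum[OF M.subspace_neg[OF sR AR]]) simp_all
    finally show ?thesis unfolding U_def using HD(4)[OF AH] by blast
  qed
  have closed: "closedin (subtopology (zariski_topology mscale) {A. invertible A}) U"
  proof -
    define P where "P = {p. polynomial_fun mscale p \<and> (\<forall>B\<in>H. p B = 0)}
       \<union> {\<lambda>A. f A + (- f (mat 1)) | f. Vector_Spaces.linear mscale (*) f \<and> (\<forall>B\<in>R. f B = (0::'k))}"
    have P: "P \<subseteq> {p. polynomial_fun mscale p}"
    proof
      fix p assume "p \<in> P"
      then consider "polynomial_fun mscale p"
        | f where "Vector_Spaces.linear mscale (*) f" "p = (\<lambda>A. f A + (- f (mat 1)))"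
        unfolding P_def by blast
      then show "p \<in> {p. polynomial_fun mscale p}"
      proof cases
        case 2
        show ?thesis unfolding 2(2) mem_Collect_eq
          by (rule polynomial_fun.add[OF polynomial_fun.functional[OF 2(1)] polynomial_fun.const])
      qed blast
    qed
    have "U = {A. \<forall>p\<in>P. p A = 0} \<inter> {A. invertible A}"
    proof (intro equalityI subsetI)
      fix A assume A: "A \<in> U"
      then have AH: "A \<in> H" and AR: "A - mat 1 \<in> R" unfolding U_def by auto
      have "f A + (- f (mat 1)) = 0" if f: "Vector_Spaces.linear mscale (*) f" "\<forall>B\<in>R. f B = (0::'k)" for f
      proof -
        interpret f: Vector_Spaces.linear mscale "(*)" f by fact
        show ?thesis using f(2) AR f.diff[of A "mat 1"] by simp
      qed
      then show "A \<in> {A. \<forall>p\<in>P. p A = 0} \<inter> {A. invertible A}" using AH HD(1)[OF AH] unfolding P_def by auto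
    next
      fix A assume "A \<in> {A. \<forall>p\<in>P. p A = 0} \<inter> {A. invertible A}"
      then have i: "invertible A" and p: "\<And>p. p \<in> P \<Longrightarrow> p A = 0" by auto
      have AH: "A \<in> H" by (rule mem_linear_algebraic_groupI[OF H i]) (rule p, simp add: P_def)
      have "A - mat 1 \<in> R"
      proof (rule ccontr)
        assume "A - mat 1 \<notin> R"
        then obtain f where f: "Vector_Spaces.linear mscale (*) f" "\<forall>B\<in>R. f B = 0" "f (A - mat 1) = (1::'k)"
          using M.exists_functional[OF sR] by blast
        interpret f: Vector_Spaces.linear mscale "(*)" f by (rule f)
        have "(\<lambda>A. f A + (- f (mat 1))) \<in> P" unfolding P_def using f(1,2) by blast
        then have "f A + (- f (mat 1)) = 0" by (rule p)
        then show False using f(3) f.diff[of A "mat 1"] by simp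
      qed
      then show "A \<in> U" using AH unfolding U_def by blast
    qed
    then show ?thesis unfolding closedin_subtopology using closedin_zariski_zero_set[OF P] by blast
  qed
  have lag: "linear_algebraic_group U"
    unfolding linear_algebraic_group_def using closed one mul inv by blast
  have curve: "binomial_curve (A - mat 1) m t \<in> U"
    if A: "A \<in> U" and m: "mpow (A - mat 1) m = 0" "m > 0" for A m t
  proof -
    have AR: "A - mat 1 \<in> R" using A unfolding U_def by blast
    have r: "binomial_curve (A - mat 1) m t - mat 1 \<in> R" unfolding binomial_curve_def
      by (rule Rsum[OF AR m(2)]) (simp add: gbinomial_0)
    have nat: "binomial_curve (A - mat 1) m (of_nat n) \<in> U" for n
    proof (induction n)
      case 0 then show ?case by (simp add: binomial_curve_0[OF m(2)] one)
    next
      case (Suc n)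
      have "binomial_curve (A - mat 1) m (of_nat (Suc n)) = binomial_curve (A - mat 1) m (of_nat n) ** A"
        using binomial_curve_Suc[OF m, of "of_nat n"] by (simp add: add.commute)
      then show ?case using mul[OF Suc A] by simp
    qed
    have "binomial_curve (A - mat 1) m t \<in> H"
    proof (rule inH[OF r])
      fix p assume p: "polynomial_fun mscale p" "\<forall>B\<in>H. p B = 0"
      obtain q where q: "\<And>t. p (binomial_curve (A - mat 1) m t) = poly q t"
        using polynomial_fun_on_binomial_curve[OF p(1)] by blast
      have "poly q (of_nat n) = 0" for n using q[of "of_nat n"] nat[of n] p(2) unfolding U_def by auto
      then have "q = 0" by (rule poly_0_if_nat_zeros)
      then show "p (binomial_curve (A - mat 1) m t) = 0" using q by simp
    qed
    then show ?thesis using r unfolding U_def by blast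
  qed
  \<comment> \<open>Two open sets that meet a curve in \<open>U\<close> meet it in a common point, as the product of two nonzero
    polynomials in \<open>t\<close> is nonzero.\<close>
  have conn: "connectedin (zariski_topology mscale) U"
  proof -
    have "\<not> (E1 \<inter> E2 \<inter> U = {} \<and> mat 1 \<in> E1 \<and> B \<in> E2)"
      if E: "openin (zariski_topology mscale) E1" "openin (zariski_topology mscale) E2" and B: "B \<in> U" for E1 E2 B
    proof
      assume a: "E1 \<inter> E2 \<inter> U = {} \<and> mat 1 \<in> E1 \<and> B \<in> E2"
      have BR: "B - mat 1 \<in> R" using B unfolding U_def by blast
      obtain m where m0: "mpow (B - mat 1) m = 0" using nilR[OF BR] by blast
      have m: "mpow (B - mat 1) (Suc m) = 0" using m0 by simp
      let ?g = "binomial_curve (B - mat 1) (Suc m)"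
      have g0: "?g 0 = mat 1" by (rule binomial_curve_0) simp
      have g1: "?g 1 = B" using binomial_curve_Suc[OF m, of 0] g0 by simp
      obtain P1 where P1: "P1 \<subseteq> {p. polynomial_fun mscale p}" "E1 = {x. \<exists>p\<in>P1. p x \<noteq> 0}"
        using E(1) unfolding openin_zariski_topology by (elim exE conjE)
      obtain P2 where P2: "P2 \<subseteq> {p. polynomial_fun mscale p}" "E2 = {x. \<exists>p\<in>P2. p x \<noteq> 0}"
        using E(2) unfolding openin_zariski_topology by (elim exE conjE)
      obtain p1 where p1: "p1 \<in> P1" "p1 (mat 1) \<noteq> 0" using a P1(2) by auto
      obtain p2 where p2: "p2 \<in> P2" "p2 B \<noteq> 0" using a P2(2) by auto
      have pp: "polynomial_fun mscale p1" "polynomial_fun mscale p2" using p1 p2 P1 P2 by auto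
      obtain r1 where r1: "\<And>t. p1 (?g t) = poly r1 t" using polynomial_fun_on_binomial_curve[OF pp(1)] by blast
      obtain r2 where r2: "\<And>t. p2 (?g t) = poly r2 t" using polynomial_fun_on_binomial_curve[OF pp(2)] by blast
      have "r1 \<noteq> 0" "r2 \<noteq> 0" using r1[of 0] r2[of 1] g0 g1 p1 p2 by auto
      then have "finite {t. poly (r1 * r2) t = 0}" by (intro poly_roots_finite) simp
      then obtain t where "poly (r1 * r2) t \<noteq> 0" using ex_new_if_finite[OF infinite_UNIV_char_0] by blast
      then have "p1 (?g t) \<noteq> 0" "p2 (?g t) \<noteq> 0" using r1 r2 by auto
      then have "?g t \<in> E1" "?g t \<in> E2" using P1(2) P2(2) p1(1) p2(1) by auto
      moreover have "?g t \<in> U" by (rule curve[OF B m]) simp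
      ultimately show False using a by blast
    qed note sep = this
    show ?thesis unfolding connectedin topspace_zariski
    proof (intro conjI notI)
      assume "\<exists>E1 E2. openin (zariski_topology mscale) E1 \<and> openin (zariski_topology mscale) E2 \<and>
            U \<subseteq> E1 \<union> E2 \<and> E1 \<inter> E2 \<inter> U = {} \<and> E1 \<inter> U \<noteq> {} \<and> E2 \<inter> U \<noteq> {}"
      then obtain E1 E2 where E: "openin (zariski_topology mscale) E1" "openin (zariski_topology mscale) E2"
            "U \<subseteq> E1 \<union> E2" "E1 \<inter> E2 \<inter> U = {}" "E1 \<inter> U \<noteq> {}" "E2 \<inter> U \<noteq> {}" by (elim exE conjE)
      obtain B1 B2 where B: "B1 \<in> E1" "B1 \<in> U" "B2 \<in> E2" "B2 \<in> U" using E by blast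
      have e': "E2 \<inter> E1 \<inter> U = {}" using E(4) by blast
      have "mat 1 \<in> E1 \<or> mat 1 \<in> E2" using one E(3) by blast
      then show False using sep[OF E(1,2) B(4)] sep[OF E(2,1) B(2)] E(4) e' B by blast
    qed simp
  qed
  have conjL: "A ** Y ** matrix_inv A \<in> lie_algebra_of H" "matrix_inv A ** Y ** A \<in> lie_algebra_of H"
    if A: "A \<in> H" and Y: "Y \<in> lie_algebra_of H" for A Y
    using lie_algebra_of_conj[OF H A Y] lie_algebra_of_conj[OF H HD(4)[OF A] Y]
    unfolding matrix_inv_matrix_inv(2)[OF HD(1)[OF A]] by auto
  have normal: "A ** B ** matrix_inv A \<in> U" if A: "A \<in> H" and B: "B \<in> U" for A B
  proof -
    have BH: "B \<in> H" and BR: "B - mat 1 \<in> R" using B unfolding U_def by auto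
    have "A ** (B - mat 1) ** matrix_inv A \<in> R"
      unfolding R_def by (rule trace_radical_conj[OF HD(1)[OF A] conjL(1)[OF A] conjL(2)[OF A] BR[unfolded R_def]])
    then have "A ** B ** matrix_inv A - mat 1 \<in> R"
      by (simp add: mat_diff_left mat_diff_right matrix_inv_props[OF HD(1)[OF A]])
    then show ?thesis unfolding U_def using HD(3)[OF HD(3)[OF A BH] HD(4)[OF A]] by blast
  qed
  have unip: "unipotent_matrix B" if "B \<in> U" for B
    using nilR[of "B - mat 1"] that unipotent_matrix_if_mpow unfolding U_def by blast
  have U1: "U = {mat 1}"
    using red lag conn normal unip unfolding reductive_group_def connected_linear_algebraic_group_def
    by (metis (no_types, lifting) U_def mem_Collect_eq subsetI)
  have XR: "X \<in> R" unfolding R_def by (rule X)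
  obtain m0 where m0: "mpow X m0 = 0" using nilR[OF XR] by blast
  then have m: "mpow X (Suc (Suc m0)) = 0" by simp
  let ?e = "mexp_poly X (Suc (Suc m0)) 1"
  have eR: "?e - mat 1 \<in> R" unfolding mexp_poly_def by (rule Rsum[OF XR]) simp_all
  have "?e \<in> H" by (rule inH[OF eR]) (rule exp_in_group[OF H X(1) m], auto)
  then have e1: "?e = mat 1" using eR U1 unfolding U_def by blast
  \<comment> \<open>The exponential series minus one is the product of \<open>X\<close> and a unipotent matrix.\<close>
  define Y where "Y = (\<Sum>i<Suc m0. mscale (1 / fact (Suc i)) (mpow X i))"
  have "?e = mat 1 + (\<Sum>i<Suc m0. mscale (1 / fact (Suc i)) (mpow X (Suc i)))"
    unfolding mexp_poly_def by (simp add: sum.lessThan_Suc_shift[of _ "Suc m0"] del: sum.lessThan_Suc mpow.simps fact_Suc) simp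
  also have "(\<Sum>i<Suc m0. mscale (1 / fact (Suc i)) (mpow X (Suc i))) = X ** Y"
    unfolding Y_def by (simp add: mat_sum_right mscale_mult_right del: sum.lessThan_Suc fact_Suc)
  finally have XY: "X ** Y = 0" using e1 by simp
  have "Y - mat 1 \<in> R" unfolding Y_def by (rule Rsum[OF XR]) simp_all
  then obtain m1 where "mpow (Y - mat 1) m1 = 0" using nilR by blast
  then have "invertible (mat 1 + (Y - mat 1))" by (rule invertible_one_plus_nilpotent)
  then have "invertible Y" by simp
  then have "X = X ** Y ** matrix_inv Y" using matrix_inv_props by (metis matrix_mul_assoc matrix_mul_rid)
  then show ?thesis using XY by simp
qed

text \<open>All matrices in the associative algebra generated by the Lie algebra are sums of vectors of weights
  \<open>0, 1, 2, \<dots>\<close> under \<open>[N, _]\<close>. So a product of \<open>X\<close> with one of them is a sum of vectors of positive weight;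
  being multiples of commutators, these have trace \<open>0\<close>.\<close>

lemma reductive_no_positive_weight:
  fixes H :: "('k::{alg_closed_field,field_char_0}^'n^'n) set"
  assumes red: "reductive_group H"
    and wt: "\<And>Y. Y \<in> lie_algebra_of H \<Longrightarrow>
      \<exists>Y0 Y1. Y = Y0 + Y1 \<and> N ** Y0 - Y0 ** N = 0 \<and> N ** Y1 - Y1 ** N = Y1"
    and X: "X \<in> lie_algebra_of H" "N ** X - X ** N = X"
  shows "X = 0"
proof (rule reductive_trace_radical[OF red X(1)])
  define W where "W = M.span {w. \<exists>i::nat. N ** w - w ** N = mscale (of_nat i) w}"
  have Wbase: "w \<in> W" if "N ** w - w ** N = mscale (of_nat i) w" for w i
    unfolding W_def by (rule M.span_base) (use that in blast)
  have prod: "N ** (w ** w') - w ** w' ** N = mscale (a + b) (w ** w')"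
    if w: "N ** w - w ** N = mscale a w" and w': "N ** w' - w' ** N = mscale b w'" for w w' a b
  proof -
    have "N ** (w ** w') - w ** w' ** N = (N ** w - w ** N) ** w' + w ** (N ** w' - w' ** N)"
      by (simp add: mat_diff_left mat_diff_right matrix_mul_assoc)
    then show ?thesis unfolding w w' by (simp add: mscale_mult_left mscale_mult_right M.scale_left_distrib)
  qed
  have Wmult: "A ** B \<in> W" if A: "A \<in> W" and B: "B \<in> W" for A B
  proof -
    have 1: "w ** B \<in> W" if w: "N ** w - w ** N = mscale (of_nat i) w" for w i
      using B unfolding W_def
    proof (induction rule: M.span_induct_alt)
      case base then show ?case by (simp add: M.span_zero)
    next
      case (step c x y)
      then obtain j :: nat where j: "N ** x - x ** N = mscale (of_nat j) x" by blast
      have "w ** x \<in> W" using prod[OF w j] by (intro Wbase[of _ "i + j"]) simp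
      then show ?case using step unfolding W_def
        by (simp add: matrix_add_ldistrib mscale_mult_right M.span_add M.span_scale)
    qed
    show ?thesis using A unfolding W_def
    proof (induction rule: M.span_induct_alt)
      case base then show ?case by (simp add: M.span_zero)
    next
      case (step c x y)
      then obtain j :: nat where j: "N ** x - x ** N = mscale (of_nat j) x" by blast
      show ?case using step 1[OF j] unfolding W_def
        by (simp add: mat_add_rdistrib mscale_mult_left M.span_add M.span_scale)
    qed
  qed
  have algW: "B \<in> W" if "B \<in> generated_algebra (lie_algebra_of H)" for B
    using that
  proof induction
    case one then show ?case by (rule Wbase[of _ 0]) simp
  next
    case (gen Y)
    then obtain Y0 Y1 where Y: "Y = Y0 + Y1" "N ** Y0 - Y0 ** N = 0" "N ** Y1 - Y1 ** N = Y1" using wt by blast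
    have "Y0 \<in> W" "Y1 \<in> W" using Wbase[of Y0 0] Wbase[of Y1 1] Y by simp_all
    then show ?case unfolding Y(1) W_def by (rule M.span_add)
  next
    case (add A B) then show ?case unfolding W_def by (intro M.span_add)
  next
    case (mult A B) then show ?case by (intro Wmult)
  next
    case (scale A c) then show ?case unfolding W_def by (intro M.span_scale)
  qed
  have tr0: "trace (X ** B) = 0" if "B \<in> W" for B
    using that unfolding W_def
  proof (induction rule: M.span_induct_alt)
    case base then show ?case by (simp add: trace_def)
  next
    case (step c x y)
    then obtain j :: nat where j: "N ** x - x ** N = mscale (of_nat j) x" by blast
    have X1: "N ** X - X ** N = mscale 1 X" using X(2) by simp
    have "trace (N ** (X ** x) - X ** x ** N) = (1 + of_nat j) * trace (X ** x)"
      unfolding prod[OF X1 j] trace_mscale ..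
    moreover have "trace (N ** (X ** x) - X ** x ** N) = 0"
      unfolding trace_sub using trace_mul_sym[of N "X ** x"] by simp
    moreover have "(1 + of_nat j :: 'k) \<noteq> 0" using of_nat_neq_0[of j, where 'a='k] by (simp add: add.commute)
    ultimately have "trace (X ** x) = 0" by simp
    then show ?case using step by (simp add: matrix_add_ldistrib mscale_mult_right trace_add trace_mscale)
  qed
  show "X \<in> trace_radical (lie_algebra_of H)"
    unfolding trace_radical_def using generated_algebra.gen[OF X(1)] tr0 algW by blast
qed

section \<open>The dense orbit\<close>

text \<open>A determinant-free form of the fact that independence is detected by a minor. Gaussian elimination
  with polynomial coefficients: a functional \<open>f\<close> that does not kill the pivot \<open>a j v0\<close> serves to replace
  the remaining vectors by the \<open>b i\<close>, on which \<open>f\<close> vanishes.\<close>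

lemma (in vector_space) independence_is_zariski_open:
  assumes "finite I"
    and "\<And>i f. i \<in> I \<Longrightarrow> Vector_Spaces.linear scale (*) f \<Longrightarrow> polynomial_fun scale (\<lambda>v. f (a i v))"
    and "\<And>c. (\<Sum>i\<in>I. scale (c i) (a i v0)) = 0 \<Longrightarrow> \<forall>i\<in>I. c i = 0"
  shows "\<exists>p. polynomial_fun scale p \<and> p v0 \<noteq> 0 \<and>
     (\<forall>v. p v \<noteq> 0 \<longrightarrow> (\<forall>c. (\<Sum>i\<in>I. scale (c i) (a i v)) = 0 \<longrightarrow> (\<forall>i\<in>I. c i = 0)))"
  using assms
proof (induction I arbitrary: a rule: finite_induct)
  case empty
  show ?case by (rule exI[of _ "\<lambda>_. 1"]) (simp add: polynomial_fun.const)
next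
  case (insert j I)
  have "a j v0 \<noteq> 0"
  proof
    assume "a j v0 = 0"
    then have "(\<Sum>i\<in>insert j I. scale (if i = j then 1 else 0) (a i v0)) = 0"
      by (intro sum.neutral) auto
    then show False using insert.prems(2)[of "\<lambda>i. if i = j then 1 else 0"] by auto
  qed
  then obtain f where f: "Vector_Spaces.linear scale (*) f" "f (a j v0) = 1"
    using exists_functional[OF subspace_single_0, of "a j v0"] by auto
  interpret f: Vector_Spaces.linear scale "(*)" f by fact
  have fa: "polynomial_fun scale (\<lambda>v. f (a i v))" if "i \<in> insert j I" for i
    by (rule insert.prems(1)[OF that f(1)])
  define b where "b = (\<lambda>i v. scale (f (a j v)) (a i v) - scale (f (a i v)) (a j v))"
  have sum_b: "(\<Sum>i\<in>I. scale (c i) (b i v))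
      = scale (f (a j v)) (\<Sum>i\<in>I. scale (c i) (a i v)) - scale (\<Sum>i\<in>I. c i * f (a i v)) (a j v)" for c v
    unfolding b_def
    by (simp add: scale_right_diff_distrib sum_subtractf scale_sum_right scale_sum_left mult.commute)
  have "\<exists>p. polynomial_fun scale p \<and> p v0 \<noteq> 0 \<and>
     (\<forall>v. p v \<noteq> 0 \<longrightarrow> (\<forall>c. (\<Sum>i\<in>I. scale (c i) (b i v)) = 0 \<longrightarrow> (\<forall>i\<in>I. c i = 0)))"
  proof (rule insert.IH)
    fix i g assume i: "i \<in> I" and g: "Vector_Spaces.linear scale (*) g"
    interpret g: Vector_Spaces.linear scale "(*)" g by fact
    have "polynomial_fun scale (\<lambda>v. f (a j v) * g (a i v) + (- 1) * (f (a i v) * g (a j v)))"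
      using i by (intro polynomial_fun.add polynomial_fun.mult polynomial_fun.const fa insert.prems(1)[OF _ g]) auto
    then show "polynomial_fun scale (\<lambda>v. g (b i v))" by (simp add: b_def g.diff g.scale)
  next
    fix c assume "(\<Sum>i\<in>I. scale (c i) (b i v0)) = 0"
    then have z: "(\<Sum>i\<in>I. scale (c i) (a i v0)) - scale (\<Sum>i\<in>I. c i * f (a i v0)) (a j v0) = 0"
      unfolding sum_b f(2) by simp
    define d where "d = (\<lambda>i. if i = j then - (\<Sum>i\<in>I. c i * f (a i v0)) else c i)"
    have "(\<Sum>i\<in>I. scale (d i) (a i v0)) = (\<Sum>i\<in>I. scale (c i) (a i v0))"
      by (intro sum.cong refl) (use insert.hyps in \<open>auto simp: d_def\<close>)
    then have "(\<Sum>i\<in>insert j I. scale (d i) (a i v0)) = 0"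
      using z insert.hyps by (simp add: d_def)
    then have "\<forall>i\<in>insert j I. d i = 0" by (rule insert.prems(2))
    then show "\<forall>i\<in>I. c i = 0" using insert.hyps by (metis d_def insertCI)
  qed
  then obtain p where p: "polynomial_fun scale p" "p v0 \<noteq> 0"
    "\<And>v c. p v \<noteq> 0 \<Longrightarrow> (\<Sum>i\<in>I. scale (c i) (b i v)) = 0 \<Longrightarrow> \<forall>i\<in>I. c i = 0" by blast
  have "\<forall>i\<in>insert j I. c i = 0"
    if v: "p v * f (a j v) \<noteq> 0" and s: "(\<Sum>i\<in>insert j I. scale (c i) (a i v)) = 0" for v c
  proof -
    have s': "(\<Sum>i\<in>I. scale (c i) (a i v)) = - scale (c j) (a j v)"
      using s insert.hyps by (simp add: add.commute eq_neg_iff_add_eq_0)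
    have "f (\<Sum>i\<in>I. scale (c i) (a i v)) = (\<Sum>i\<in>I. c i * f (a i v))" by (simp add: f.sum f.scale)
    then have "(\<Sum>i\<in>I. c i * f (a i v)) = - (c j * f (a j v))" unfolding s' by (simp add: f.neg f.scale)
    then have "(\<Sum>i\<in>I. scale (c i) (b i v)) = 0" unfolding sum_b s' by (simp add: mult.commute)
    then have cI: "\<forall>i\<in>I. c i = 0" using p(3)[of v c] v by simp
    then have "(\<Sum>i\<in>I. scale (c i) (a i v)) = 0" by (intro sum.neutral) simp
    then have "scale (c j) (a j v) = 0" unfolding s' by simp
    moreover have "a j v \<noteq> 0" using v f.zero by auto
    ultimately show ?thesis using cI by simp
  qed
  moreover have "polynomial_fun scale (\<lambda>v. p v * f (a j v))" by (intro polynomial_fun.mult p(1) fa) simp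
  moreover have "p v0 * f (a j v0) \<noteq> 0" using p(2) f(2) by simp
  ultimately show ?case by (intro exI[of _ "\<lambda>v. p v * f (a j v)"]) blast
qed

context short_graded_algebra
begin

lemma regularity_is_zariski_open:
  "\<exists>p. polynomial_fun scale p \<and> (\<exists>v\<in>gr 1. p v \<noteq> 0) \<and>
     (\<forall>v. p v \<noteq> 0 \<longrightarrow> (\<forall>y\<in>gr (-1). bracket v y = 0 \<longrightarrow> y = 0))"
proof -
  obtain v0 where v0: "v0 \<in> gr 1" "\<And>y. y \<in> gr (-1) \<Longrightarrow> bracket v0 y = 0 \<Longrightarrow> y = 0" using exists_regular by blast
  obtain B where B: "B \<subseteq> gr (-1)" "independent B" "gr (-1) \<subseteq> span B" using basis_exists[of "gr (-1)"] by metis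
  have fB: "finite B" by (rule finiteI_independent[OF B(2)])
  have sumB: "(\<Sum>b\<in>B. scale (c b) (bracket v b)) = bracket v (\<Sum>b\<in>B. scale (c b) b)" for c v
    by (simp add: lin_sum[OF lin_ad] bracket_scale_right)
  have memB: "(\<Sum>b\<in>B. scale (c b) b) \<in> gr (-1)" for c
    using B(1) by (intro subspace_sum subspace_scale subspace_gr) auto
  have "\<exists>p. polynomial_fun scale p \<and> p v0 \<noteq> 0 \<and>
     (\<forall>v. p v \<noteq> 0 \<longrightarrow> (\<forall>c. (\<Sum>b\<in>B. scale (c b) (bracket v b)) = 0 \<longrightarrow> (\<forall>b\<in>B. c b = 0)))"
  proof (rule independence_is_zariski_open[OF fB])
    fix b f assume "Vector_Spaces.linear scale (*) f"
    then have "Vector_Spaces.linear scale (*) (f \<circ> (\<lambda>v. bracket v b))"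
      by (rule Vector_Spaces.linear_compose[OF linear_left])
    then show "polynomial_fun scale (\<lambda>v. f (bracket v b))"
      using polynomial_fun.functional[of scale "f \<circ> (\<lambda>v. bracket v b)"] by (simp add: o_def)
  next
    fix c assume "(\<Sum>b\<in>B. scale (c b) (bracket v0 b)) = 0"
    then have "(\<Sum>b\<in>B. scale (c b) b) = 0" unfolding sumB by (rule v0(2)[OF memB])
    then show "\<forall>b\<in>B. c b = 0" using independentD[OF B(2) fB subset_refl] by blast
  qed
  then obtain p where p: "polynomial_fun scale p" "p v0 \<noteq> 0"
     "\<And>v c. p v \<noteq> 0 \<Longrightarrow> (\<Sum>b\<in>B. scale (c b) (bracket v b)) = 0 \<Longrightarrow> \<forall>b\<in>B. c b = 0" by blast
  have "y = 0" if v: "p v \<noteq> 0" and y: "y \<in> gr (-1)" "bracket v y = 0" for v y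
  proof -
    have e: "(\<Sum>b\<in>B. scale (representation B y b) b) = y"
      using sum_representation_eq[OF B(2) _ fB subset_refl, of y] B(3) y(1) by blast
    have "(\<Sum>b\<in>B. scale (representation B y b) (bracket v b)) = 0" unfolding sumB e by (rule y(2))
    then have "\<forall>b\<in>B. representation B y b = 0" by (rule p(3)[OF v])
    then have "(\<Sum>b\<in>B. scale (representation B y b) b) = 0" by (intro sum.neutral) simp
    then show ?thesis using e by simp
  qed
  then show ?thesis using p v0(1) by blast
qed

text \<open>Some point \<open>w = Ad A e\<close> of the dense orbit lies in the nonempty open set of regular elements, and \<open>Ad A\<close>
  maps \<open>[gr 0, e]\<close> onto \<open>[gr 0, w] = gr 1\<close>, because it preserves \<open>gr 0\<close>. The dimensions of
  \<open>[gr 0, e] \<subseteq> gr 1\<close> and \<open>gr 1\<close> therefore agree.\<close>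

lemma dense_orbit_regular:
  fixes G G0 :: "('k^'n^'n) set"
  assumes G: "linear_algebraic_group G" and iso: "lie_algebra_iso \<phi> G"
    and G0: "linear_algebraic_group G0" "G0 \<subseteq> G" "lie_algebra_of G0 = \<phi> ` gr 0"
    and e: "e \<in> gr 1"
    and dense: "zariski_topology scale closure_of {Ad \<phi> A e | A. A \<in> G0} = gr 1"
  shows "(\<lambda>x. bracket x e) ` gr 0 = gr 1"
proof -
  have inj: "inj \<phi>" and ran: "range \<phi> = lie_algebra_of G"
    and lin\<phi>: "Vector_Spaces.linear scale mscale \<phi>"
    and br: "\<And>x y. \<phi> (bracket x y) = \<phi> x ** \<phi> y - \<phi> y ** \<phi> x"
    using iso unfolding lie_algebra_iso_def by auto
  interpret \<phi>: Vector_Spaces.linear scale mscale \<phi> by (rule lin\<phi>)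
  note HD = linear_algebraic_groupD[OF G]
  have Ad: "\<phi> (Ad \<phi> A x) = A ** \<phi> x ** matrix_inv A" if A: "A \<in> G" for A x
  proof -
    have "A ** \<phi> x ** matrix_inv A \<in> range \<phi>"
      unfolding ran by (rule lie_algebra_of_conj[OF G A]) (simp add: ran[symmetric])
    then show ?thesis unfolding Ad_def by (rule f_inv_into_f)
  qed
  have linAd: "lin (Ad \<phi> A)" if A: "A \<in> G" for A
  proof (rule linI)
    show "Ad \<phi> A (x + y) = Ad \<phi> A x + Ad \<phi> A y" for x y
      by (rule injD[OF inj]) (simp add: Ad[OF A] \<phi>.add matrix_add_ldistrib mat_add_rdistrib)
    show "Ad \<phi> A (scale c x) = scale c (Ad \<phi> A x)" for c x
      by (rule injD[OF inj]) (simp add: Ad[OF A] \<phi>.scale mscale_mult_left mscale_mult_right)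
  qed
  have Ad_br: "Ad \<phi> A (bracket x y) = bracket (Ad \<phi> A x) (Ad \<phi> A y)" if A: "A \<in> G" for A x y
    by (rule injD[OF inj])
      (simp add: Ad[OF A] br mat_diff_left mat_diff_right conj_mult[OF HD(1)[OF A], symmetric])
  have Ad0: "Ad \<phi> A x \<in> gr 0" if A: "A \<in> G0" and x: "x \<in> gr 0" for A x
  proof -
    have "A ** \<phi> x ** matrix_inv A \<in> lie_algebra_of G0"
      by (rule lie_algebra_of_conj[OF G0(1) A]) (simp add: G0(3) x)
    then obtain z where z: "z \<in> gr 0" "A ** \<phi> x ** matrix_inv A = \<phi> z" unfolding G0(3) by blast
    then have "Ad \<phi> A x = z" using Ad[of A x] A G0(2) injD[OF inj] by auto
    then show ?thesis using z(1) by simp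
  qed
  have Ad_inv: "Ad \<phi> A (Ad \<phi> (matrix_inv A) x) = x" if A: "A \<in> G" for A x
  proof (rule injD[OF inj])
    have "A ** (matrix_inv A ** \<phi> x ** A) ** matrix_inv A = \<phi> x" by (rule conj_conj_inv[OF HD(1)[OF A]])
    then show "\<phi> (Ad \<phi> A (Ad \<phi> (matrix_inv A) x)) = \<phi> x"
      by (simp add: Ad[OF A] Ad[OF HD(4)[OF A]] matrix_inv_matrix_inv(2)[OF HD(1)[OF A]])
  qed
  let ?O = "{Ad \<phi> A e | A. A \<in> G0}"
  obtain p v0 where p: "polynomial_fun scale p" "v0 \<in> gr 1" "p v0 \<noteq> 0"
     "\<And>v y. p v \<noteq> 0 \<Longrightarrow> y \<in> gr (-1) \<Longrightarrow> bracket v y = 0 \<Longrightarrow> y = 0"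
    using regularity_is_zariski_open by blast
  have op: "openin (zariski_topology scale) {x. p x \<noteq> 0}"
    unfolding openin_zariski_topology by (rule exI[of _ "{p}"]) (simp add: p(1))
  have "v0 \<in> zariski_topology scale closure_of ?O" unfolding dense by (rule p(2))
  then have "\<forall>T. v0 \<in> T \<and> openin (zariski_topology scale) T \<longrightarrow> (\<exists>y. y \<in> ?O \<and> y \<in> T)"
    unfolding in_closure_of by (rule conjunct2)
  then have "\<exists>y. y \<in> ?O \<and> y \<in> {x. p x \<noteq> 0}"
    by (elim allE[of _ "{x. p x \<noteq> 0}"] mp) (simp add: p(3) op)
  then obtain w A where A: "A \<in> G0" and w: "w = Ad \<phi> A e" "p w \<noteq> 0" by blast
  have AG: "A \<in> G" using A G0(2) by blast
  have "?O \<subseteq> zariski_topology scale closure_of ?O"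
    by (rule closure_of_subset) (simp add: topspace_zariski)
  then have w1: "w \<in> gr 1" unfolding dense using A w(1) by blast
  have sw: "(\<lambda>x. bracket x w) ` gr 0 = gr 1" by (rule ad_surjective_if_injective[OF w1 p(4)[OF w(2)]])
  let ?W = "(\<lambda>x. bracket x e) ` gr 0"
  have sW: "subspace ?W"
    by (rule subspace_lin_image[OF linear_left subspace_gr])
  have "gr 1 \<subseteq> Ad \<phi> A ` ?W"
  proof
    fix u assume "u \<in> gr 1"
    then obtain x where x: "x \<in> gr 0" "u = bracket x w" using sw by blast
    have "u = Ad \<phi> A (bracket (Ad \<phi> (matrix_inv A) x) e)"
      unfolding Ad_br[OF AG] Ad_inv[OF AG] x(2) w(1) ..
    then show "u \<in> Ad \<phi> A ` ?W" using Ad0[OF linear_algebraic_groupD(4)[OF G0(1) A] x(1)] by blast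
  qed
  then have "dim (gr 1) \<le> dim (Ad \<phi> A ` ?W)" by (rule dim_subset)
  also have "\<dots> \<le> dim ?W"
  proof -
    interpret fp: finite_dimensional_vector_space_pair_1 scale Basis scale by unfold_locales
    show ?thesis by (rule fp.dim_image_le[OF linAd[OF AG]])
  qed
  finally have "dim (gr 1) \<le> dim ?W" .
  moreover have "?W \<subseteq> gr 1" using gr_bracket[OF _ e, of _ 0 1] by auto
  ultimately show ?thesis by (intro subspace_dim_equal[OF sW subspace_gr])
qed

end

theorem theorem6p2:
  fixes scale :: "'k::{alg_closed_field,field_char_0} \<Rightarrow> 'g::ab_group_add \<Rightarrow> 'g"
    and Basis :: "'g set"
    and bracket :: "'g \<Rightarrow> 'g \<Rightarrow> 'g"
    and G G0 :: "('k^'n^'n) set"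
    and \<phi> :: "'g \<Rightarrow> 'k^'n^'n"
    and \<sigma>\<^sub>1 :: "'g \<Rightarrow> 'g"
    and gr :: "int \<Rightarrow> 'g set"
    and e :: 'g
  assumes "lie_algebra scale Basis bracket"
    and "lie_algebra.simple scale bracket"
    and "connected_linear_algebraic_group G"
    and "lie_algebra.lie_algebra_iso scale bracket \<phi> G"
    and "lie_algebra.hermitian_involution scale bracket \<sigma>\<^sub>1"
    and "lie_algebra.short_grading scale bracket gr"
    and "lie_algebra.associated_grading \<sigma>\<^sub>1 gr"
    and "connected_linear_algebraic_group G0" and "G0 \<subseteq> G"
    and "lie_algebra_of G0 = \<phi> ` gr 0"
    and "e \<in> gr 1"
    and "zariski_topology scale closure_of {lie_algebra.Ad \<phi> A e | A. A \<in> G0} = gr 1"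
    and "lie_algebra.reductive_algebraic \<phi> {x \<in> gr 0. bracket x e = 0}"
  shows "\<exists>\<sigma>\<^sub>2 \<sigma>\<^sub>3. lie_algebra.triad scale bracket {\<sigma>\<^sub>1, \<sigma>\<^sub>2, \<sigma>\<^sub>3}"
proof -
  interpret lie_algebra scale Basis bracket by fact
  interpret short_graded_algebra scale Basis bracket gr
    by unfold_locales (fact assms)+
  note e = \<open>e \<in> gr 1\<close>
  have G: "linear_algebraic_group G" and G0: "linear_algebraic_group G0"
    using assms(3,8) unfolding connected_linear_algebraic_group_def by auto
  note sur = dense_orbit_regular[OF G assms(4) G0 assms(9,10) e assms(12)]
  obtain f h where mem: "f \<in> gr (-1)" "h \<in> gr 0"
    and T: "bracket e f = h" "bracket h e = scale 2 e" "bracket h f = scale (-2) f"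
    using jacobson_morozov_graded[OF e sur] by blast
  have inj: "inj \<phi>" and lin\<phi>: "Vector_Spaces.linear scale mscale \<phi>"
    and br: "\<And>x y. \<phi> (bracket x y) = \<phi> x ** \<phi> y - \<phi> y ** \<phi> x"
    using assms(4) unfolding lie_algebra_iso_def by auto
  interpret \<phi>: Vector_Spaces.linear scale mscale \<phi> by (rule lin\<phi>)
  obtain H where H: "reductive_group H" "lie_algebra_of H = \<phi> ` {x \<in> gr 0. bracket x e = 0}"
    using assms(13) unfolding reductive_algebraic_def by blast
  \<comment> \<open>Reductivity excludes weight \<open>1\<close> in the centraliser: an element \<open>y\<close>
    of it is the sum of \<open>y - [h, y]\<close> of weight \<open>0\<close> and \<open>[h, y]\<close> of weight \<open>1\<close>.\<close>
  have no1: "x = 0" if x: "x \<in> gr 0" "bracket x e = 0" "bracket h x = x" for x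
  proof -
    have "\<phi> x = 0"
    proof (rule reductive_no_positive_weight[OF H(1), of "\<phi> h"])
      fix Y assume "Y \<in> lie_algebra_of H"
      then obtain y where y: "y \<in> gr 0" "bracket y e = 0" "Y = \<phi> y" unfolding H(2) by blast
      have "bracket e y = 0" using y(2) anticommute[of e y] by simp
      then have hh: "bracket h (bracket h y) = bracket h y"
        by (rule centralizer_weights[OF T e mem(2,1) y(1)])
      show "\<exists>Y0 Y1. Y = Y0 + Y1 \<and> \<phi> h ** Y0 - Y0 ** \<phi> h = 0 \<and> \<phi> h ** Y1 - Y1 ** \<phi> h = Y1"
      proof (intro exI conjI)
        show "Y = \<phi> (y - bracket h y) + \<phi> (bracket h y)" unfolding y(3) \<phi>.add[symmetric] by simp
        show "\<phi> h ** \<phi> (y - bracket h y) - \<phi> (y - bracket h y) ** \<phi> h = 0"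
          unfolding br[symmetric] bracket_diff_right hh by (simp add: \<phi>.zero)
        show "\<phi> h ** \<phi> (bracket h y) - \<phi> (bracket h y) ** \<phi> h = \<phi> (bracket h y)"
          unfolding br[symmetric] hh ..
      qed
    next
      show "\<phi> x \<in> lie_algebra_of H" unfolding H(2) using x by blast
      show "\<phi> h ** \<phi> x - \<phi> x ** \<phi> h = \<phi> x" unfolding br[symmetric] x(3) ..
    qed
    then show ?thesis using injD[OF inj, of x 0] \<phi>.zero by simp
  qed
  note hD = characteristic_of_triple[OF T e mem(2,1) sur no1]
  have inv: "involution \<sigma>\<^sub>1" using assms(5) unfolding hermitian_involution_def by blast
  have s0: "\<sigma>\<^sub>1 x = x" if "x \<in> gr 0" for x
    using assms(7) that unfolding associated_grading_def by blast
  have sm: "\<sigma>\<^sub>1 (y + z) = - (y + z)" if "y \<in> gr (-1)" "z \<in> gr 1" for y z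
    using assms(7) that unfolding associated_grading_def by blast
  show ?thesis
    by (rule triad_from_triple[OF T e mem(1) hD inv s0])
      (use sm[OF gr_0_mem] sm[OF _ gr_0_mem] in auto)
qed

end
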